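(* Let $(M,g,\Phi)$ be a locally conformal parallel ${\rm Spin}(7)$-structure on an $8$-dimensional Riemannian manifold, with intrinsic torsion $\xi$, Lee form $\theta$ and minimal ${\rm Spin}(7)$-connection $\nabla^{{\rm Spin}(7)}$. Then the structure is second order nearly parallel, i.e. $\nabla^{{\rm Spin}(7)}r=0$ where $r(X,Y)=\sum_i g(\xi_Xe_i,\xi_Ye_i)$, if and only if $\nabla^{{\rm Spin}(7)}\theta=0$.
   Context: A ${\rm Spin}(7)$-structure on an $8$-dimensional Riemannian manifold $(M,g)$ is a global $4$-form $\Phi$ such that around each point there is a local orthonormal frame $e_0,\dots,e_7$ with dual coframe $e^0,\dots,e^7$ in which (writing $e^{ijkl}=e^i\wedge e^j\wedge e^k\wedge e^l$) $$\Phi=e^{0123}-e^{0145}-e^{0167}-e^{0246}+e^{0257}-e^{0347}-e^{0356}+e^{4567}-e^{2367}-e^{2345}-e^{1357}+e^{1346}-e^{1256}-e^{1247}.$$ $M$ is oriented by $e^{01234567}$, $\star$ is the Hodge star, $\star\Phi=\Phi$, and $\delta\Phi=-\star d\star\Phi$ is the codifferential. ${\rm Spin}(7)\subset SO(8)$ is the stabilizer of $\Phi$. Pointwise, $\Lambda^2=\Lambda^2_7\oplus\Lambda^2_{21}$ with $\Lambda^2_7=\{\omega:\star(\Phi\wedge\omega)=3\omega\}$ and $\Lambda^2_{21}=\{\omega:\star(\Phi\wedge\omega)=-\omega\}$. Skew endomorphisms $A$ of $TM$ are identified with $2$-forms via $(Y,Z)\mapsto g(AY,Z)$; with this identification $\mathfrak{so}(8)=\mathfrak{spin}(7)\oplus\mathfrak{spin}(7)^{\perp}$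 corresponds to $\Lambda^2=\Lambda^2_{21}\oplus\Lambda^2_7$. Lee form: $\theta=\frac{1}{7}\star(\delta\Phi\wedge\Phi)$. The structure is locally conformal parallel (type $\mathcal{W}_8$) if $d\Phi=\theta\wedge\Phi$; equivalently, its intrinsic torsion is $\xi_X=\frac14(X^\flat\wedge\theta)_7$, where the subscript $7$ denotes the $\Lambda^2_7$-component. Let $\nabla$ be the Levi-Civita connection. The minimal ${\rm Spin}(7)$-connection $\nabla^{{\rm Spin}(7)}$ is the connection given by the $\mathfrak{spin}(7)$-component of the Levi-Civita connection form; the intrinsic torsion is the $(1,2)$-tensor $\xi=\nabla^{{\rm Spin}(7)}-\nabla$. Equivalently, $\nabla^{{\rm Spin}(7)}=\nabla+\xi$ is the unique metric connection with $\nabla^{{\rm Spin}(7)}\Phi=0$ and $\xi_X\in\Lambda^2_7$ for all $X$. In the definition of the symmetric $2$-tensor $r$, $(e_i)$ is any local orthonormal frame. *)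

theory Defs
  imports "HOL-Analysis.Analysis" "HOL-Library.Numeral_Type" "HOL-Combinatorics.Permutations"
begin

text \<open>
  Tensor fields on a manifold are given by their local representatives in the charts of an atlas,
  subject to the usual transformation law. In a chart, tangent vectors are elements of
  \<^typ>\<open>real^8\<close>, and a covariant \<open>k\<close>-tensor at a point is a multilinear function of lists of
  length \<open>k\<close> of tangent vectors; its values on lists of other lengths carry no meaning.
  The index type \<^typ>\<open>8\<close> has the elements \<open>0, \<dots>, 7\<close>.
\<close>

type_synonym vec8 = "real^8"
type_synonym tensor = "vec8 list \<Rightarrow> real"
type_synonym basis8 = "8 \<Rightarrow> vec8"
type_synonym 'a chart = "'a set \<times> ('a \<Rightarrow> vec8)"
type_synonym 'a tensor_field = "'a chart \<Rightarrow> vec8 \<Rightarrow> tensor"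
type_synonym 'a connection = "'a chart \<Rightarrow> vec8 \<Rightarrow> vec8 \<Rightarrow> vec8 \<Rightarrow> vec8"


section \<open>Manifolds and tensor fields\<close>

text \<open>\<open>C\<^sup>k\<close> and smooth functions, for open sets \<open>S\<close>.\<close>

primrec Ck_on :: "nat \<Rightarrow> vec8 set \<Rightarrow> (vec8 \<Rightarrow> 'b::real_normed_vector) \<Rightarrow> bool" where
  "Ck_on 0 S f \<longleftrightarrow> continuous_on S f"
| "Ck_on (Suc k) S f \<longleftrightarrow> (\<forall>x\<in>S. f differentiable (at x)) \<and>
     (\<forall>v. Ck_on k S (\<lambda>x. frechet_derivative f (at x) v))"

definition smooth_on :: "vec8 set \<Rightarrow> (vec8 \<Rightarrow> 'b::real_normed_vector) \<Rightarrow> bool" where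
  "smooth_on S f \<longleftrightarrow> (\<forall>k. Ck_on k S f)"

definition coords :: "'a chart \<Rightarrow> vec8 set" where
  "coords c = snd c ` fst c"

definition transition :: "'a chart \<Rightarrow> 'a chart \<Rightarrow> vec8 \<Rightarrow> vec8" where
  "transition c c' = snd c' \<circ> inv_into (fst c) (snd c)"

definition overlap :: "'a chart \<Rightarrow> 'a chart \<Rightarrow> vec8 set" where
  "overlap c c' = snd c ` (fst c \<inter> fst c')"

definition smooth_manifold8 ::
    "'a::{t2_space,second_countable_topology} set \<Rightarrow> 'a chart set \<Rightarrow> bool" where
  "smooth_manifold8 M A \<longleftrightarrow>
     M = (\<Union>c\<in>A. fst c) \<and>
     (\<forall>c\<in>A. openin (top_of_set M) (fst c) \<and> open (coords c) \<and>
        homeomorphism (fst c) (coords c) (snd c) (inv_into (fst c) (snd c))) \<and>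
     (\<forall>c\<in>A. \<forall>c'\<in>A. smooth_on (overlap c c') (transition c c'))"

definition multilinear_tensor :: "nat \<Rightarrow> tensor \<Rightarrow> bool" where
  "multilinear_tensor k \<alpha> \<longleftrightarrow>
     (\<forall>vs i. length vs = k \<longrightarrow> i < k \<longrightarrow> linear (\<lambda>v. \<alpha> (vs[i := v])))"

definition alternating_form :: "nat \<Rightarrow> tensor \<Rightarrow> bool" where
  "alternating_form k \<alpha> \<longleftrightarrow> multilinear_tensor k \<alpha> \<and>
     (\<forall>vs i j. length vs = k \<longrightarrow> i < j \<longrightarrow> j < k \<longrightarrow> vs ! i = vs ! j \<longrightarrow> \<alpha> vs = 0)"

definition smooth_tensor_field :: "'a chart set \<Rightarrow> nat \<Rightarrow> 'a tensor_field \<Rightarrow> bool" where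
  "smooth_tensor_field A k T \<longleftrightarrow>
     (\<forall>c\<in>A. \<forall>x\<in>coords c. multilinear_tensor k (T c x)) \<and>
     (\<forall>c\<in>A. \<forall>vs. length vs = k \<longrightarrow> smooth_on (coords c) (\<lambda>x. T c x vs)) \<and>
     (\<forall>c\<in>A. \<forall>c'\<in>A. \<forall>x\<in>overlap c c'. \<forall>vs. length vs = k \<longrightarrow>
        T c x vs =
        T c' (transition c c' x) (map (frechet_derivative (transition c c') (at x)) vs))"

definition riemannian_metric :: "'a chart set \<Rightarrow> 'a tensor_field \<Rightarrow> bool" where
  "riemannian_metric A g \<longleftrightarrow> smooth_tensor_field A 2 g \<and>
     (\<forall>c\<in>A. \<forall>x\<in>coords c.
        (\<forall>u v. g c x [u, v] = g c x [v, u]) \<and> (\<forall>v. v \<noteq> 0 \<longrightarrow> g c x [v, v] > 0))"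

definition differential_form :: "'a chart set \<Rightarrow> nat \<Rightarrow> 'a tensor_field \<Rightarrow> bool" where
  "differential_form A k \<alpha> \<longleftrightarrow> smooth_tensor_field A k \<alpha> \<and>
     (\<forall>c\<in>A. \<forall>x\<in>coords c. alternating_form k (\<alpha> c x))"


section \<open>Exterior algebra at a point\<close>

text \<open>The convention is
  \<open>(\<alpha> \<and> \<beta>)(v) = 1/(p! q!) \<Sum>\<sigma>. sign \<sigma> \<alpha>(v\<^sub>\<sigma>\<^sub>(\<^sub>1\<^sub>), \<dots>) \<beta>(\<dots>, v\<^sub>\<sigma>\<^sub>(\<^sub>p\<^sub>+\<^sub>q\<^sub>))\<close>
  for a \<open>p\<close>-form \<open>\<alpha>\<close> and a \<open>q\<close>-form \<open>\<beta>\<close>.\<close>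

definition wedge :: "nat \<Rightarrow> nat \<Rightarrow> tensor \<Rightarrow> tensor \<Rightarrow> tensor" where
  "wedge p q \<alpha> \<beta> vs =
     (\<Sum>\<sigma> | \<sigma> permutes {..<p + q}. of_int (sign \<sigma>) *
        \<alpha> (map (\<lambda>i. vs ! \<sigma> i) [0..<p]) * \<beta> (map (\<lambda>i. vs ! \<sigma> i) [p..<p + q]))
     / (fact p * fact q)"

definition orthonormal_basis :: "tensor \<Rightarrow> basis8 \<Rightarrow> bool" where
  "orthonormal_basis h F \<longleftrightarrow> (\<forall>i j. h [F i, F j] = (if i = j then 1 else 0))"

text \<open>For an orthonormal basis \<open>F\<close> the dual basis consists of the metric duals of the \<open>F i\<close>.\<close>

definition coframe :: "tensor \<Rightarrow> basis8 \<Rightarrow> 8 \<Rightarrow> vec8 \<Rightarrow> real" where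
  "coframe h F i v = h [F i, v]"

text \<open>\<open>e\<^sup>i\<^sup>j\<^sup>\<dots> = e\<^sup>i \<and> e\<^sup>j \<and> \<dots>\<close>, evaluated as the determinant of the matrix
  \<open>(e\<^sup>i\<^sup>a(v\<^sub>b))\<close>; this agrees with the convention for \<^const>\<open>wedge\<close>.\<close>

definition wedge_covectors :: "(8 \<Rightarrow> vec8 \<Rightarrow> real) \<Rightarrow> 8 list \<Rightarrow> tensor" where
  "wedge_covectors e I vs =
     (\<Sum>\<sigma> | \<sigma> permutes {..<length I}. of_int (sign \<sigma>) *
        (\<Prod>a<length I. e (I ! a) (vs ! \<sigma> a)))"

definition spin7_terms :: "(real \<times> 8 list) list" where
  "spin7_terms =
     [( 1, [0,1,2,3]), (-1, [0,1,4,5]), (-1, [0,1,6,7]), (-1, [0,2,4,6]), ( 1, [0,2,5,7]),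
      (-1, [0,3,4,7]), (-1, [0,3,5,6]), ( 1, [4,5,6,7]), (-1, [2,3,6,7]), (-1, [2,3,4,5]),
      (-1, [1,3,5,7]), ( 1, [1,3,4,6]), (-1, [1,2,5,6]), (-1, [1,2,4,7])]"

definition standard_spin7_form :: "(8 \<Rightarrow> vec8 \<Rightarrow> real) \<Rightarrow> tensor" where
  "standard_spin7_form e vs = (\<Sum>(s, I)\<leftarrow>spin7_terms. s * wedge_covectors e I vs)"

definition adapted_basis :: "tensor \<Rightarrow> tensor \<Rightarrow> basis8 \<Rightarrow> bool" where
  "adapted_basis h \<phi> F \<longleftrightarrow> orthonormal_basis h F \<and>
     (\<forall>vs. length vs = 4 \<longrightarrow> \<phi> vs = standard_spin7_form (coframe h F) vs)"

text \<open>The Hodge star with respect to the metric \<open>h\<close> and the orientation of the orthonormal basis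
  \<open>F\<close>, normalised by \<open>\<alpha> \<and> \<star>\<beta> = h(\<alpha>, \<beta>) e\<^sup>0\<^sup>1\<^sup>2\<^sup>3\<^sup>4\<^sup>5\<^sup>6\<^sup>7\<close>: the volume form is
  contracted with the \<open>k\<close>-form \<open>\<alpha>\<close> in its first \<open>k\<close> arguments.\<close>

definition hodge_star_wrt :: "tensor \<Rightarrow> basis8 \<Rightarrow> nat \<Rightarrow> tensor \<Rightarrow> tensor" where
  "hodge_star_wrt h F k \<alpha> ws =
     (\<Sum>I | length I = k.
        \<alpha> (map F I) * wedge_covectors (coframe h F) [0,1,2,3,4,5,6,7] (map F I @ ws)) / fact k"

text \<open>The manifold is oriented by \<open>e\<^sup>0\<^sup>1\<^sup>2\<^sup>3\<^sup>4\<^sup>5\<^sup>6\<^sup>7\<close> for an adapted coframe. The choice of the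
  adapted basis is immaterial: two of them differ by an element of the stabilizer \<open>Spin(7)\<close>
  of \<open>\<phi>\<close>, which lies in \<open>SO(8)\<close>.\<close>

definition hodge_star :: "tensor \<Rightarrow> tensor \<Rightarrow> nat \<Rightarrow> tensor \<Rightarrow> tensor" where
  "hodge_star h \<phi> = hodge_star_wrt h (SOME F. adapted_basis h \<phi> F)"

definition Lambda2_7 :: "tensor \<Rightarrow> tensor \<Rightarrow> tensor set" where
  "Lambda2_7 h \<phi> = {\<omega>. alternating_form 2 \<omega> \<and>
     (\<forall>vs. length vs = 2 \<longrightarrow> hodge_star h \<phi> 6 (wedge 4 2 \<phi> \<omega>) vs = 3 * \<omega> vs)}"

definition Lambda2_21 :: "tensor \<Rightarrow> tensor \<Rightarrow> tensor set" where
  "Lambda2_21 h \<phi> = {\<omega>. alternating_form 2 \<omega> \<and>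
     (\<forall>vs. length vs = 2 \<longrightarrow> hodge_star h \<phi> 6 (wedge 4 2 \<phi> \<omega>) vs = - \<omega> vs)}"

text \<open>\<open>\<beta>\<close> is the \<open>\<Lambda>\<^sup>2\<^sub>2\<^sub>1\<close>-component of \<open>\<omega>\<close>; under the identification of skew
  endomorphisms with 2-forms this is the \<open>spin(7)\<close>-component.\<close>

definition is_spin7_component :: "tensor \<Rightarrow> tensor \<Rightarrow> tensor \<Rightarrow> tensor \<Rightarrow> bool" where
  "is_spin7_component h \<phi> \<omega> \<beta> \<longleftrightarrow>
     \<beta> \<in> Lambda2_21 h \<phi> \<and> (\<lambda>vs. \<omega> vs - \<beta> vs) \<in> Lambda2_7 h \<phi>"


section \<open>\<open>Spin(7)\<close>-structures\<close>

text \<open>A local orthonormal frame on \<open>N\<close>, in the coordinates of the chart \<open>c\<close>, in which \<open>\<Phi>\<close> has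
  the standard form.\<close>

definition adapted_local_frame ::
    "'a tensor_field \<Rightarrow> 'a tensor_field \<Rightarrow> 'a chart \<Rightarrow> vec8 set \<Rightarrow> (vec8 \<Rightarrow> basis8) \<Rightarrow> bool" where
  "adapted_local_frame g \<Phi> c N E \<longleftrightarrow> open N \<and> N \<subseteq> coords c \<and>
     (\<forall>i. smooth_on N (\<lambda>x. E x i)) \<and> (\<forall>x\<in>N. adapted_basis (g c x) (\<Phi> c x) (E x))"

text \<open>Frames transform between charts, so having a frame near \<open>x\<close> in every chart is the same as
  having one near each point of \<open>M\<close> in some chart.\<close>

definition spin7_structure ::
    "'a::{t2_space,second_countable_topology} set \<Rightarrow> 'a chart set \<Rightarrow> 'a tensor_field \<Rightarrow>
     'a tensor_field \<Rightarrow> bool" where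
  "spin7_structure M A g \<Phi> \<longleftrightarrow>
     smooth_manifold8 M A \<and> riemannian_metric A g \<and> differential_form A 4 \<Phi> \<and>
     (\<forall>c\<in>A. \<forall>x\<in>coords c. \<exists>N E. x \<in> N \<and> adapted_local_frame g \<Phi> c N E)"

text \<open>The exterior derivative of a \<open>k\<close>-form in a chart; the arguments \<open>vs ! i\<close> are constant
  vector fields in the chart, so there are no bracket terms.\<close>

definition ext_deriv :: "nat \<Rightarrow> (vec8 \<Rightarrow> tensor) \<Rightarrow> vec8 \<Rightarrow> tensor" where
  "ext_deriv k \<alpha> x vs =
     (\<Sum>i\<le>k. (-1) ^ i *
        frechet_derivative (\<lambda>y. \<alpha> y (take i vs @ drop (Suc i) vs)) (at x) (vs ! i))"

text \<open>\<open>\<delta>\<Phi> = - \<star> d \<star> \<Phi>\<close>, a 3-form.\<close>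

definition codiff_Phi :: "'a tensor_field \<Rightarrow> 'a tensor_field \<Rightarrow> 'a tensor_field" where
  "codiff_Phi g \<Phi> c x vs =
     - hodge_star (g c x) (\<Phi> c x) 5
         (ext_deriv 4 (\<lambda>y. hodge_star (g c y) (\<Phi> c y) 4 (\<Phi> c y)) x) vs"

definition lee_form :: "'a tensor_field \<Rightarrow> 'a tensor_field \<Rightarrow> 'a tensor_field" where
  "lee_form g \<Phi> c x vs =
     1 / 7 * hodge_star (g c x) (\<Phi> c x) 7 (wedge 3 4 (codiff_Phi g \<Phi> c x) (\<Phi> c x)) vs"

definition locally_conformal_parallel ::
    "'a chart set \<Rightarrow> 'a tensor_field \<Rightarrow> 'a tensor_field \<Rightarrow> bool" where
  "locally_conformal_parallel A g \<Phi> \<longleftrightarrow>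
     (\<forall>c\<in>A. \<forall>x\<in>coords c. \<forall>vs. length vs = 5 \<longrightarrow>
        ext_deriv 4 (\<Phi> c) x vs = wedge 1 4 (lee_form g \<Phi> c x) (\<Phi> c x) vs)"


section \<open>Connections\<close>

text \<open>An affine connection is given in each chart by its Christoffel symbols \<open>C\<close>, so that
  \<open>\<nabla>\<^sub>u Y = \<partial>\<^sub>u Y + C(u, Y)\<close>; the transformation law says that \<open>\<nabla>\<^sub>u Y\<close> is independent
  of the chart.\<close>

definition affine_connection :: "'a chart set \<Rightarrow> 'a connection \<Rightarrow> bool" where
  "affine_connection A C \<longleftrightarrow>
     (\<forall>c\<in>A. \<forall>x\<in>coords c. bilinear (C c x)) \<and>
     (\<forall>c\<in>A. \<forall>u v. smooth_on (coords c) (\<lambda>x. C c x u v)) \<and>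
     (\<forall>c\<in>A. \<forall>c'\<in>A. \<forall>x\<in>overlap c c'. \<forall>u v.
        (let \<tau> = transition c c'; D\<tau> = (\<lambda>y. frechet_derivative \<tau> (at y)) in
         C c' (\<tau> x) (D\<tau> x u) (D\<tau> x v) =
         D\<tau> x (C c x u v) - frechet_derivative (\<lambda>y. D\<tau> y v) (at x) u))"

text \<open>\<open>(\<nabla>\<^sub>u T)(vs)\<close> in a chart, for a covariant \<open>k\<close>-tensor field \<open>T\<close>; meaningful for
  differentiable \<open>T\<close>. The tensor fields to which this is applied are smooth on every
  \<open>Spin(7)\<close>-structure.\<close>

definition cov_deriv ::
    "(vec8 \<Rightarrow> vec8 \<Rightarrow> vec8 \<Rightarrow> vec8) \<Rightarrow> nat \<Rightarrow> (vec8 \<Rightarrow> tensor) \<Rightarrow> vec8 \<Rightarrow> vec8 \<Rightarrow> tensor" where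
  "cov_deriv C k T x u vs =
     frechet_derivative (\<lambda>y. T y vs) (at x) u - (\<Sum>i<k. T x (vs[i := C x u (vs ! i)]))"

definition parallel_tensor ::
    "'a chart set \<Rightarrow> 'a connection \<Rightarrow> nat \<Rightarrow> 'a tensor_field \<Rightarrow> bool" where
  "parallel_tensor A C k T \<longleftrightarrow>
     (\<forall>c\<in>A. \<forall>x\<in>coords c. \<forall>u vs. length vs = k \<longrightarrow> cov_deriv (C c) k (T c) x u vs = 0)"

definition levi_civita :: "'a chart set \<Rightarrow> 'a tensor_field \<Rightarrow> 'a connection \<Rightarrow> bool" where
  "levi_civita A g C \<longleftrightarrow> affine_connection A C \<and>
     (\<forall>c\<in>A. \<forall>x\<in>coords c. \<forall>u v. C c x u v = C c x v u) \<and>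
     parallel_tensor A C 2 g"

text \<open>The connection form of \<open>\<nabla>\<close> in the local frame \<open>E\<close>, evaluated at \<open>u\<close>: the endomorphism
  \<open>A\<close> with \<open>A (E j) = \<nabla>\<^sub>u (E j)\<close>, regarded as the 2-form \<open>(Y, Z) \<mapsto> g(A Y, Z)\<close>.\<close>

definition connection_form ::
    "(vec8 \<Rightarrow> tensor) \<Rightarrow> (vec8 \<Rightarrow> vec8 \<Rightarrow> vec8 \<Rightarrow> vec8) \<Rightarrow> (vec8 \<Rightarrow> basis8) \<Rightarrow> vec8 \<Rightarrow> vec8 \<Rightarrow> tensor"
  where
  "connection_form g C E x u vs =
     (\<Sum>j\<in>UNIV. coframe (g x) (E x) j (vs ! 0) *
        g x [frechet_derivative (\<lambda>y. E y j) (at x) u + C x u (E x j), vs ! 1])"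

text \<open>The connection \<open>D\<close> is the minimal \<open>Spin(7)\<close>-connection: in every adapted local frame its
  connection form is the \<open>spin(7)\<close>-component of that of the Levi-Civita connection \<open>\<nabla>\<close>.\<close>

definition minimal_spin7_connection ::
    "'a chart set \<Rightarrow> 'a tensor_field \<Rightarrow> 'a tensor_field \<Rightarrow> 'a connection \<Rightarrow> 'a connection \<Rightarrow> bool"
  where
  "minimal_spin7_connection A g \<Phi> nabla D \<longleftrightarrow> affine_connection A D \<and>
     (\<forall>c\<in>A. \<forall>N E. adapted_local_frame g \<Phi> c N E \<longrightarrow>
        (\<forall>x\<in>N. \<forall>u. is_spin7_component (g c x) (\<Phi> c x)
           (connection_form (g c) (nabla c) E x u) (connection_form (g c) (D c) E x u)))"

definition intrinsic_torsion ::
    "'a connection \<Rightarrow> 'a connection \<Rightarrow> 'a chart \<Rightarrow> vec8 \<Rightarrow> vec8 \<Rightarrow> vec8 \<Rightarrow> vec8" where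
  "intrinsic_torsion nabla D c x u v = D c x u v - nabla c x u v"

text \<open>\<open>r(X, Y) = \<Sum>\<^sub>i g(\<xi>\<^sub>X e\<^sub>i, \<xi>\<^sub>Y e\<^sub>i)\<close>, which does not depend on the choice of the
  orthonormal basis.\<close>

definition torsion_square ::
    "'a tensor_field \<Rightarrow> ('a chart \<Rightarrow> vec8 \<Rightarrow> vec8 \<Rightarrow> vec8 \<Rightarrow> vec8) \<Rightarrow> 'a tensor_field" where
  "torsion_square g \<xi> c x vs =
     (let F = (SOME F. orthonormal_basis (g c x) F) in
      \<Sum>i\<in>UNIV. g c x [\<xi> c x (vs ! 0) (F i), \<xi> c x (vs ! 1) (F i)])"

definition second_order_nearly_parallel ::
    "'a chart set \<Rightarrow> 'a tensor_field \<Rightarrow> 'a connection \<Rightarrow> 'a connection \<Rightarrow> bool" where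
  "second_order_nearly_parallel A g nabla D \<longleftrightarrow>
     parallel_tensor A D 2 (torsion_square g (intrinsic_torsion nabla D))"

end

theory Submission
  imports Defs
begin

text \<open>
  Work in an adapted local frame \<open>e\<^sub>0, \<dots>, e\<^sub>7\<close>, with indices added by bitwise exclusive or. Every
  quadruple in \<open>\<Phi>\<close> has exclusive or \<open>0\<close>, so that all equations decouple by the degree in
  \<open>(\<int>/2)\<^sup>3\<close>. Since \<open>\<nabla>\<close> is torsion free and the minimal connection preserves \<open>\<Phi>\<close>, the form
  \<open>d\<Phi>\<close> is the alternation of \<open>\<xi> \<cdot> \<Phi>\<close>, and \<open>d\<Phi> = \<theta> \<and> \<Phi>\<close> splits into eight linear systems with seven
  unknowns each, which force \<open>\<xi>\<^sub>X = (X \<and> \<theta>)\<^sub>7 / 4\<close>. Taking traces, \<open>\<theta>\<close> is a multiple of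
  \<open>\<Sum>\<^sub>i g(\<xi>(e\<^sub>i, e\<^sub>i), -)\<close>, hence smooth, and \<open>32 r = |\<theta>|\<^sup>2 g - \<theta> \<otimes> \<theta>\<close>.

  As the minimal connection is metric, a parallel \<open>\<theta>\<close> makes \<open>r\<close> parallel. Conversely, if \<open>r\<close> is
  parallel then its trace shows that \<open>|\<theta>|\<^sup>2\<close> is locally constant, so \<open>\<theta> \<otimes> \<theta>\<close> is parallel. Where
  \<open>\<theta> \<noteq> 0\<close> this gives that \<open>\<theta>\<close> is parallel, and near a zero of \<open>\<theta>\<close> the form vanishes identically.
\<close>

section \<open>Exterior powers of an orthonormal coframe\<close>

text \<open>The Hodge star and \<open>torsion_square\<close> are evaluated in bases picked by
  \<open>SOME\<close> at each point separately. These bases need not vary continuously, nor be the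
  frame along which one differentiates. The algebra at a point is therefore done in the picked
  adapted basis, where the eigenvalue equations of \<open>Lambda2_7\<close> and
  \<open>Lambda2_21\<close> can be read off, and its results are exported as basis-free identities;
  equality of traces in all orthonormal bases links them to the smooth frame \<open>E\<close> used
  for the calculus. Origin of the constants: a basis element of \<open>Lambda2_7\<close> acts on
  \<Phi> with a factor 4, and each equation sums 4 unknowns, so the components of \<xi> are
  \<theta>-components up to sign, divided by 16. The trace adds seven of them, which gives 7/16. In
  the Gram matrix of \<xi> each product carries 1/256 and each degree occurs for 8 index pairs,
  which gives 1/32.\<close>

lemma wedge_covectors_permute:
  assumes "\<tau> permutes {..<length I}"
  shows "wedge_covectors e I (map (\<lambda>i. vs ! \<tau> i) [0..<length I]) =
         of_int (sign \<tau>) * wedge_covectors e I vs"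
proof -
  let ?n = "length I" and ?S = "{\<sigma>. \<sigma> permutes {..<length I}}"
  have sg: "sign (\<tau> \<circ> \<sigma>) = sign \<tau> * sign \<sigma>" if "\<sigma> \<in> ?S" for \<sigma>
    using that assms by (intro sign_compose) (auto intro: permutes_imp_permutation[of "{..<?n}"])
  have "of_int (sign \<tau>) * wedge_covectors e I vs =
      (\<Sum>\<sigma>\<in>?S. of_int (sign \<tau>) * (of_int (sign (\<tau> \<circ> \<sigma>)) *
        (\<Prod>a<?n. e (I ! a) (vs ! \<tau> (\<sigma> a)))))"
    unfolding wedge_covectors_def
    by (subst setum_permutations_compose_left[OF assms]) (simp add: sum_distrib_left)
  also have "\<dots> = (\<Sum>\<sigma>\<in>?S. of_int (sign \<sigma>) *
        (\<Prod>a<?n. e (I ! a) (map (\<lambda>i. vs ! \<tau> i) [0..<?n] ! \<sigma> a)))"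
  proof (rule sum.cong[OF refl])
    fix \<sigma> assume \<sigma>: "\<sigma> \<in> ?S"
    have "\<sigma> a < ?n" if "a < ?n" for a
      using \<sigma> that permutes_in_image[of \<sigma> "{..<?n}" a] by auto
    hence "(\<Prod>a<?n. e (I ! a) (map (\<lambda>i. vs ! \<tau> i) [0..<?n] ! \<sigma> a)) =
        (\<Prod>a<?n. e (I ! a) (vs ! \<tau> (\<sigma> a)))"
      by (intro prod.cong) auto
    thus "of_int (sign \<tau>) * (of_int (sign (\<tau> \<circ> \<sigma>)) * (\<Prod>a<?n. e (I ! a) (vs ! \<tau> (\<sigma> a)))) =
        of_int (sign \<sigma>) * (\<Prod>a<?n. e (I ! a) (map (\<lambda>i. vs ! \<tau> i) [0..<?n] ! \<sigma> a))"
      using sg[OF \<sigma>] by (simp flip: of_int_mult mult.assoc)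
  qed
  finally show ?thesis by (simp add: wedge_covectors_def)
qed

lemma wedge_covectors_swap:
  assumes "length I = length xs + length ys + 2"
  shows "wedge_covectors e I (xs @ b # a # ys) = - wedge_covectors e I (xs @ a # b # ys)"
proof -
  let ?n = "length xs"
  let ?\<tau> = "Transposition.transpose ?n (Suc ?n)"
  have p: "?\<tau> permutes {..<length I}" using assms by (intro permutes_swap_id) auto
  have "map (\<lambda>i. (xs @ a # b # ys) ! ?\<tau> i) [0..<length I] = xs @ b # a # ys"
  proof (rule nth_equalityI)
    fix i assume "i < length (map (\<lambda>i. (xs @ a # b # ys) ! ?\<tau> i) [0..<length I])"
    hence i: "i < length I" by simp
    consider "i < ?n" | "i = ?n" | "i = Suc ?n" | k where "i = ?n + Suc (Suc k)"
      by (metis less_SucE linorder_neqE_nat add_Suc_right add_Suc less_natE Suc_lessI)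
    thus "map (\<lambda>i. (xs @ a # b # ys) ! ?\<tau> i) [0..<length I] ! i = (xs @ b # a # ys) ! i"
      using i by cases (simp_all add: nth_append transpose_def)
  qed (use assms in simp)
  thus ?thesis using wedge_covectors_permute[OF p, of e "xs @ a # b # ys"]
    by (simp add: sign_swap_id)
qed

text \<open>Moving \<open>a\<close> in front of \<open>ys\<close> takes \<open>length ys\<close>
  adjacent swaps. This is the sign counted in \<open>eps\<close>.\<close>

lemma wedge_covectors_rotate:
  assumes "length I = length xs + length ys + length zs + 1"
  shows "wedge_covectors e I (xs @ ys @ a # zs) =
         (- 1) ^ length ys * wedge_covectors e I (xs @ a # ys @ zs)"
  using assms
proof (induction ys arbitrary: zs rule: rev_induct)
  case (snoc y ys)
  have "wedge_covectors e I ((xs @ ys) @ y # a # zs) =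
      - wedge_covectors e I ((xs @ ys) @ a # y # zs)"
    using snoc.prems by (intro wedge_covectors_swap) simp
  moreover have "wedge_covectors e I (xs @ ys @ a # y # zs) =
      (- 1) ^ length ys * wedge_covectors e I (xs @ a # ys @ y # zs)"
    using snoc.prems by (intro snoc.IH) simp
  ultimately show ?case by simp
qed simp

text \<open>For distinct \<open>I\<close> and \<open>J\<close> of the same length this is the
  generalised Kronecker delta: the sign of the permutation carrying \<open>J\<close> to
  \<open>I\<close>, or 0 if there is none. Each entry of \<open>I\<close> is brought to the front of
  \<open>J\<close> in turn, and the exponent counts the swaps, so that determinants of dual bases
  can be evaluated without summing over all permutations. In the base case both lists are exhausted,
  and 1 is the empty determinant.\<close>

fun eps :: "'b list \<Rightarrow> 'b list \<Rightarrow> int" where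
  "eps [] J = 1"
| "eps (i # I) J = (if i \<in> set J
     then (- 1) ^ length (takeWhile (\<lambda>j. j \<noteq> i) J) * eps I (remove1 i J) else 0)"

lemma eps_map: "inj_on f (set I \<union> set J) \<Longrightarrow> eps (map f I) (map f J) = eps I J"
proof (induction I arbitrary: J)
  case (Cons i I)
  have inj: "inj_on f (set I \<union> set (remove1 i J))"
    by (rule inj_on_subset[OF Cons.prems]) (use set_remove1_subset[of i J] in auto)
  have eq: "f j = f i \<longleftrightarrow> j = i" if "j \<in> set J" for j
    using Cons.prems that by (auto simp: inj_on_def)
  have 1: "f i \<in> f ` set J \<longleftrightarrow> i \<in> set J" using eq by force
  have 2: "takeWhile (\<lambda>j. j \<noteq> f i) (map f J) = map f (takeWhile (\<lambda>j. j \<noteq> i) J)"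
    using eq by (auto simp: takeWhile_map o_def intro!: arg_cong[of _ _ "map f"] takeWhile_cong)
  have 3: "remove1 (f i) (map f J) = map f (remove1 i J)"
    using eq by (induction J) (fastforce)+
  show ?case using Cons.IH[OF inj] 1 2 3 by simp
qed auto

lemma wedge_covectors_id:
  assumes "distinct I" and "\<And>i j. e i (F j) = (if i = j then 1 else (0::real))"
  shows "wedge_covectors e I (map F I) = 1"
proof -
  have "of_int (sign \<sigma>) * (\<Prod>a<length I. e (I ! a) (map F I ! \<sigma> a)) = (if \<sigma> = id then 1 else 0)"
    if s: "\<sigma> permutes {..<length I}" for \<sigma>
  proof (cases "\<sigma> = id")
    case True thus ?thesis using assms by simp
  next
    case False
    then obtain a where a: "\<sigma> a \<noteq> a" by (auto simp: fun_eq_iff)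
    hence al: "a < length I" using s by (meson lessThan_iff permutes_not_in)
    hence sl: "\<sigma> a < length I" using s permutes_in_image[of \<sigma> "{..<length I}" a] by simp
    have "e (I ! a) (map F I ! \<sigma> a) = 0"
      using a al sl assms by (simp add: nth_eq_iff_index_eq)
    hence "(\<Prod>a<length I. e (I ! a) (map F I ! \<sigma> a)) = 0"
      by (intro prod_zero) (use al in auto)
    thus ?thesis using False by simp
  qed
  hence "wedge_covectors e I (map F I) =
      (\<Sum>\<sigma> | \<sigma> permutes {..<length I}. if \<sigma> = id then 1 else 0)"
    unfolding wedge_covectors_def by (intro sum.cong) auto
  thus ?thesis by (simp add: finite_permutations permutes_id sum.delta)
qed

text \<open>The row of \<open>e (I ! a)\<close> in the determinant is zero.\<close>

lemma wedge_covectors_0: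
  assumes "length vs = length I" "a < length I" "\<And>v. v \<in> set vs \<Longrightarrow> e (I ! a) v = 0"
  shows "wedge_covectors e I vs = 0"
  unfolding wedge_covectors_def
proof (intro sum.neutral ballI)
  fix \<sigma> assume "\<sigma> \<in> {\<sigma>. \<sigma> permutes {..<length I}}"
  hence "\<sigma> a < length I"
    using permutes_in_image[of \<sigma> "{..<length I}" a] assms by simp
  hence "e (I ! a) (vs ! \<sigma> a) = 0" using assms by auto
  hence "(\<Prod>a<length I. e (I ! a) (vs ! \<sigma> a)) = 0"
    by (intro prod_zero) (use assms in auto)
  thus "of_int (sign \<sigma>) * (\<Prod>a<length I. e (I ! a) (vs ! \<sigma> a)) = 0" by simp
qed

text \<open>The prefix \<open>pre\<close> collects the entries already matched between covectors and
  vectors. If \<open>i\<close> does not occur in \<open>J\<close>, the row of \<open>e i\<close>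
  vanishes; otherwise the first occurrence of \<open>F i\<close> is rotated to the end of
  \<open>pre\<close>.\<close>

lemma wedge_covectors_eps_aux:
  assumes "distinct (pre @ I)" "length I = length J"
    and e: "\<And>i j. e i (F j) = (if i = j then 1 else (0::real))"
  shows "wedge_covectors e (pre @ I) (map F (pre @ J)) = of_int (eps I J)"
  using assms(1,2)
proof (induction I arbitrary: pre J)
  case Nil
  thus ?case using wedge_covectors_id[of "pre" e F] e by simp
next
  case (Cons i I)
  show ?case
  proof (cases "i \<in> set J")
    case False
    have "wedge_covectors e (pre @ i # I) (map F (pre @ J)) = 0"
      by (rule wedge_covectors_0[of _ _ "length pre"]) (use False Cons.prems e in auto)
    thus ?thesis using False by simp
  next
    case True
    define ys where "ys = takeWhile (\<lambda>j. j \<noteq> i) J"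
    obtain ys' zs where "J = ys' @ i # zs" "i \<notin> set ys'"
      using split_list_first[OF True] by blast
    moreover from this have "ys = ys'"
      unfolding ys_def by (simp add: takeWhile_tail) (metis takeWhile_eq_all_conv)
    ultimately have J: "J = ys @ i # zs" by simp
    have "i \<notin> set ys" unfolding ys_def by (metis (mono_tags) set_takeWhileD)
    hence r: "remove1 i J = ys @ zs" by (simp add: J remove1_append)
    have "wedge_covectors e (pre @ i # I) (map F pre @ map F ys @ F i # map F zs) =
        (- 1) ^ length ys * wedge_covectors e (pre @ i # I) (map F pre @ F i # map F ys @ map F zs)"
      using wedge_covectors_rotate[of "pre @ i # I" "map F pre" "map F ys" "map F zs"] Cons.prems
      by (simp add: J)
    also have "wedge_covectors e (pre @ i # I) (map F pre @ F i # map F ys @ map F zs) =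
        of_int (eps I (ys @ zs))"
      using Cons.IH[of "pre @ [i]" "ys @ zs"] Cons.prems by (simp add: J)
    finally show ?thesis using True r by (simp add: ys_def[symmetric]) (simp add: J)
  qed
qed

lemma wedge_covectors_eps:
  assumes "distinct I" "length I = length J"
    and "\<And>i j. e i (F j) = (if i = j then 1 else (0::real))"
  shows "wedge_covectors e I (map F J) = of_int (eps I J)"
  using wedge_covectors_eps_aux[of "[]" I J e F] assms by simp


section \<open>Components of the Spin(7)-form\<close>

text \<open>The 2-forms \<open>\<Sum> spin7_sign i j e\<^sup>i\<^sup>j\<close>, summed over \<open>i < j\<close> with \<open>i xor j = n\<close>, form an
  orthogonal basis of \<open>\<Lambda>\<^sup>2\<^sub>7\<close> for \<open>0 < n < 8\<close>. The signs are normalised by \<open>spin7_sign 0 n = 1\<close>.\<close>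

definition spin7_sign :: "nat \<Rightarrow> nat \<Rightarrow> int" where
  "spin7_sign a b =
    [[ 0,  1,  1,  1,  1,  1,  1,  1],
     [-1,  0,  1, -1, -1,  1, -1,  1],
     [-1, -1,  0,  1, -1,  1,  1, -1],
     [-1,  1, -1,  0, -1, -1,  1,  1],
     [-1,  1,  1,  1,  0, -1, -1, -1],
     [-1, -1, -1,  1,  1,  0, -1,  1],
     [-1,  1, -1, -1,  1,  1,  0, -1],
     [-1, -1,  1, -1,  1, -1,  1,  0]] ! a ! b"

text \<open>The components of \<Phi> in an adapted frame. Writing them as a product of two signs,
  one for each of two pairs with equal xor, lets contractions with 2-forms factor through
  \<open>pairing7\<close>.\<close>

definition spin7_coeff :: "nat \<Rightarrow> nat \<Rightarrow> nat \<Rightarrow> nat \<Rightarrow> int" where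
  "spin7_coeff a b c d =
     (if xor a b = xor c d \<and> distinct [a, b, c, d] then spin7_sign a b * spin7_sign c d else 0)"

text \<open>A copy of \<open>spin7_terms\<close> over natural numbers, where xor is available and
  \<open>code_simp\<close> can evaluate.\<close>

definition spin7_nat_terms :: "(int \<times> nat list) list" where
  "spin7_nat_terms =
     [( 1, [0,1,2,3]), (-1, [0,1,4,5]), (-1, [0,1,6,7]), (-1, [0,2,4,6]), ( 1, [0,2,5,7]),
      (-1, [0,3,4,7]), (-1, [0,3,5,6]), ( 1, [4,5,6,7]), (-1, [2,3,6,7]), (-1, [2,3,4,5]),
      (-1, [1,3,5,7]), ( 1, [1,3,4,6]), (-1, [1,2,5,6]), (-1, [1,2,4,7])]"

lemma spin7_terms_nat:
  "spin7_terms = map (\<lambda>(s, I). (of_int s, map of_nat I)) spin7_nat_terms"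
  by (simp add: spin7_terms_def spin7_nat_terms_def)

lemma spin7_sign_skew: "a < 8 \<Longrightarrow> b < 8 \<Longrightarrow> spin7_sign a b = - spin7_sign b a"
proof -
  have "\<forall>a\<in>set [0..<8]. \<forall>b\<in>set [0..<8]. spin7_sign a b = - spin7_sign b a"
    by code_simp
  thus "a < 8 \<Longrightarrow> b < 8 \<Longrightarrow> ?thesis" by (metis atLeastLessThan_iff set_upt zero_le)
qed

lemma spin7_coeff_swap12: 
  assumes "a < 8" "b < 8" shows "spin7_coeff b a c d = - spin7_coeff a b c d"
proof -
  obtain p where p: "spin7_sign a b = p" "spin7_sign b a = - p"
    using spin7_sign_skew[OF assms] by (metis minus_minus)
  show ?thesis unfolding spin7_coeff_def p xor.commute[of b a] by auto
qed

text \<open>Unlike the other two swaps, this one compares different splittings of a quadruple into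
  pairs. It is a property of the sign table and is checked on all quadruples.\<close>

lemma spin7_coeff_swap23:
  assumes "a < 8" "b < 8" "c < 8" "d < 8"
  shows "spin7_coeff a c b d = - spin7_coeff a b c d"
proof -
  have "\<forall>a\<in>set [0..<8]. \<forall>b\<in>set [0..<8]. \<forall>c\<in>set [0..<8]. \<forall>d\<in>set [0..<8].
     spin7_coeff a c b d = - spin7_coeff a b c d"
    by code_simp
  thus ?thesis using assms by (metis atLeastLessThan_iff set_upt zero_le)
qed

lemma spin7_coeff_swap34:
  assumes "c < 8" "d < 8" shows "spin7_coeff a b d c = - spin7_coeff a b c d"
proof -
  obtain p where p: "spin7_sign c d = p" "spin7_sign d c = - p"
    using spin7_sign_skew[OF assms] by (metis minus_minus)
  show ?thesis unfolding spin7_coeff_def p xor.commute[of d c] by auto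
qed

lemma spin7_coeff_eps:
  assumes "a < b" "b < c" "c < d" "d < 8"
  shows "(\<Sum>(s, I)\<leftarrow>spin7_nat_terms. s * eps I [a, b, c, d]) = spin7_coeff a b c d"
proof -
  have "\<forall>a\<in>set [0..<8]. \<forall>b\<in>set [Suc a..<8]. \<forall>c\<in>set [Suc b..<8]. \<forall>d\<in>set [Suc c..<8].
     (\<Sum>(s, I)\<leftarrow>spin7_nat_terms. s * eps I [a, b, c, d]) = spin7_coeff a b c d"
    by code_simp
  thus ?thesis using assms by simp
qed

text \<open>This is \<star>\<Phi> = \<Phi> in components. Each set of four summed indices occurs
  once, which absorbs the factor 1/4! of the Hodge star.\<close>

lemma spin7_coeff_eps_star:
  assumes "a < b" "b < c" "c < d" "d < 8"
  shows "(\<Sum>(s, I)\<leftarrow>spin7_nat_terms. s * eps [0,1,2,3,4,5,6,7] (I @ [a, b, c, d])) =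
    spin7_coeff a b c d"
proof -
  have "\<forall>a\<in>set [0..<8]. \<forall>b\<in>set [Suc a..<8]. \<forall>c\<in>set [Suc b..<8]. \<forall>d\<in>set [Suc c..<8].
     (\<Sum>(s, I)\<leftarrow>spin7_nat_terms. s * eps [0,1,2,3,4,5,6,7] (I @ [a, b, c, d])) =
     spin7_coeff a b c d"
    by code_simp
  thus ?thesis using assms by simp
qed

text \<open>The indices are sorted by adjacent swaps: \<open>d\<close> is inserted into
  \<open>a < b < c\<close>, and before that \<open>c\<close> into \<open>a < b\<close>. A repeated
  index, brought next to its copy, gives \<open>f = - f\<close>. Identities between alternating
  components thereby reduce to increasing quadruples, which can be enumerated.\<close>

lemma alternating4_eq_0:
  fixes f :: "nat \<Rightarrow> nat \<Rightarrow> nat \<Rightarrow> nat \<Rightarrow> real"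
  assumes s1: "\<And>a b c d. a < n \<Longrightarrow> b < n \<Longrightarrow> c < n \<Longrightarrow> d < n \<Longrightarrow> f b a c d = - f a b c d"
    and s2: "\<And>a b c d. a < n \<Longrightarrow> b < n \<Longrightarrow> c < n \<Longrightarrow> d < n \<Longrightarrow> f a c b d = - f a b c d"
    and s3: "\<And>a b c d. a < n \<Longrightarrow> b < n \<Longrightarrow> c < n \<Longrightarrow> d < n \<Longrightarrow> f a b d c = - f a b c d"
    and sorted: "\<And>a b c d. a < b \<Longrightarrow> b < c \<Longrightarrow> c < d \<Longrightarrow> d < n \<Longrightarrow> f a b c d = 0"
    and "a < n" "b < n" "c < n" "d < n"
  shows "f a b c d = 0"
proof -
  have 1: "f a b c d = 0" if "a < b" "b < c" "c < n" "d < n" for a b c d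
  proof -
    have lt: "a < n" "b < n" using that by auto
    consider "c < d" | "d = c" | "b < d" "d < c" | "d = b" | "a < d" "d < b" | "d = a" | "d < a"
      by linarith
    thus ?thesis
      using sorted[of a b c d] sorted[of a b d c] sorted[of a d b c] sorted[of d a b c]
        s3[of a b c d] s2[of a b d c] s1[of a d b c] that lt
      by cases auto
  qed
  have 2: "f a b c d = 0" if "a < b" "b < n" "c < n" "d < n" for a b c d
  proof -
    have lt: "a < n" using that by auto
    consider "b < c" | "b = c" | "a < c" "c < b" | "a = c" | "c < a" by linarith
    thus ?thesis
      using 1[of a b c d] 1[of a c b d] 1[of c a b d] s2[of a b c d] s1[of a c b d] that lt
      by cases auto
  qed
  consider "a < b" | "a = b" | "b < a" by linarith
  thus ?thesis
    using 2[of a b c d] 2[of b a c d] s1[of a b c d] assms(5-) by cases auto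
qed

section \<open>Transfer between the index type \<open>8\<close> and the natural numbers below
  eight\<close>

lemma bij_of_nat_8: "bij_betw (of_nat :: nat \<Rightarrow> 8) {..<8} UNIV"
proof -
  have inj: "inj_on (of_nat :: nat \<Rightarrow> 8) {..<8}"
  proof (rule linorder_inj_onI)
    fix a b :: nat assume ab: "a < b" "b \<in> {..<8}"
    hence "\<not> CHAR(8) dvd b - a" by (auto dest!: dvd_imp_le)
    hence "of_nat (b - a) \<noteq> (0 :: 8)" by (simp add: of_nat_eq_0_iff_char_dvd)
    thus "of_nat a \<noteq> (of_nat b :: 8)" using ab by (simp add: of_nat_diff)
  qed auto
  hence "card ((of_nat :: nat \<Rightarrow> 8) ` {..<8}) = CARD(8)" by (simp add: card_image)
  hence "(of_nat :: nat \<Rightarrow> 8) ` {..<8} = UNIV" by (intro card_eq_UNIV_imp_eq_UNIV) auto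
  with inj show ?thesis by (simp add: bij_betw_def)
qed

lemma of_nat_8_eq_iff: "a < 8 \<Longrightarrow> b < 8 \<Longrightarrow> (of_nat a :: 8) = of_nat b \<longleftrightarrow> a = b"
  using bij_of_nat_8 by (auto simp: bij_betw_def inj_on_def)

lemma of_nat_8_cases: obtains a where "a < 8" "i = (of_nat a :: 8)"
  using bij_of_nat_8 by (auto simp: bij_betw_def)

lemma list_8_of_nat:
  assumes "length (I :: 8 list) = 4"
  obtains a b c d where "a < 8" "b < 8" "c < 8" "d < 8" "I = map of_nat [a, b, c, d]"
proof -
  obtain i j k l where I: "I = [i, j, k, l]"
    using assms by (auto simp: length_Suc_conv numeral_eq_Suc)
  obtain a where a: "a < 8" "i = of_nat a" by (rule of_nat_8_cases)
  obtain b where b: "b < 8" "j = of_nat b" by (rule of_nat_8_cases)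
  obtain c where c: "c < 8" "k = of_nat c" by (rule of_nat_8_cases)
  obtain d where d: "d < 8" "l = of_nat d" by (rule of_nat_8_cases)
  show ?thesis by (rule that[OF a(1) b(1) c(1) d(1)]) (simp add: I a b c d)
qed

lemma distinct_of_nat_8:
  assumes "distinct I" "set I \<subseteq> {..<8}"
  shows "distinct (map (of_nat :: nat \<Rightarrow> 8) I)"
  using assms inj_on_subset[OF bij_betw_imp_inj_on[OF bij_of_nat_8], of "set I"]
  by (simp add: distinct_map)

lemma sum_8_eq: "(\<Sum>i\<in>UNIV. f i) = (\<Sum>i<8. f (of_nat i :: 8))"
  by (rule sum.reindex_bij_betw[OF bij_of_nat_8, symmetric])

lemma eps_of_nat_8:
  assumes "set I \<subseteq> {..<8}" "set J \<subseteq> {..<8}"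
  shows "eps (map (of_nat :: nat \<Rightarrow> 8) I) (map of_nat J) = eps I J"
  by (rule eps_map, rule inj_on_subset[of _ "{..<8}"])
    (use bij_of_nat_8 assms in \<open>auto simp: bij_betw_def\<close>)

lemma spin7_nat_terms_wf:
  "(s, I) \<in> set spin7_nat_terms \<Longrightarrow> distinct I \<and> length I = 4 \<and> set I \<subseteq> {..<8}"
  by (auto simp: spin7_nat_terms_def)

lemma standard_spin7_form_coeff:
  assumes e: "\<And>i j. e i (F j) = (if i = j then 1 else (0::real))"
    and "a < 8" "b < 8" "c < 8" "d < 8"
  shows "standard_spin7_form e (map F (map of_nat [a, b, c, d])) = of_int (spin7_coeff a b c d)"
proof -
  \<comment> \<open>Both sides are alternating in the four indices, so their difference only has to
    be tested on increasing quadruples.\<close>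
  define f where "f a b c d = standard_spin7_form e (map F (map of_nat [a, b, c, d])) -
    of_int (spin7_coeff a b c d)" for a b c d
  have len: "length I = 4" if "(s, I) \<in> set spin7_terms" for s I
    using that by (auto simp: spin7_terms_def)
  have swap: "standard_spin7_form e (xs @ y # x # ys) = - standard_spin7_form e (xs @ x # y # ys)"
    if "length xs + length ys = 2" for xs ys x y
  proof -
    have *: "s * wedge_covectors e I (xs @ y # x # ys) = - (s * wedge_covectors e I (xs @ x # y # ys))"
      if "(s, I) \<in> set spin7_terms" for s I
      using wedge_covectors_swap[of I xs ys e y x] len[OF that] \<open>length xs + length ys = 2\<close> by simp
    show ?thesis
      unfolding standard_spin7_form_def case_prod_unfold uminus_sum_list_map o_def
      by (intro arg_cong[where f = sum_list] map_cong refl) (metis * prod.collapse)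
  qed
  have "f a b c d = 0"
  proof (rule alternating4_eq_0[of 8 f])
    fix a b c d :: nat assume lt: "a < 8" "b < 8" "c < 8" "d < 8"
    show "f b a c d = - f a b c d"
      using swap[of "[]" "[F (of_nat c), F (of_nat d)]" "F (of_nat b)" "F (of_nat a)"] lt by (simp add: f_def spin7_coeff_swap12[of a b])
    show "f a c b d = - f a b c d"
      using swap[of "[F (of_nat a)]" "[F (of_nat d)]" "F (of_nat c)" "F (of_nat b)"] lt by (simp add: f_def spin7_coeff_swap23[of a b c d])
    show "f a b d c = - f a b c d"
      using swap[of "[F (of_nat a), F (of_nat b)]" "[]" "F (of_nat d)" "F (of_nat c)"] lt by (simp add: f_def spin7_coeff_swap34[of c d])
  next
    fix a b c d :: nat assume lt: "a < b" "b < c" "c < d" "d < 8"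
    have *: "wedge_covectors e (map of_nat I) (map F (map of_nat [a, b, c, d])) =
        of_int (eps I [a, b, c, d])" if "(s, I) \<in> set spin7_nat_terms" for s I
    proof -
      have I: "distinct I" "length I = 4" "set I \<subseteq> {..<8}" using spin7_nat_terms_wf[OF that] by auto
      hence "distinct (map (of_nat :: nat \<Rightarrow> 8) I)" by (intro distinct_of_nat_8)
      hence "wedge_covectors e (map of_nat I) (map F (map of_nat [a, b, c, d])) =
        of_int (eps (map (of_nat :: nat \<Rightarrow> 8) I) (map of_nat [a, b, c, d]))"
        by (intro wedge_covectors_eps) (use I e in auto)
      also have "\<dots> = of_int (eps I [a, b, c, d])"
        using eps_of_nat_8[OF I(3), of "[a, b, c, d]"] lt by simp
      finally show ?thesis .
    qed
    have "standard_spin7_form e (map F (map of_nat [a, b, c, d])) =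
        (\<Sum>(s, I)\<leftarrow>spin7_nat_terms. of_int s * of_int (eps I [a, b, c, d]))"
      unfolding standard_spin7_form_def spin7_terms_nat
      using * by (intro arg_cong[where f = sum_list]) auto
    also have "\<dots> = of_int (\<Sum>(s, I)\<leftarrow>spin7_nat_terms. s * eps I [a, b, c, d])"
      by (simp add: spin7_nat_terms_def)
    also have "\<dots> = of_int (spin7_coeff a b c d)"
      using spin7_coeff_eps[OF lt] by simp
    finally show "f a b c d = 0" by (simp add: f_def)
  qed (use assms in auto)
  thus ?thesis by (simp add: f_def)
qed


section \<open>The Hodge star of a wedge product\<close>

lemma bij_betw_permute_list:
  assumes "\<sigma> permutes {..<n}"
  shows "bij_betw (permute_list \<sigma>) {I. length I = n} {I. length I = n}"
proof (rule bij_betw_byWitness[where f' = "permute_list (inv \<sigma>)"])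
  have i: "inv \<sigma> permutes {..<n}" using assms by (rule permutes_inv)
  show "\<forall>I\<in>{I. length I = n}. permute_list (inv \<sigma>) (permute_list \<sigma> I) = I"
  proof
    fix I assume I: "I \<in> {I. length I = n}"
    hence "permute_list (inv \<sigma>) (permute_list \<sigma> I) = permute_list (\<sigma> \<circ> inv \<sigma>) I"
      using i I by (intro permute_list_compose[symmetric]) auto
    thus "permute_list (inv \<sigma>) (permute_list \<sigma> I) = I"
      using permutes_inv_o(1)[OF assms] by simp
  qed
  show "\<forall>I\<in>{I. length I = n}. permute_list \<sigma> (permute_list (inv \<sigma>) I) = I"
  proof
    fix I assume I: "I \<in> {I. length I = n}"
    hence "permute_list \<sigma> (permute_list (inv \<sigma>) I) = permute_list (inv \<sigma> \<circ> \<sigma>) I"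
      using assms I by (intro permute_list_compose[symmetric]) auto
    thus "permute_list \<sigma> (permute_list (inv \<sigma>) I) = I"
      using permutes_inv_o(2)[OF assms] by simp
  qed
qed auto

lemma wedge_covectors_permute_list:
  assumes "\<sigma> permutes {..<n}" "length us = n" "n + length ws = length I"
  shows "wedge_covectors e I (permute_list \<sigma> us @ ws) =
         of_int (sign \<sigma>) * wedge_covectors e I (us @ ws)"
proof -
  have p: "\<sigma> permutes {..<length I}"
    using assms by (intro permutes_subset[OF assms(1)]) auto
  have "map (\<lambda>i. (us @ ws) ! \<sigma> i) [0..<length I] = permute_list \<sigma> us @ ws"
  proof (rule nth_equalityI)
    fix i assume "i < length (map (\<lambda>i. (us @ ws) ! \<sigma> i) [0..<length I])"
    hence i: "i < length I" by simp
    show "map (\<lambda>i. (us @ ws) ! \<sigma> i) [0..<length I] ! i = (permute_list \<sigma> us @ ws) ! i"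
    proof (cases "i < n")
      case True
      moreover from True have "\<sigma> i < n"
        using permutes_in_image[OF assms(1), of i] by simp
      ultimately show ?thesis using i assms(2) by (simp add: nth_append permute_list_def)
    next
      case False
      hence "\<sigma> i = i" using assms(1) by (simp add: permutes_not_in)
      thus ?thesis using False i assms(2) by (simp add: nth_append)
    qed
  qed (use assms in simp)
  thus ?thesis using wedge_covectors_permute[OF p, of e "us @ ws"] by simp
qed

lemma finite_lists_8: "finite {I :: 'b::finite list. length I = n}"
  using finite_lists_length_eq[of "UNIV :: 'b set" n] by simp

lemma sum_lists_append:
  fixes f :: "'b::finite list \<Rightarrow> real"
  shows "(\<Sum>I | length I = p + q. f I) = (\<Sum>I | length I = p. \<Sum>J | length J = q. f (I @ J))"
proof -
  have "bij_betw (\<lambda>(I, J). I @ J) ({I :: 'b list. length I = p} \<times> {J. length J = q})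
      {I. length I = p + q}"
    by (rule bij_betw_byWitness[where f' = "\<lambda>I. (take p I, drop p I)"]) auto
  from sum.reindex_bij_betw[OF this, of f] show ?thesis
    by (simp add: sum.cartesian_product case_prod_unfold)
qed

lemma sum_lists_Suc:
  fixes f :: "'b::finite list \<Rightarrow> real"
  shows "(\<Sum>I | length I = Suc n. f I) = (\<Sum>i\<in>UNIV. \<Sum>I | length I = n. f (i # I))"
proof -
  have "bij_betw (\<lambda>(i, I). i # I) (UNIV \<times> {J :: 'b list. length J = n}) {I. length I = Suc n}"
    by (rule bij_betw_byWitness[where f' = "\<lambda>I. (hd I, tl I)"]) (auto simp: length_Suc_conv)
  from sum.reindex_bij_betw[OF this, of f] show ?thesis
    by (simp add: sum.cartesian_product case_prod_unfold)
qed

text \<open>In the sum over \<open>I\<close>, each permutation of the wedge product can be undone by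
  reindexing; the sign it carries cancels against the one from reordering the volume form. All
  \<open>fact (p + q)\<close> permutations thus contribute equally and cancel the factorial of the
  Hodge star.\<close>

lemma hodge_star_wrt_wedge:
  assumes "p + q + length ws = 8"
  shows "hodge_star_wrt h F (p + q) (wedge p q \<alpha> \<beta>) ws =
    (\<Sum>I | length I = p. \<Sum>J | length J = q. \<alpha> (map F I) * \<beta> (map F J) *
      wedge_covectors (coframe h F) [0,1,2,3,4,5,6,7] (map F I @ map F J @ ws)) / (fact p * fact q)"
proof -
  let ?n = "p + q"
  let ?W = "\<lambda>I. wedge_covectors (coframe h F) [0,1,2,3,4,5,6,7] (map F I @ ws)"
  let ?G = "\<lambda>I. \<alpha> (map F (take p I)) * \<beta> (map F (drop p I)) * ?W I"
  have *: "(\<Sum>I | length I = ?n. of_int (sign \<sigma>) *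
        \<alpha> (map (\<lambda>i. map F I ! \<sigma> i) [0..<p]) * \<beta> (map (\<lambda>i. map F I ! \<sigma> i) [p..<?n]) * ?W I) =
      (\<Sum>I | length I = ?n. ?G I)" if s: "\<sigma> permutes {..<?n}" for \<sigma>
  proof -
    have "(\<Sum>I | length I = ?n. ?G I) = (\<Sum>I | length I = ?n. ?G (permute_list \<sigma> I))"
      by (rule sum.reindex_bij_betw[OF bij_betw_permute_list[OF s], symmetric])
    also have "\<dots> = (\<Sum>I | length I = ?n. of_int (sign \<sigma>) *
        \<alpha> (map (\<lambda>i. map F I ! \<sigma> i) [0..<p]) * \<beta> (map (\<lambda>i. map F I ! \<sigma> i) [p..<?n]) * ?W I)"
    proof (rule sum.cong[OF refl])
      fix I :: "8 list" assume I: "I \<in> {I. length I = ?n}"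
      have lt: "\<sigma> i < ?n" if "i < ?n" for i using permutes_in_image[OF s, of i] that by simp
      have "map F (permute_list \<sigma> I) = permute_list \<sigma> (map F I)"
        using I lt by (simp add: permute_list_def)
      hence "?W (permute_list \<sigma> I) = of_int (sign \<sigma>) * ?W I"
        using wedge_covectors_permute_list[OF s, of "map F I" ws "[0,1,2,3,4,5,6,7]" "coframe h F"]
          I assms by simp
      moreover have "map F (take p (permute_list \<sigma> I)) = map (\<lambda>i. map F I ! \<sigma> i) [0..<p]"
        using I lt by (simp add: permute_list_def take_map)
      moreover have "map F (drop p (permute_list \<sigma> I)) = map (\<lambda>i. map F I ! \<sigma> i) [p..<?n]"
        using I lt by (simp add: permute_list_def drop_map)
      ultimately show "?G (permute_list \<sigma> I) = of_int (sign \<sigma>) *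
        \<alpha> (map (\<lambda>i. map F I ! \<sigma> i) [0..<p]) * \<beta> (map (\<lambda>i. map F I ! \<sigma> i) [p..<?n]) * ?W I"
        by simp
    qed
    finally show ?thesis ..
  qed
  have "hodge_star_wrt h F ?n (wedge p q \<alpha> \<beta>) ws =
      (\<Sum>I | length I = ?n. \<Sum>\<sigma> | \<sigma> permutes {..<?n}. of_int (sign \<sigma>) *
        \<alpha> (map (\<lambda>i. map F I ! \<sigma> i) [0..<p]) * \<beta> (map (\<lambda>i. map F I ! \<sigma> i) [p..<?n]) * ?W I)
      / (fact p * fact q) / fact ?n"
    by (simp add: hodge_star_wrt_def wedge_def sum_distrib_right sum_divide_distrib)
  also have "\<dots> = (\<Sum>\<sigma> | \<sigma> permutes {..<?n}. \<Sum>I | length I = ?n. of_int (sign \<sigma>) *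
        \<alpha> (map (\<lambda>i. map F I ! \<sigma> i) [0..<p]) * \<beta> (map (\<lambda>i. map F I ! \<sigma> i) [p..<?n]) * ?W I)
      / (fact p * fact q) / fact ?n"
    by (subst sum.swap) simp
  also have "(\<Sum>\<sigma> | \<sigma> permutes {..<?n}. \<Sum>I | length I = ?n. of_int (sign \<sigma>) *
        \<alpha> (map (\<lambda>i. map F I ! \<sigma> i) [0..<p]) * \<beta> (map (\<lambda>i. map F I ! \<sigma> i) [p..<?n]) * ?W I) =
      fact ?n * (\<Sum>I | length I = ?n. ?G I)"
    using * by (simp add: card_permutations)
  also have "(\<Sum>I | length I = ?n. ?G I) = (\<Sum>I | length I = p. \<Sum>J | length J = q.
      \<alpha> (map F I) * \<beta> (map F J) *
      wedge_covectors (coframe h F) [0,1,2,3,4,5,6,7] (map F I @ map F J @ ws))"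
    by (subst sum_lists_append) (auto intro!: sum.cong)
  finally show ?thesis by simp
qed

text \<open>On frame vectors the form of \<open>K\<close> is supported on the rearrangements of
  \<open>K\<close>. Each of them contributes the same value, since both factors change by the same
  sign.\<close>

lemma sum_wedge_covectors_contract:
  fixes K :: "8 list"
  assumes e: "\<And>i j. e i (F j) = (if i = j then 1 else (0::real))"
    and len: "length K + length ws = length L"
  shows "(\<Sum>I | length I = length K. wedge_covectors e K (map F I) * wedge_covectors e L (map F I @ ws)) =
    fact (length K) * wedge_covectors e L (map F K @ ws)"
proof -
  let ?k = "length K"
  let ?W = "\<lambda>I. wedge_covectors e L (map F I @ ws)"
  have *: "(\<Sum>I | length I = ?k. of_int (sign \<sigma>) * (\<Prod>a<?k. e (K ! a) (map F I ! \<sigma> a)) * ?W I) = ?W K"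
    if s: "\<sigma> permutes {..<?k}" for \<sigma>
  proof -
    have lt: "\<sigma> i < ?k" if "i < ?k" for i using permutes_in_image[OF s, of i] that by simp
    \<comment> \<open>The product of Kronecker deltas is 1 if \<sigma> rearranges \<open>I\<close>
      to \<open>K\<close> and 0 otherwise; the sign of \<sigma> is absorbed by reordering the
      arguments of \<open>?W\<close>.\<close>
    have "(\<Sum>I | length I = ?k. of_int (sign \<sigma>) * (\<Prod>a<?k. e (K ! a) (map F I ! \<sigma> a)) * ?W I) =
        (\<Sum>I | length I = ?k. if permute_list \<sigma> I = K then ?W (permute_list \<sigma> I) else 0)"
    proof (rule sum.cong[OF refl])
      fix I :: "8 list" assume I: "I \<in> {I. length I = ?k}"
      have "map F (permute_list \<sigma> I) = permute_list \<sigma> (map F I)"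
        using I lt by (simp add: permute_list_def)
      hence W: "?W (permute_list \<sigma> I) = of_int (sign \<sigma>) * ?W I"
        using wedge_covectors_permute_list[OF s, of "map F I" ws L e] I len by simp
      have nth: "map F I ! \<sigma> a = F (permute_list \<sigma> I ! a)" if "a < ?k" for a
        using I lt that by (simp add: permute_list_def)
      show "of_int (sign \<sigma>) * (\<Prod>a<?k. e (K ! a) (map F I ! \<sigma> a)) * ?W I =
          (if permute_list \<sigma> I = K then ?W (permute_list \<sigma> I) else 0)"
      proof (cases "permute_list \<sigma> I = K")
        case True
        have 1: "(\<Prod>a<?k. e (K ! a) (map F I ! \<sigma> a)) = 1"
        proof (intro prod.neutral ballI)
          fix a assume "a \<in> {..<?k}"
          hence "map F I ! \<sigma> a = F (K ! a)" using nth[of a] unfolding True by simp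
          thus "e (K ! a) (map F I ! \<sigma> a) = 1" using e[of "K ! a" "K ! a"] by simp
        qed
        show ?thesis unfolding 1 W[unfolded True] True by (simp only: mult_1_right if_True simp_thms)
      next
        case False
        hence "\<not> (\<forall>a<?k. permute_list \<sigma> I ! a = K ! a)"
          using I by (simp add: list_eq_iff_nth_eq)
        then obtain a where a: "a < ?k" "permute_list \<sigma> I ! a \<noteq> K ! a" by blast
        hence "e (K ! a) (map F I ! \<sigma> a) = 0"
          using nth[OF a(1)] e[of "K ! a" "permute_list \<sigma> I ! a"] by presburger
        hence "(\<Prod>a<?k. e (K ! a) (map F I ! \<sigma> a)) = 0"
          using a(1) by (intro prod_zero) blast+
        thus ?thesis using False by simp
      qed
    qed
    also have "\<dots> = (\<Sum>I | length I = ?k. if I = K then ?W I else 0)"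
      by (rule sum.reindex_bij_betw[OF bij_betw_permute_list[OF s]])
    also have "\<dots> = ?W K" by (simp add: sum.delta' finite_lists_8)
    finally show ?thesis .
  qed
  have "(\<Sum>I | length I = ?k. wedge_covectors e K (map F I) * ?W I) =
      (\<Sum>I | length I = ?k. \<Sum>\<sigma> | \<sigma> permutes {..<?k}.
         of_int (sign \<sigma>) * (\<Prod>a<?k. e (K ! a) (map F I ! \<sigma> a)) * ?W I)"
    by (simp add: wedge_covectors_def sum_distrib_right)
  also have "\<dots> = (\<Sum>\<sigma> | \<sigma> permutes {..<?k}. ?W K)"
    by (subst sum.swap) (use * in simp)
  finally show ?thesis by (simp add: card_permutations)
qed

lemma sum_list_of_int: "of_int (\<Sum>x\<leftarrow>xs. f x) = (\<Sum>x\<leftarrow>xs. of_int (f x))"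
  by (induction xs) auto

lemma sum_sum_list: "(\<Sum>i\<in>S. \<Sum>x\<leftarrow>xs. f i x) = (\<Sum>x\<leftarrow>xs. \<Sum>i\<in>S. f i x)"
  by (induction xs) (auto simp: sum.distrib)

text \<open>The left side is 4! times a component of \<star>\<Phi>, so 24 times that of \<Phi> by
  self-duality. The contraction is computed term by term and the finite check is
  \<open>spin7_coeff_eps_star\<close>.\<close>

lemma standard_spin7_form_contract:
  assumes e: "\<And>i j. e i (F j) = (if i = j then 1 else (0::real))"
    and lt: "a < 8" "b < 8" "c < 8" "d < 8"
  shows "(\<Sum>I | length I = 4. standard_spin7_form e (map F I) *
      wedge_covectors e [0,1,2,3,4,5,6,7] (map F I @ map F (map of_nat [a, b, c, d]))) =
    24 * of_int (spin7_coeff a b c d)"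
proof -
  let ?W = "wedge_covectors e [0,1,2,3,4,5,6,7]"
  define f where "f a b c d = (\<Sum>(s, K)\<leftarrow>spin7_nat_terms.
      of_int s * ?W (map F (map of_nat K) @ map F (map of_nat [a, b, c, d]))) -
    of_int (spin7_coeff a b c d)" for a b c d :: nat
  have contract: "(\<Sum>I | length I = 4. wedge_covectors e (map of_nat K) (map F I) * ?W (map F I @ ws)) =
      24 * ?W (map F (map of_nat K) @ ws)"
    if "K \<in> snd ` set spin7_nat_terms" "length ws = 4" for K ws
    using sum_wedge_covectors_contract[OF e, of "map of_nat K" ws "[0,1,2,3,4,5,6,7]"]
      spin7_nat_terms_wf that by (auto simp: fact_numeral)
  have "(\<Sum>I | length I = 4. standard_spin7_form e (map F I) *
      ?W (map F I @ map F (map of_nat [a, b, c, d]))) =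
    (\<Sum>(s, K)\<leftarrow>spin7_nat_terms. of_int s * (\<Sum>I | length I = 4.
      wedge_covectors e (map of_nat K) (map F I) * ?W (map F I @ map F (map of_nat [a, b, c, d]))))"
    unfolding standard_spin7_form_def spin7_terms_nat
    by (simp add: sum_list_mult_const[symmetric] sum_sum_list o_def case_prod_unfold
        sum_distrib_left mult.assoc)
  also have "\<dots> = 24 * (\<Sum>(s, K)\<leftarrow>spin7_nat_terms.
      of_int s * ?W (map F (map of_nat K) @ map F (map of_nat [a, b, c, d])))"
    unfolding sum_list_const_mult[symmetric] case_prod_unfold
    by (intro arg_cong[where f = sum_list] map_cong refl, subst contract) auto
  finally have main: "(\<Sum>I | length I = 4. standard_spin7_form e (map F I) *
      ?W (map F I @ map F (map of_nat [a, b, c, d]))) = 24 * (f a b c d + of_int (spin7_coeff a b c d))"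
    by (simp add: f_def)
  have swap: "(\<Sum>(s, K)\<leftarrow>spin7_nat_terms. of_int s * ?W (map F (map of_nat K) @ xs @ y # x # ys)) =
      - (\<Sum>(s, K)\<leftarrow>spin7_nat_terms. of_int s * ?W (map F (map of_nat K) @ xs @ x # y # ys))"
    if "length xs + length ys = 2" for xs ys x y
  proof -
    have *: "of_int s * ?W (map F (map of_nat K) @ xs @ y # x # ys) =
        - (of_int s * ?W (map F (map of_nat K) @ xs @ x # y # ys))"
      if "(s, K) \<in> set spin7_nat_terms" for s K
      using wedge_covectors_swap[of "[0,1,2,3,4,5,6,7]" "map F (map of_nat K) @ xs" ys e y x]
        spin7_nat_terms_wf[OF that] \<open>length xs + length ys = 2\<close> by simp
    show ?thesis
      unfolding case_prod_unfold uminus_sum_list_map o_def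
      by (intro arg_cong[where f = sum_list] map_cong refl) (metis * prod.collapse)
  qed
  have "f a b c d = 0"
  proof (rule alternating4_eq_0[of 8 f])
    fix a b c d :: nat assume lt: "a < 8" "b < 8" "c < 8" "d < 8"
    show "f b a c d = - f a b c d"
      using swap[of "[]" "[F (of_nat c), F (of_nat d)]" "F (of_nat b)" "F (of_nat a)"] lt
      by (simp add: f_def spin7_coeff_swap12[of a b])
    show "f a c b d = - f a b c d"
      using swap[of "[F (of_nat a)]" "[F (of_nat d)]" "F (of_nat c)" "F (of_nat b)"] lt
      by (simp add: f_def spin7_coeff_swap23[of a b c d])
    show "f a b d c = - f a b c d"
      using swap[of "[F (of_nat a), F (of_nat b)]" "[]" "F (of_nat d)" "F (of_nat c)"] lt
      by (simp add: f_def spin7_coeff_swap34[of c d])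
  next
    fix a b c d :: nat assume lt: "a < b" "b < c" "c < d" "d < 8"
    have "?W (map F (map of_nat K) @ map F (map of_nat [a, b, c, d])) =
        of_int (eps [0,1,2,3,4,5,6,7] (K @ [a, b, c, d]))" if "(s, K) \<in> set spin7_nat_terms" for s K
    proof -
      have K: "length K = 4" "set K \<subseteq> {..<8}" using spin7_nat_terms_wf[OF that] by auto
      have I: "[0,1,2,3,4,5,6,7] = map (of_nat :: nat \<Rightarrow> 8) [0,1,2,3,4,5,6,7]" by simp
      have "distinct (map (of_nat :: nat \<Rightarrow> 8) [0,1,2,3,4,5,6,7])"
        by (rule distinct_of_nat_8) auto
      hence "?W (map F (map of_nat (K @ [a, b, c, d]))) =
          of_int (eps (map (of_nat :: nat \<Rightarrow> 8) [0,1,2,3,4,5,6,7]) (map of_nat (K @ [a, b, c, d])))"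
        unfolding I by (intro wedge_covectors_eps) (use K e in auto)
      also have "\<dots> = of_int (eps [0,1,2,3,4,5,6,7] (K @ [a, b, c, d]))"
        by (subst eps_of_nat_8) (use K lt in auto)
      finally show ?thesis by simp
    qed
    hence "(\<Sum>(s, K)\<leftarrow>spin7_nat_terms.
        of_int s * ?W (map F (map of_nat K) @ map F (map of_nat [a, b, c, d]))) =
      (\<Sum>(s, K)\<leftarrow>spin7_nat_terms. of_int (s * eps [0,1,2,3,4,5,6,7] (K @ [a, b, c, d])))"
      by (intro arg_cong[where f = sum_list] map_cong) auto
    also have "\<dots> = of_int (spin7_coeff a b c d)"
      using spin7_coeff_eps_star[OF lt] unfolding case_prod_unfold sum_list_of_int[symmetric]
      by (rule arg_cong[where f = of_int])
    finally show "f a b c d = 0" by (simp add: f_def)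
  qed (use lt in auto)
  thus ?thesis using main by simp
qed

text \<open>Contracting \<Phi> with the volume form first leaves 24 times \<Phi>; the normalisation
  1/(4! 2!) of the wedge product turns this into the factor 1/2.\<close>

lemma hodge_star_wedge_spin7_form:
  assumes "orthonormal_basis h F"
    and \<phi>: "\<And>vs. length vs = 4 \<Longrightarrow> \<phi> vs = standard_spin7_form (coframe h F) vs"
    and "k < 8" "l < 8"
  shows "hodge_star_wrt h F 6 (wedge 4 2 \<phi> \<omega>) [F (of_nat k), F (of_nat l)] =
    (\<Sum>i<8. \<Sum>j<8. \<omega> [F (of_nat i), F (of_nat j)] * of_int (spin7_coeff i j k l)) / 2"
proof -
  have e: "coframe h F i (F j) = (if i = j then 1 else 0)" for i j
    using assms(1) by (simp add: orthonormal_basis_def coframe_def)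
  let ?W = "wedge_covectors (coframe h F) [0,1,2,3,4,5,6,7]"
  let ?ws = "[F (of_nat k), F (of_nat l)]"
  have "hodge_star_wrt h F (4 + 2) (wedge 4 2 \<phi> \<omega>) ?ws =
      (\<Sum>I | length I = 4. \<Sum>J | length J = 2. \<phi> (map F I) * \<omega> (map F J) *
        ?W (map F I @ map F J @ ?ws)) / (fact 4 * fact 2)"
    by (rule hodge_star_wrt_wedge) simp
  also have "(\<Sum>I | length I = 4. \<Sum>J | length J = 2. \<phi> (map F I) * \<omega> (map F J) *
        ?W (map F I @ map F J @ ?ws)) =
      (\<Sum>J | length J = 2. \<omega> (map F J) * (\<Sum>I | length I = 4. standard_spin7_form (coframe h F) (map F I) *
        ?W (map F I @ map F J @ ?ws)))"
    by (subst sum.swap) (auto simp: sum_distrib_left \<phi> mult_ac intro!: sum.cong)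
  also have "\<dots> = (\<Sum>i<8. \<Sum>j<8. \<omega> [F (of_nat i), F (of_nat j)] *
      (\<Sum>I | length I = 4. standard_spin7_form (coframe h F) (map F I) *
        ?W (map F I @ map F (map of_nat [i, j, k, l]))))"
    by (simp add: numeral_2_eq_2 sum_lists_Suc sum_8_eq)
  also have "\<dots> = (\<Sum>i<8. \<Sum>j<8. 24 * (\<omega> [F (of_nat i), F (of_nat j)] * of_int (spin7_coeff i j k l)))"
    by (intro sum.cong refl, subst standard_spin7_form_contract[OF e]) (use assms(3,4) in auto)
  finally show ?thesis by (simp add: sum_distrib_left[symmetric] fact_numeral)
qed


section \<open>The action of skew endomorphisms in components\<close>

lemma xor_less_8: "a < 8 \<Longrightarrow> b < 8 \<Longrightarrow> xor a b < (8::nat)"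
  using take_bit_nat_eq_self_iff[of 3 a] take_bit_nat_eq_self_iff[of 3 b]
    take_bit_nat_eq_self_iff[of 3 "xor a b"] by (simp add: take_bit_xor)

lemma xor_nat_cancel [simp]:
  "xor a (xor a b) = (b::nat)" "xor a (xor b a) = b" "xor (xor a b) a = b" "xor (xor b a) a = b"
  by (auto intro!: bit_eqI simp: bit_xor_iff)

lemma xor_eq_iff: "xor i j = (n::nat) \<longleftrightarrow> j = xor i n"
  by auto

lemma xor_left_inject [simp]: "xor a b = xor a c \<longleftrightarrow> b = (c::nat)"
  by (metis xor_nat_cancel(1))

lemma xor_eq_self_iff [simp]: "xor i n = i \<longleftrightarrow> n = (0::nat)"
  by (metis xor_nat_cancel(1) xor_self_eq)

lemma bij_xor_8: "a < 8 \<Longrightarrow> bij_betw (xor a) {..<8::nat} {..<8}"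
  by (rule bij_betw_byWitness[where f' = "xor a"]) (auto simp: xor_less_8)

lemma sum_eq_single:
  fixes f :: "nat \<Rightarrow> 'b::comm_monoid_add"
  assumes "m < n" "\<And>j. j < n \<Longrightarrow> j \<noteq> m \<Longrightarrow> f j = 0"
  shows "(\<Sum>j<n. f j) = f m"
  using assms by (subst sum.remove[of _ m]) auto

lemma spin7_sign_square:
  assumes "a < 8" "b < 8"
  shows "spin7_sign a b * spin7_sign a b = (if a = b then 0 else 1)"
proof -
  have "\<forall>a\<in>set [0..<8]. \<forall>b\<in>set [0..<8].
      spin7_sign a b * spin7_sign a b = (if a = b then 0 else 1)"
    by code_simp
  thus ?thesis using assms by (metis atLeastLessThan_iff set_upt zero_le)
qed

lemma spin7_sign_square_real:
  assumes "a < 8" "b < 8"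
  shows "real_of_int (spin7_sign a b) * real_of_int (spin7_sign a b) = (if a = b then 0 else 1)"
  using spin7_sign_square[OF assms] by (metis of_int_0 of_int_1 of_int_mult)

lemma xor_swap_iff:
  "xor a b = xor c d \<longleftrightarrow> a = xor b (xor c (d::nat))"
  "xor a b = xor c d \<longleftrightarrow> b = xor a (xor c (d::nat))"
  "xor a b = xor c d \<longleftrightarrow> c = xor a (xor b (d::nat))"
  "xor a b = xor c d \<longleftrightarrow> d = xor a (xor b (c::nat))"
proof -
  have *: "xor a b = y \<longleftrightarrow> a = xor b y" "xor a b = y \<longleftrightarrow> b = xor a y" for a b y :: nat by auto
  show "xor a b = xor c d \<longleftrightarrow> a = xor b (xor c d)" "xor a b = xor c d \<longleftrightarrow> b = xor a (xor c d)"
    by (rule *)+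
  have **: "y = xor c d \<longleftrightarrow> c = xor d y" "y = xor c d \<longleftrightarrow> d = xor c y" for c d y :: nat by auto
  have e: "xor a (xor b d) = xor d (xor a b)" "xor a (xor b c) = xor c (xor a b)"
    by (simp_all only: xor.assoc xor.commute xor.left_commute)
  show "xor a b = xor c d \<longleftrightarrow> c = xor a (xor b d)" unfolding e by (rule **)
  show "xor a b = xor c d \<longleftrightarrow> d = xor a (xor b c)" unfolding e by (rule **)
qed

text \<open>Three indices determine the fourth, so that each sum over \<open>j\<close> in
  \<open>form_act\<close> collapses to a single term.\<close>

lemma spin7_coeff_eq_0:
  "a \<noteq> xor b (xor c d) \<Longrightarrow> spin7_coeff a b c d = 0"
  "b \<noteq> xor a (xor c d) \<Longrightarrow> spin7_coeff a b c d = 0"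
  "c \<noteq> xor a (xor b d) \<Longrightarrow> spin7_coeff a b c d = 0"
  "d \<noteq> xor a (xor b c) \<Longrightarrow> spin7_coeff a b c d = 0"
  using xor_swap_iff[of a b c d] by (auto simp only: spin7_coeff_def if_False simp_thms)

definition coset_quadruple :: "nat \<Rightarrow> int \<Rightarrow> nat \<Rightarrow> nat \<Rightarrow> nat \<Rightarrow> nat \<Rightarrow> bool" where
  "coset_quadruple m \<epsilon> a b c d \<longleftrightarrow>
     distinct [a, b, c, d, xor a m, xor b m, xor c m, xor d m] \<and>
     spin7_coeff (xor a m) b c d = \<epsilon> * spin7_sign a (xor a m) \<and>
     spin7_coeff a (xor b m) c d = \<epsilon> * spin7_sign b (xor b m) \<and>
     spin7_coeff a b (xor c m) d = \<epsilon> * spin7_sign c (xor c m) \<and>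
     spin7_coeff a b c (xor d m) = \<epsilon> * spin7_sign d (xor d m)"

text \<open>A quadruple with \<open>m = a xor b xor c xor d \<noteq> 0\<close> represents the cosets of \<open>{0, m}\<close>, so that the
  corresponding component of \<open>w \<cdot> \<Phi>\<close> is a multiple of \<open>pairing7 w m\<close>.\<close>

lemma coset_quadrupleI:
  assumes "a < b" "b < c" "c < d" "d < 8" "m = xor (xor a b) (xor c d)" "m \<noteq> 0"
  shows "\<exists>\<epsilon>. coset_quadruple m \<epsilon> a b c d"
proof -
  have "\<forall>a\<in>set [0..<8]. \<forall>b\<in>set [Suc a..<8]. \<forall>c\<in>set [Suc b..<8]. \<forall>d\<in>set [Suc c..<8].
    xor a b = xor c d \<or>
    coset_quadruple (xor (xor a b) (xor c d)) 1 a b c d \<or>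
    coset_quadruple (xor (xor a b) (xor c d)) (- 1) a b c d"
    by code_simp
  from bspec[OF bspec[OF bspec[OF bspec[OF this, of a], of b], of c], of d] assms(1-4)
  have "xor a b = xor c d \<or> coset_quadruple m 1 a b c d \<or> coset_quadruple m (- 1) a b c d"
    unfolding assms(5) by simp
  moreover have "xor a b \<noteq> xor c d" using assms(5,6) by auto
  ultimately have "coset_quadruple m 1 a b c d \<or> coset_quadruple m (- 1) a b c d" by blast
  thus ?thesis by blast
qed

text \<open>Twice the inner product of the 2-form \<open>w\<close> with the \<open>n\<close>-th basis element of \<open>\<Lambda>\<^sup>2\<^sub>7\<close>.\<close>

definition pairing7 :: "(nat \<Rightarrow> nat \<Rightarrow> real) \<Rightarrow> nat \<Rightarrow> real" where
  "pairing7 w n = (\<Sum>i<8. of_int (spin7_sign i (xor i n)) * w i (xor i n))"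

text \<open>The coefficient is \<open>spin7_sign i j * spin7_sign k l\<close> for
  \<open>xor i j = xor k l\<close>, except that distinctness removes \<open>i = k\<close> and
  \<open>i = l\<close>. Completing the sum to \<open>pairing7\<close> adds these two terms, each
  equal to \<open>w k l\<close>. After halving, the operator \<omega> to \<star>(\<Phi> \<and>
  \<omega>) is visibly 3 on the span of the sign forms and -1 where \<open>pairing7\<close>
  vanishes.\<close>

lemma spin7_coeff_contract:
  assumes skew: "\<And>i j. i < 8 \<Longrightarrow> j < 8 \<Longrightarrow> w i j = - (w j i :: real)"
    and kl: "k < 8" "l < 8" "k \<noteq> l"
  shows "(\<Sum>i<8. \<Sum>j<8. w i j * of_int (spin7_coeff i j k l)) =
    pairing7 w (xor k l) * of_int (spin7_sign k l) - 2 * w k l"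
proof -
  let ?n = "xor k l"
  let ?s = "\<lambda>i j. real_of_int (spin7_sign i j)"
  let ?g = "\<lambda>i. ?s i (xor i ?n) * w i (xor i ?n) * ?s k l"
  have n: "?n < 8" using kl by (simp add: xor_less_8)
  have n0: "?n \<noteq> 0" using kl by (simp add: xor_eq_iff)
  have kn: "xor k ?n = l" "xor l ?n = k" by simp_all
  have inner: "(\<Sum>j<8. w i j * of_int (spin7_coeff i j k l)) = (if i = k \<or> i = l then 0 else ?g i)"
    if i: "i < 8" for i
  proof -
    have "(\<Sum>j<8. w i j * of_int (spin7_coeff i j k l)) =
        w i (xor i ?n) * of_int (spin7_coeff i (xor i ?n) k l)"
      by (rule sum_eq_single) (use i n in \<open>auto simp: xor_less_8 spin7_coeff_def xor_eq_iff\<close>)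
    moreover have "xor i ?n = k \<longleftrightarrow> i = l" "xor i ?n = l \<longleftrightarrow> i = k"
      using kn by (metis xor.commute xor_left_inject)+
    moreover have "xor i ?n \<noteq> i" using n0 by simp
    ultimately show ?thesis using kl by (auto simp: spin7_coeff_def)
  qed
  have "(\<Sum>i<8. \<Sum>j<8. w i j * of_int (spin7_coeff i j k l)) =
      (\<Sum>i<8. if i = k \<or> i = l then 0 else ?g i)"
    using inner by simp
  also have "\<dots> = (\<Sum>i\<in>{..<8} - {k} - {l}. ?g i)"
    by (rule sum.mono_neutral_cong_right) auto
  also have "\<dots> = (\<Sum>i<8. ?g i) - ?g k - ?g l"
    using kl by (simp add: sum_diff1)
  also have "?g k = w k l"
    using spin7_sign_square_real[OF kl(1,2)] kl kn(1) by (simp add: mult_ac)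
  also have "?g l = w k l"
    using spin7_sign_square_real[OF kl(1,2)] kl kn(2) skew[OF kl(2,1)] spin7_sign_skew[OF kl(2,1)]
    by (simp add: mult_ac)
  also have "(\<Sum>i<8. ?g i) = pairing7 w ?n * ?s k l"
    by (simp add: pairing7_def sum_distrib_right)
  finally show ?thesis by simp
qed

text \<open>The derivation action on \<Phi> of the endomorphism whose image of the
  \<open>i\<close>-th basis vector has \<open>j\<close>-th coefficient \<open>w i j\<close>.\<close>

definition form_act :: "(nat \<Rightarrow> nat \<Rightarrow> real) \<Rightarrow> nat \<Rightarrow> nat \<Rightarrow> nat \<Rightarrow> nat \<Rightarrow> real" where
  "form_act w a b c d =
    (\<Sum>j<8. w a j * of_int (spin7_coeff j b c d)) + (\<Sum>j<8. w b j * of_int (spin7_coeff a j c d)) +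
    (\<Sum>j<8. w c j * of_int (spin7_coeff a b j d)) + (\<Sum>j<8. w d j * of_int (spin7_coeff a b c j))"

text \<open>The Lie algebra of the stabilizer kills \<Phi>. On an increasing quadruple with total
  xor \<open>m\<close>, each of the four sums has one surviving term. For \<open>m = 0\<close> it
  contains a diagonal entry of \<open>w\<close>; otherwise the four terms add up to a multiple of
  \<open>pairing7 w m\<close>.\<close>

lemma spin7_coeff_annihilate:
  assumes skew: "\<And>i j. i < 8 \<Longrightarrow> j < 8 \<Longrightarrow> w i j = - (w j i :: real)"
    and 0: "\<And>n. 0 < n \<Longrightarrow> n < 8 \<Longrightarrow> pairing7 w n = 0"
    and lt: "a < 8" "b < 8" "c < 8" "d < 8"
  shows "form_act w a b c d = 0"
proof -
  let ?f = "\<lambda>a b c d. (\<Sum>j<8. w a j * of_int (spin7_coeff j b c d)) + (\<Sum>j<8. w b j * of_int (spin7_coeff a j c d)) +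
    (\<Sum>j<8. w c j * of_int (spin7_coeff a b j d)) + (\<Sum>j<8. w d j * of_int (spin7_coeff a b c j))"
  have "?f a b c d = 0"
  proof (rule alternating4_eq_0[of 8 ?f])
  fix a b c d :: nat assume lt: "a < 8" "b < 8" "c < 8" "d < 8"
  have s12: "spin7_coeff y x z t = - spin7_coeff x y z t" if "x < 8" "y < 8" for x y z t
    using that by (rule spin7_coeff_swap12)
  have s34: "spin7_coeff x y t z = - spin7_coeff x y z t" if "z < 8" "t < 8" for x y z t
    using that by (rule spin7_coeff_swap34)
  have s23: "spin7_coeff x z y t = - spin7_coeff x y z t" if "x < 8" "y < 8" "z < 8" "t < 8" for x y z t
    using that by (rule spin7_coeff_swap23)
  have neg: "(\<Sum>j<8. u j * of_int (p j)) = - (\<Sum>j<8. u j * of_int (q j))"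
    if "\<And>j. j < 8 \<Longrightarrow> p j = - q j" for u :: "nat \<Rightarrow> real" and p q :: "nat \<Rightarrow> int"
    using that by (simp add: sum_negf[symmetric])
  have
    "(\<Sum>j<8. w b j * of_int (spin7_coeff j a c d)) = - (\<Sum>j<8. w b j * of_int (spin7_coeff a j c d))"
    "(\<Sum>j<8. w a j * of_int (spin7_coeff b j c d)) = - (\<Sum>j<8. w a j * of_int (spin7_coeff j b c d))"
    "(\<Sum>j<8. w c j * of_int (spin7_coeff b a j d)) = - (\<Sum>j<8. w c j * of_int (spin7_coeff a b j d))"
    "(\<Sum>j<8. w d j * of_int (spin7_coeff b a c j)) = - (\<Sum>j<8. w d j * of_int (spin7_coeff a b c j))"
    by (rule neg, rule s12, simp_all add: lt)+
  thus "?f b a c d = - ?f a b c d" by simp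
  have
    "(\<Sum>j<8. w a j * of_int (spin7_coeff j c b d)) = - (\<Sum>j<8. w a j * of_int (spin7_coeff j b c d))"
    "(\<Sum>j<8. w c j * of_int (spin7_coeff a j b d)) = - (\<Sum>j<8. w c j * of_int (spin7_coeff a b j d))"
    "(\<Sum>j<8. w b j * of_int (spin7_coeff a c j d)) = - (\<Sum>j<8. w b j * of_int (spin7_coeff a j c d))"
    "(\<Sum>j<8. w d j * of_int (spin7_coeff a c b j)) = - (\<Sum>j<8. w d j * of_int (spin7_coeff a b c j))"
    by (rule neg, rule s23, simp_all add: lt)+
  thus "?f a c b d = - ?f a b c d" by simp
  have
    "(\<Sum>j<8. w a j * of_int (spin7_coeff j b d c)) = - (\<Sum>j<8. w a j * of_int (spin7_coeff j b c d))"
    "(\<Sum>j<8. w b j * of_int (spin7_coeff a j d c)) = - (\<Sum>j<8. w b j * of_int (spin7_coeff a j c d))"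
    "(\<Sum>j<8. w d j * of_int (spin7_coeff a b j c)) = - (\<Sum>j<8. w d j * of_int (spin7_coeff a b c j))"
    "(\<Sum>j<8. w c j * of_int (spin7_coeff a b d j)) = - (\<Sum>j<8. w c j * of_int (spin7_coeff a b j d))"
    by (rule neg, rule s34, simp_all add: lt)+
  thus "?f a b d c = - ?f a b c d" by simp
next
  fix a b c d :: nat assume ord: "a < b" "b < c" "c < d" "d < 8"
  define m where "m = xor (xor a b) (xor c d)"
  let ?s = "\<lambda>i j. real_of_int (spin7_sign i j)"
  have lt: "a < 8" "b < 8" "c < 8" "d < 8" using ord by auto
  hence m: "m < 8" by (simp add: m_def xor_less_8)
  have xm: "xor a m = xor b (xor c d)" "xor b m = xor a (xor c d)"
      "xor c m = xor a (xor b d)" "xor d m = xor a (xor b c)"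
    by (auto simp: m_def bit_xor_iff intro!: bit_eqI)
  have "?f a b c d = w a (xor a m) * of_int (spin7_coeff (xor a m) b c d) +
      w b (xor b m) * of_int (spin7_coeff a (xor b m) c d) +
      w c (xor c m) * of_int (spin7_coeff a b (xor c m) d) +
      w d (xor d m) * of_int (spin7_coeff a b c (xor d m))"
    unfolding xm
    by (intro arg_cong2[where f = "(+)"] sum_eq_single)
      (use lt in \<open>auto simp: xor_less_8 spin7_coeff_eq_0\<close>)
  also have "\<dots> = 0"
  proof (cases "m = 0")
    case True
    thus ?thesis using skew[of a a] skew[of b b] skew[of c c] skew[of d d] lt by simp
  next
    case False
    then obtain \<epsilon> where "coset_quadruple m \<epsilon> a b c d"
      using coset_quadrupleI[OF ord m_def] by blast
    note q = this[unfolded coset_quadruple_def, THEN conjunct1]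
      this[unfolded coset_quadruple_def, THEN conjunct2]
    let ?L = "[a, b, c, d, xor a m, xor b m, xor c m, xor d m]"
    have set: "set ?L = {..<8}"
    proof (rule card_subset_eq)
      show "card (set ?L) = card {..<8::nat}"
        using q(1) by (simp add: distinct_card)
    qed (use lt m in \<open>auto simp: xor_less_8\<close>)
    let ?g = "\<lambda>i. ?s i (xor i m) * w i (xor i m)"
    \<comment> \<open>\<open>w\<close> and the sign table are both skew, so \<open>?g\<close> is
      constant on the cosets of {0, m}. The sum over all eight indices is twice the sum over the
      representatives \<open>a\<close>, \<open>b\<close>, \<open>c\<close>,
      \<open>d\<close>.\<close>
    have g: "?g (xor i m) = ?g i" if "i < 8" for i
      using that m skew[of "xor i m" i] spin7_sign_skew[of "xor i m" i] by (simp add: xor_less_8)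
    have "pairing7 w m = sum_list (map ?g ?L)"
      using q(1)
      by (simp only: pairing7_def set[symmetric] sum_list_distinct_conv_sum_set)
    also have "\<dots> = 2 * (?g a + ?g b + ?g c + ?g d)"
      using g[OF lt(1)] g[OF lt(2)] g[OF lt(3)] g[OF lt(4)] by simp
    finally have g0: "?g a + ?g b + ?g c + ?g d = 0" using 0[of m] False m by simp
    show ?thesis
      using q(2) arg_cong[OF g0, of "\<lambda>t. of_int \<epsilon> * t"] by (simp add: algebra_simps)
  qed
  finally show "?f a b c d = 0" .
  qed (use lt in auto)
  thus ?thesis by (simp add: form_act_def)
qed

text \<open>The action on \<Phi> of the \<open>m\<close>-th basis element of
  \<open>Lambda2_7\<close>, whose entries are \<open>spin7_sign i (xor i m)\<close>.\<close>

definition coeff_act :: "nat \<Rightarrow> nat \<Rightarrow> nat \<Rightarrow> nat \<Rightarrow> nat \<Rightarrow> int" where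
  "coeff_act m a b c d =
     spin7_sign a (xor a m) * spin7_coeff (xor a m) b c d +
     spin7_sign b (xor b m) * spin7_coeff a (xor b m) c d +
     spin7_sign c (xor c m) * spin7_coeff a b (xor c m) d +
     spin7_sign d (xor d m) * spin7_coeff a b c (xor d m)"

lemma spin7_coeff_act:
  assumes w: "\<And>i j. i < 8 \<Longrightarrow> j < 8 \<Longrightarrow> w i j = x (xor i j) * (of_int (spin7_sign i j) :: real)"
    and lt: "a < 8" "b < 8" "c < 8" "d < 8"
  shows "form_act w a b c d =
    x (xor (xor a b) (xor c d)) * of_int (coeff_act (xor (xor a b) (xor c d)) a b c d)"
proof -
  define m where "m = xor (xor a b) (xor c d)"
  have m: "m < 8" using lt by (simp add: m_def xor_less_8)
  have xm: "xor a m = xor b (xor c d)" "xor b m = xor a (xor c d)"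
      "xor c m = xor a (xor b d)" "xor d m = xor a (xor b c)"
    by (auto simp: m_def bit_xor_iff intro!: bit_eqI)
  have "form_act w a b c d =
      w a (xor a m) * of_int (spin7_coeff (xor a m) b c d) +
      w b (xor b m) * of_int (spin7_coeff a (xor b m) c d) +
      w c (xor c m) * of_int (spin7_coeff a b (xor c m) d) +
      w d (xor d m) * of_int (spin7_coeff a b c (xor d m))"
    unfolding xm form_act_def
    by (intro arg_cong2[where f = "(+)"] sum_eq_single)
      (use lt in \<open>auto simp: xor_less_8 spin7_coeff_eq_0\<close>)
  also have "\<dots> = x m * of_int (coeff_act m a b c d)"
    unfolding coeff_act_def
    using lt m by (simp add: w xor_less_8 algebra_simps)
  finally show ?thesis by (simp add: m_def)
qed

text \<open>The integer coefficients in the component (m, a, b, c, d) of d\<Phi> = \<theta> \<and>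
  \<Phi>. The factors -4 and 4 alternate like the signs of the alternation, so the four unknowns
  enter with equal signs. The vanishing coefficients leave only the \<theta>-component of index
  \<open>m\<close> on the right.\<close>

definition quadruple_relations :: "nat \<Rightarrow> nat \<Rightarrow> nat \<Rightarrow> nat \<Rightarrow> nat \<Rightarrow> bool" where
  "quadruple_relations m a b c d \<longleftrightarrow>
     coeff_act 0 a b c d = 0 \<and> xor (xor a b) (xor c d) = 0 \<and>
     coeff_act (xor a m) m b c d = - 4 * spin7_coeff a b c d * spin7_sign a m \<and>
     coeff_act (xor b m) m a c d = 4 * spin7_coeff a b c d * spin7_sign b m \<and>
     coeff_act (xor c m) m a b d = - 4 * spin7_coeff a b c d * spin7_sign c m \<and>
     coeff_act (xor d m) m a b c = 4 * spin7_coeff a b c d * spin7_sign d m \<and>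
     spin7_coeff m b c d = 0 \<and> spin7_coeff a m c d = 0 \<and>
     spin7_coeff a b m d = 0 \<and> spin7_coeff a b c m = 0 \<and> spin7_coeff a b c d \<noteq> 0"

lemma quadruple_relationsI:
  assumes "(s, [a, b, c, d]) \<in> set spin7_nat_terms" "m < 8" "m \<notin> {a, b, c, d}"
  shows "quadruple_relations m a b c d"
proof -
  have "\<forall>(s, I)\<in>set spin7_nat_terms. \<forall>m\<in>set [0..<8]. m \<notin> set I \<longrightarrow>
      quadruple_relations m (I ! 0) (I ! 1) (I ! 2) (I ! 3)"
    by code_simp
  from bspec[OF this assms(1)] show ?thesis
    using assms(2,3) by (simp add: numeral_2_eq_2 numeral_3_eq_3)
qed


section \<open>Solving for the intrinsic torsion\<close>

text \<open>The quadruples of \<Phi> form the Steiner system S(3,4,8). The seven blocks omitting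
  \<open>m\<close> are the complements of the lines of a Fano plane on the remaining seven indices;
  their incidence matrix is invertible, so the constant solution is the only one.\<close>

lemma spin7_quadruples_solve:
  fixes y :: "nat \<Rightarrow> real"
  assumes eq: "\<And>s I. (s, I) \<in> set spin7_nat_terms \<Longrightarrow> m \<notin> set I \<Longrightarrow> (\<Sum>q\<leftarrow>I. y q) = 4 * t"
    and "m < 8" "q < 8" "q \<noteq> m"
  shows "y q = t"
proof -
  have E: "\<forall>(s, I)\<in>set spin7_nat_terms. m \<notin> set I \<longrightarrow> (\<Sum>q\<leftarrow>I. y q) = 4 * t"
    using eq by blast
  have all: "\<forall>q\<in>{0,1,2,3,4,5,6,7}. q \<noteq> m \<longrightarrow> y q = t"
  proof -
    consider "m = 0" | "m = 1" | "m = 2" | "m = 3" | "m = 4" | "m = 5" | "m = 6" | "m = 7"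
      using assms(2) by linarith
    thus ?thesis
      by cases (use E in \<open>simp add: spin7_nat_terms_def; linarith\<close>)+
  qed
  have "q \<in> {0,1,2,3,4,5,6,7}" using assms(3) by auto
  thus ?thesis using all assms(4) by blast
qed

text \<open>The component \<open>(m, a, b, c, d)\<close> of \<open>d\<Phi> = \<theta> \<and> \<Phi>\<close>, for a quadruple of \<open>\<Phi>\<close> that omits \<open>m\<close>, only
  involves \<open>\<theta>\<^sub>m\<close> and the four unknowns \<open>x q (xor q m)\<close> with \<open>q\<close> in the quadruple.\<close>

lemma spin7_torsion_solve:
  fixes w :: "nat \<Rightarrow> nat \<Rightarrow> nat \<Rightarrow> real"
  assumes w: "\<And>k i j. k < 8 \<Longrightarrow> i < 8 \<Longrightarrow> j < 8 \<Longrightarrow> w k i j = x k (xor i j) * of_int (spin7_sign i j)"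
    and eq: "\<And>a b c d e. a < 8 \<Longrightarrow> b < 8 \<Longrightarrow> c < 8 \<Longrightarrow> d < 8 \<Longrightarrow> e < 8 \<Longrightarrow>
      form_act (w a) b c d e - form_act (w b) a c d e + form_act (w c) a b d e -
      form_act (w d) a b c e + form_act (w e) a b c d =
      \<theta> a * of_int (spin7_coeff b c d e) - \<theta> b * of_int (spin7_coeff a c d e) -
      \<theta> c * of_int (spin7_coeff b a d e) - \<theta> d * of_int (spin7_coeff b c a e) -
      \<theta> e * of_int (spin7_coeff b c d a)"
    and lt: "k < 8" "i < 8" "j < 8"
  shows "w k i j = \<theta> (xor k (xor i j)) * of_int (spin7_sign k (xor k (xor i j))) *
    of_int (spin7_sign i j) / 16"
proof (cases "i = j")
  case True
  thus ?thesis using w[OF lt] spin7_sign_square_real[OF lt(2,3)] by simp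
next
  case False
  \<comment> \<open>With this \<open>m\<close> the unknown \<open>x k (xor i j)\<close> is
    \<open>x k (xor k m)\<close>, so it belongs to the system for the \<theta>-component of index
    \<open>m\<close>.\<close>
  define m where "m = xor k (xor i j)"
  have m: "m < 8" using lt by (simp add: m_def xor_less_8)
  have "xor i j \<noteq> 0" using False by (simp add: xor_eq_iff)
  hence km: "k \<noteq> m" unfolding m_def by (metis xor_eq_self_iff)
  let ?y = "\<lambda>q. x q (xor q m) * of_int (spin7_sign q m)"
  \<comment> \<open>One factor 4 comes from \<open>quadruple_relations\<close>, the other from the
    four unknowns in each equation.\<close>
  have "?y k = \<theta> m / 16"
  proof (rule spin7_quadruples_solve[where m = m and y = ?y and t = "\<theta> m / 16" and q = k])
    fix s I assume sI: "(s, I) \<in> set spin7_nat_terms" "m \<notin> set I"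
    then obtain a b c d where I: "I = [a, b, c, d]"
      using spin7_nat_terms_wf[OF sI(1)] by (auto simp: length_Suc_conv numeral_eq_Suc)
    have abcd: "a < 8" "b < 8" "c < 8" "d < 8" using spin7_nat_terms_wf[OF sI(1)] I by auto
    have "quadruple_relations m a b c d"
      using quadruple_relationsI[of s a b c d m] sI m I by simp
    note q = this[unfolded quadruple_relations_def]
    have "xor a b = xor c d" using q by (metis xor_nat_cancel(1) xor.right_neutral)
    hence a: "a = xor b (xor c d)" by (rule iffD1[OF xor_swap_iff(1)])
    have x4: "xor (xor m b) (xor c d) = xor a m" "xor (xor m a) (xor c d) = xor b m"
      "xor (xor m a) (xor b d) = xor c m" "xor (xor m a) (xor b c) = xor d m"
      unfolding a by (auto simp: bit_xor_iff intro!: bit_eqI)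
    let ?C = "real_of_int (spin7_coeff a b c d)"
    have act: "form_act (w p) a' b' c' d' = x p (xor (xor a' b') (xor c' d')) *
        of_int (coeff_act (xor (xor a' b') (xor c' d')) a' b' c' d')"
      if "p < 8" "a' < 8" "b' < 8" "c' < 8" "d' < 8" for p a' b' c' d'
      using that by (intro spin7_coeff_act w)
    have "?C * (4 * (?y a + ?y b + ?y c + ?y d)) = ?C * \<theta> m"
      using eq[OF m abcd] abcd m by (simp add: act x4 q algebra_simps)
    moreover have "?C \<noteq> 0" using q by simp
    ultimately have "4 * (?y a + ?y b + ?y c + ?y d) = \<theta> m" by (metis mult_left_cancel)
    thus "(\<Sum>q\<leftarrow>I. ?y q) = 4 * (\<theta> m / 16)" by (simp add: I)
  qed (use m lt km in auto)
  moreover have "xor k m = xor i j" by (simp add: m_def)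
  ultimately have "x k (xor i j) * of_int (spin7_sign k m) = \<theta> m / 16" by simp
  hence "x k (xor i j) * (of_int (spin7_sign k m) * of_int (spin7_sign k m)) =
      \<theta> m * of_int (spin7_sign k m) / 16"
    by (metis mult.assoc times_divide_eq_left)
  hence "x k (xor i j) = \<theta> m * of_int (spin7_sign k m) / 16"
    using spin7_sign_square_real[OF lt(1) m] km by simp
  thus ?thesis using w[OF lt] by (simp add: m_def)
qed

text \<open>For \<open>k = i\<close> the \<theta>-index is \<open>j\<close> and the two signs
  coincide, so each of the seven indices \<open>i\<close> other than \<open>j\<close> contributes
  the same amount. Read backwards, this expresses \<theta> through \<xi>.\<close>

lemma spin7_torsion_trace:
  fixes w :: "nat \<Rightarrow> nat \<Rightarrow> nat \<Rightarrow> real"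
  assumes w: "\<And>k i j. k < 8 \<Longrightarrow> i < 8 \<Longrightarrow> j < 8 \<Longrightarrow>
      w k i j = \<theta> (xor k (xor i j)) * of_int (spin7_sign k (xor k (xor i j))) * of_int (spin7_sign i j) / 16"
    and j: "j < 8"
  shows "(\<Sum>i<8. w i i j) = 7 / 16 * \<theta> j"
proof -
  have "(\<Sum>i<8. w i i j) = (\<Sum>i<8. if i = j then 0 else \<theta> j / 16)"
  proof (intro sum.cong refl)
    fix i :: nat assume "i \<in> {..<8}"
    hence "w i i j = \<theta> j * (of_int (spin7_sign i j) * of_int (spin7_sign i j)) / 16"
      using w[of i i j] j by simp
    thus "w i i j = (if i = j then 0 else \<theta> j / 16)"
      using spin7_sign_square_real[of i j] j \<open>i \<in> {..<8}\<close> by (cases "i = j") simp_all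
  qed
  also have "\<dots> = (\<Sum>i\<in>{..<8} - {j}. \<theta> j / 16)" by (rule sum.mono_neutral_cong_right) auto
  finally show ?thesis using j by simp
qed

lemma sum_lessThan_8:
  "(\<Sum>n<8. f n) = f 0 + f 1 + f 2 + f 3 + f 4 + f 5 + f 6 + f (7::nat)"
  by (simp add: eval_nat_numeral)

text \<open>The entry for \<open>n = 0\<close> vanishes. If it is filled with
  \<open>\<theta> a\<close>, the rows become orthogonal of squared length |\<theta>|^2, which is the
  polarised eight-square identity; the filled column accounts for the term
  \<open>- \<theta> a * \<theta> b\<close>.\<close>

lemma spin7_sign_orthogonal:
  assumes "a < 8" "b < 8"
  shows "(\<Sum>n<8. \<theta> (xor a n) * of_int (spin7_sign a (xor a n)) *
      (\<theta> (xor b n) * of_int (spin7_sign b (xor b n)))) =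
    (if a = b then \<Sum>n<8. (\<theta> n)\<^sup>2 else 0) - \<theta> a * (\<theta> b :: real)"
proof -
  have "\<forall>a\<in>{0,1,2,3,4,5,6,7}. \<forall>b\<in>{0,1,2,3,4,5,6,7}.
    (\<Sum>n<8. \<theta> (xor a n) * of_int (spin7_sign a (xor a n)) *
      (\<theta> (xor b n) * of_int (spin7_sign b (xor b n)))) =
    (if a = b then \<Sum>n<8. (\<theta> n)\<^sup>2 else 0) - \<theta> a * (\<theta> b :: real)"
    by (simp add: spin7_sign_def sum_lessThan_8 power2_eq_square algebra_simps)
      (simp add: numeral_2_eq_2 numeral_3_eq_3)
  moreover have "a \<in> {0,1,2,3,4,5,6,7}" "b \<in> {0,1,2,3,4,5,6,7}" using assms by auto
  ultimately show ?thesis by blast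
qed

text \<open>The products depend only on \<open>n = xor i j\<close>, and each \<open>n\<close> arises
  from eight pairs: 8/256 = 1/32.\<close>

lemma spin7_torsion_gram:
  fixes w :: "nat \<Rightarrow> nat \<Rightarrow> nat \<Rightarrow> real"
  assumes w: "\<And>k i j. k < 8 \<Longrightarrow> i < 8 \<Longrightarrow> j < 8 \<Longrightarrow>
      w k i j = \<theta> (xor k (xor i j)) * of_int (spin7_sign k (xor k (xor i j))) * of_int (spin7_sign i j) / 16"
    and ab: "a < 8" "b < 8"
  shows "(\<Sum>i<8. \<Sum>j<8. w a i j * w b i j) =
    ((if a = b then \<Sum>n<8. (\<theta> n)\<^sup>2 else 0) - \<theta> a * \<theta> b) / 32"
proof -
  let ?g = "\<lambda>n. \<theta> (xor a n) * of_int (spin7_sign a (xor a n)) *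
      (\<theta> (xor b n) * of_int (spin7_sign b (xor b n)))"
  have "w a i j * w b i j = ?g (xor i j) / 256" if "i < 8" "j < 8" for i j
  proof -
    have "w a i j * w b i j = ?g (xor i j) * (of_int (spin7_sign i j) * of_int (spin7_sign i j)) / 256"
      using that ab by (simp add: w)
    \<comment> \<open>For \<open>i = j\<close> the squared sign is 0 instead of 1, so the formula
      needs the diagonal value of \<open>?g\<close> to vanish as well.\<close>
    moreover have "?g 0 = 0" using spin7_sign_square_real[OF ab(1,1)] by simp
    ultimately show ?thesis using spin7_sign_square_real[OF that] by (cases "i = j") auto
  qed
  hence "(\<Sum>i<8. \<Sum>j<8. w a i j * w b i j) = (\<Sum>i<8. \<Sum>j<8. ?g (xor i j) / 256)"
    by (intro sum.cong refl) auto
  also have "\<dots> = (\<Sum>i<8::nat. \<Sum>n<8. ?g n / 256)"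
    by (intro sum.cong refl sum.reindex_bij_betw bij_xor_8) simp
  also have "\<dots> = (\<Sum>n<8. ?g n) / 32" by (simp flip: sum_divide_distrib)
  also have "(\<Sum>n<8. ?g n) = (if a = b then \<Sum>n<8. (\<theta> n)\<^sup>2 else 0) - \<theta> a * \<theta> b"
    by (rule spin7_sign_orthogonal[OF ab])
  finally show ?thesis .
qed


section \<open>Multilinear tensors and orthonormal bases\<close>

lemma multilinear_tensorD:
  "multilinear_tensor k \<alpha> \<Longrightarrow> length vs = k \<Longrightarrow> i < k \<Longrightarrow> linear (\<lambda>v. \<alpha> (vs[i := v]))"
  by (simp add: multilinear_tensor_def)

lemma multilinear_tensor_append:
  "multilinear_tensor k \<alpha> \<Longrightarrow> length us + length ws + 1 = k \<Longrightarrow> linear (\<lambda>v. \<alpha> (us @ v # ws))"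
  using multilinear_tensorD[of k \<alpha> "us @ 0 # ws" "length us"] by simp

lemma multilinear_tensor_2:
  assumes "multilinear_tensor 2 h"
  shows "linear (\<lambda>u. h [u, v])" "linear (\<lambda>v. h [u, v])"
  using multilinear_tensor_append[OF assms, of "[]" "[v]"]
    multilinear_tensor_append[OF assms, of "[u]" "[]"] by simp_all

lemma alternating_form_swap:
  assumes \<alpha>: "alternating_form k \<alpha>" and len: "length vs = k" and ij: "i < j" "j < k"
  shows "\<alpha> (vs[i := vs ! j, j := vs ! i]) = - \<alpha> vs"
proof -
  have ml: "multilinear_tensor k \<alpha>" using \<alpha> by (simp add: alternating_form_def)
  let ?f = "\<lambda>u v. \<alpha> (vs[i := u, j := v])"
  have 0: "?f u u = 0" for u
    using \<alpha> len ij by (simp add: alternating_form_def)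
  have 1: "?f (u + u') v = ?f u v + ?f u' v" for u u' v
    using linear_add[OF multilinear_tensorD[OF ml, of "vs[j := v]" i], of u u'] len ij
    by (simp add: list_update_swap)
  have 2: "?f u (v + v') = ?f u v + ?f u v'" for u v v'
    using linear_add[OF multilinear_tensorD[OF ml, of "vs[i := u]" j], of v v'] len ij by simp
  have "?f u v = - ?f v u" for u v
  proof -
    have "?f (u + v) (u + v) = (?f u u + ?f u v) + (?f v u + ?f v v)" by (simp only: 1 2)
    thus ?thesis unfolding 0 by simp
  qed
  from this[of "vs ! j" "vs ! i"] show ?thesis by simp
qed

lemma alternating_form_permute_tail:
  assumes \<beta>: "alternating_form q \<beta>" and \<sigma>: "\<sigma> permutes {1..<Suc q}"
  shows "\<beta> (map (\<lambda>i. us (\<sigma> i)) [1..<Suc q]) = of_int (sign \<sigma>) * \<beta> (map us [1..<Suc q])"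
proof -
  have "finite {1..<Suc q}" by simp
  from this \<sigma> show ?thesis
  proof (induction rule: permutes_rev_induct)
    case id
    show ?case by simp
  next
    case (swap a b p)
    have *: "\<beta> (map (\<lambda>i. us (p (Transposition.transpose a b i))) [1..<Suc q]) =
        - \<beta> (map (\<lambda>i. us (p i)) [1..<Suc q])"
      if ab: "a < b" "1 \<le> a" "b < Suc q" for a b
    proof -
      let ?xs = "map (\<lambda>i. us (p i)) [1..<Suc q]"
      have "map (\<lambda>i. us (p (Transposition.transpose a b i))) [1..<Suc q] =
          ?xs[a - 1 := ?xs ! (b - 1), b - 1 := ?xs ! (a - 1)]"
        using ab by (intro nth_equalityI) (auto simp: nth_list_update transpose_def simp del: upt_Suc)
      thus ?thesis
        using alternating_form_swap[OF \<beta>, of ?xs "a - 1" "b - 1"] ab by (simp del: upt_Suc)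
    qed
    have "\<beta> (map (\<lambda>i. us (p (Transposition.transpose a b i))) [1..<Suc q]) =
        - \<beta> (map (\<lambda>i. us (p i)) [1..<Suc q])"
      using *[of a b] *[of b a] swap.hyps(1-3)
      by (cases a b rule: linorder_cases) (auto simp: transpose_commute simp del: upt_Suc)
    moreover have "sign (p \<circ> Transposition.transpose a b) = - sign p"
      using swap.hyps by (subst sign_compose)
        (auto simp: sign_swap_id permutation_swap_id intro: permutes_imp_permutation[OF _ swap.hyps(4)])
    ultimately show ?case using swap.IH by (simp del: upt_Suc add: o_def)
  qed
qed

text \<open>Every permutation is uniquely a transposition of 0 and \<open>b\<close> after a
  permutation fixing 0; the latter ones cancel the factorial. Because a transposition is used
  instead of a cycle, every term with \<open>b\<close> nonzero has sign -1 and the argument of index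
  0 takes the place of \<open>b\<close>.\<close>

lemma wedge_1:
  assumes \<beta>: "alternating_form q \<beta>"
  shows "wedge 1 q \<alpha> \<beta> vs = (\<Sum>b<Suc q. (if b = 0 then 1 else - 1) * \<alpha> [vs ! b] *
    \<beta> (map (\<lambda>i. vs ! Transposition.transpose 0 b i) [1..<Suc q]))"
proof -
  let ?S = "{1..<Suc q}"
  have S: "{..<1 + q} = insert 0 ?S" by auto
  have summand: "of_int (sign (Transposition.transpose 0 b \<circ> \<sigma>)) *
      \<alpha> (map (\<lambda>i. vs ! (Transposition.transpose 0 b \<circ> \<sigma>) i) [0..<1]) *
      \<beta> (map (\<lambda>i. vs ! (Transposition.transpose 0 b \<circ> \<sigma>) i) [1..<1 + q]) =
    (if b = 0 then 1 else - 1) * \<alpha> [vs ! b] *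
      \<beta> (map (\<lambda>i. vs ! Transposition.transpose 0 b i) [1..<Suc q])"
    if \<sigma>: "\<sigma> permutes ?S" for b \<sigma>
  proof -
    have "\<sigma> 0 = 0" using \<sigma> by (simp add: permutes_not_in)
    have sgn: "sign (Transposition.transpose 0 b \<circ> \<sigma>) = (if b = 0 then 1 else - 1) * sign \<sigma>"
      using \<sigma> by (subst sign_compose)
        (auto simp: sign_swap_id permutation_swap_id intro: permutes_imp_permutation[of ?S])
    have sq: "real_of_int (sign \<sigma>) * (real_of_int (sign \<sigma>) * x) = x" for x
      by (simp flip: of_int_mult mult.assoc)
    have hd: "map (\<lambda>i. vs ! Transposition.transpose 0 b (\<sigma> i)) [0..<1] = [vs ! b]"
      using \<open>\<sigma> 0 = 0\<close> by (simp add: upt_rec)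
    note tl = alternating_form_permute_tail[OF \<beta> \<sigma>, of "\<lambda>i. vs ! Transposition.transpose 0 b i"]
    show ?thesis
      unfolding hd sgn plus_1_eq_Suc comp_apply tl by (simp add: mult_ac sq del: upt_Suc)
  qed
  have "wedge 1 q \<alpha> \<beta> vs = (\<Sum>b\<in>insert 0 ?S. \<Sum>\<sigma> | \<sigma> permutes ?S.
      of_int (sign (Transposition.transpose 0 b \<circ> \<sigma>)) *
      \<alpha> (map (\<lambda>i. vs ! (Transposition.transpose 0 b \<circ> \<sigma>) i) [0..<1]) *
      \<beta> (map (\<lambda>i. vs ! (Transposition.transpose 0 b \<circ> \<sigma>) i) [1..<1 + q])) / fact q"
    unfolding wedge_def S by (subst sum_over_permutations_insert) (simp_all del: upt_Suc)
  also have "\<dots> = (\<Sum>b\<in>insert 0 ?S. fact q * ((if b = 0 then 1 else - 1) * \<alpha> [vs ! b] *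
      \<beta> (map (\<lambda>i. vs ! Transposition.transpose 0 b i) [1..<Suc q]))) / fact q"
    using summand by (simp add: card_permutations del: upt_Suc)
  also have "\<dots> = (\<Sum>b\<in>insert 0 ?S. (if b = 0 then 1 else - 1) * \<alpha> [vs ! b] *
      \<beta> (map (\<lambda>i. vs ! Transposition.transpose 0 b i) [1..<Suc q]))"
    by (simp only: sum_distrib_left[symmetric]) simp
  finally show ?thesis using S by simp
qed

lemma wedge_1_4:
  assumes "alternating_form 4 \<beta>"
  shows "wedge 1 4 \<alpha> \<beta> [a, b, c, d, e] = \<alpha> [a] * \<beta> [b, c, d, e] - \<alpha> [b] * \<beta> [a, c, d, e] -
    \<alpha> [c] * \<beta> [b, a, d, e] - \<alpha> [d] * \<beta> [b, c, a, e] - \<alpha> [e] * \<beta> [b, c, d, a]"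
  unfolding wedge_1[OF assms]
  by (simp add: numeral_eq_Suc transpose_def upt_rec)

section \<open>Orthonormal bases and basis-independent traces\<close>

lemma orthonormal_basis_expansion:
  assumes h: "multilinear_tensor 2 h" and F: "orthonormal_basis h F"
  shows "v = (\<Sum>i\<in>UNIV. h [F i, v] *\<^sub>R F i)"
proof -
  note lin = multilinear_tensor_2[OF h]
  have hF: "h [F i, F j] = (if i = j then 1 else 0)" for i j
    using F by (simp add: orthonormal_basis_def)
  have coeff: "h [F j, \<Sum>i\<in>UNIV. c i *\<^sub>R F i] = c j" for c j
    by (simp add: linear_sum[OF lin(2)] linear_cmul[OF lin(2)] hF if_distrib cong: if_cong)
  have inj: "inj F"
    using F by (auto simp: inj_on_def orthonormal_basis_def) (metis zero_neq_one)
  have "independent (range F)"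
  proof (rule independent_if_scalars_zero)
    fix f x assume 0: "(\<Sum>x\<in>range F. f x *\<^sub>R x) = 0" and "x \<in> range F"
    then obtain j where j: "x = F j" by auto
    have "(\<Sum>i\<in>UNIV. f (F i) *\<^sub>R F i) = 0" using 0 inj by (simp add: sum.reindex)
    thus "f x = 0" using coeff[of j "f \<circ> F"] linear_0[OF lin(2)] j by simp
  qed simp
  moreover have "card (range F) = DIM(vec8)" using inj by (simp add: card_image)
  ultimately have span: "span (range F) = UNIV"
    by (metis dim_eq_full dim_eq_card_independent)
  have "v \<in> span (range F)" by (simp add: span)
  then obtain f where "v = (\<Sum>x\<in>range F. f x *\<^sub>R x)"
    using span_finite[of "range F"] by auto
  hence v: "v = (\<Sum>i\<in>UNIV. f (F i) *\<^sub>R F i)" using inj by (simp add: sum.reindex)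
  have "h [F j, v] = f (F j)" for j using coeff[of j "f \<circ> F"] v by simp
  thus ?thesis using v by simp
qed

lemma orthonormal_basis_parseval:
  assumes h: "multilinear_tensor 2 h" and F: "orthonormal_basis h F"
  shows "h [u, v] = (\<Sum>i\<in>UNIV. h [u, F i] * h [F i, v])"
proof -
  note lin = multilinear_tensor_2[OF h]
  have "h [u, v] = h [u, \<Sum>i\<in>UNIV. h [F i, v] *\<^sub>R F i]"
    using orthonormal_basis_expansion[OF assms, of v] by simp
  thus ?thesis by (simp add: linear_sum[OF lin(2)] linear_cmul[OF lin(2)] mult.commute)
qed

text \<open>Expand \<open>F\<close> in \<open>G\<close> and sum over \<open>F\<close> by Parseval.
  This is the bridge between bases picked by \<open>SOME\<close> and the frame.\<close>

lemma orthonormal_basis_trace: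
  fixes B :: "vec8 \<Rightarrow> vec8 \<Rightarrow> real"
  assumes h: "multilinear_tensor 2 h" and sym: "\<And>u v. h [u, v] = h [v, u]"
    and F: "orthonormal_basis h F" and G: "orthonormal_basis h G" and B: "bilinear B"
  shows "(\<Sum>i\<in>UNIV. B (F i) (F i)) = (\<Sum>i\<in>UNIV. B (G i) (G i))"
proof -
  have "B (F i) (F i) = (\<Sum>j\<in>UNIV. \<Sum>k\<in>UNIV. h [G j, F i] * h [F i, G k] * B (G j) (G k))" for i
  proof -
    have e: "F i = (\<Sum>j\<in>UNIV. h [G j, F i] *\<^sub>R G j)"
      by (rule orthonormal_basis_expansion[OF h G])
    have "B (F i) (F i) = B (\<Sum>j\<in>UNIV. h [G j, F i] *\<^sub>R G j) (\<Sum>k\<in>UNIV. h [F i, G k] *\<^sub>R G k)"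
      by (rule arg_cong2[where f = B, OF e]) (simp only: sym[of "F i"] e[symmetric])
    also have "\<dots> = (\<Sum>j\<in>UNIV. \<Sum>k\<in>UNIV. h [G j, F i] * h [F i, G k] * B (G j) (G k))"
      by (simp add: bilinear_sum[OF B] sum.cartesian_product bilinear_lmul[OF B] bilinear_rmul[OF B]
          case_prod_unfold mult_ac)
    finally show ?thesis .
  qed
  hence "(\<Sum>i\<in>UNIV. B (F i) (F i)) =
      (\<Sum>i\<in>UNIV. \<Sum>j\<in>UNIV. \<Sum>k\<in>UNIV. h [G j, F i] * h [F i, G k] * B (G j) (G k))"
    by simp
  also have "\<dots> = (\<Sum>j\<in>UNIV. \<Sum>i\<in>UNIV. \<Sum>k\<in>UNIV. h [G j, F i] * h [F i, G k] * B (G j) (G k))"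
    by (rule sum.swap)
  also have "\<dots> = (\<Sum>j\<in>UNIV. \<Sum>k\<in>UNIV. \<Sum>i\<in>UNIV. h [G j, F i] * h [F i, G k] * B (G j) (G k))"
    by (intro sum.cong refl sum.swap)
  also have "\<dots> = (\<Sum>j\<in>UNIV. \<Sum>k\<in>UNIV. h [G j, G k] * B (G j) (G k))"
    by (simp add: orthonormal_basis_parseval[OF h F, of "G _" "G _"] sum_distrib_right)
  also have "\<dots> = (\<Sum>j\<in>UNIV. \<Sum>k\<in>UNIV. if j = k then B (G j) (G k) else 0)"
    using G by (intro sum.cong refl) (simp add: orthonormal_basis_def)
  also have "\<dots> = (\<Sum>j\<in>UNIV. B (G j) (G j))" by simp
  finally show ?thesis .
qed

lemma multilinear_tensor_eq_0:
  assumes T: "multilinear_tensor k T" and F: "\<And>v. \<exists>c. v = (\<Sum>i\<in>UNIV. c i *\<^sub>R F i)"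
    and 0: "\<And>I. length I = k \<Longrightarrow> T (map F I) = 0" and "length vs = k"
  shows "T (vs :: vec8 list) = 0"
proof -
  \<comment> \<open>Arguments are expanded from the left; \<open>I\<close> records those already
    replaced by members of \<open>F\<close>.\<close>
  have "T (map F I @ vs) = 0" if "length I + length vs = k" for I vs
    using that
  proof (induction vs arbitrary: I)
    case Nil
    thus ?case using 0 by simp
  next
    case (Cons v vs)
    obtain c where v: "v = (\<Sum>i\<in>UNIV. c i *\<^sub>R F i)" using F by blast
    have lin: "linear (\<lambda>v. T (map F I @ v # vs))"
      using Cons.prems by (intro multilinear_tensor_append[OF T]) simp
    have "T (map F I @ v # vs) = (\<Sum>i\<in>UNIV. c i * T (map F (I @ [i]) @ vs))"
      unfolding v by (simp add: linear_sum[OF lin] linear_cmul[OF lin])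
    thus ?case using Cons.IH[of "I @ [_]"] Cons.prems by simp
  qed
  from this[of "[]" vs] show ?thesis using assms(4) by simp
qed

section \<open>Differentiating multilinear expressions with moving arguments\<close>

lemma linear_sum_Basis:
  fixes L :: "'a::euclidean_space \<Rightarrow> real"
  assumes "linear L"
  shows "L v = (\<Sum>b\<in>Basis. (v \<bullet> b) * L b)"
proof -
  have "L v = L (\<Sum>b\<in>Basis. (v \<bullet> b) *\<^sub>R b)" by (simp add: euclidean_representation)
  thus ?thesis by (simp add: linear_sum[OF assms] linear_cmul[OF assms])
qed

lemma linear_frechet_derivative_param:
  fixes f :: "'v::euclidean_space \<Rightarrow> 'c::real_normed_vector \<Rightarrow> real"
  assumes "open N" "x \<in> N" and lin: "\<And>y. y \<in> N \<Longrightarrow> linear (\<lambda>v. f v y)"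
    and diff: "\<And>v. f v differentiable (at x)"
  shows "linear (\<lambda>v. frechet_derivative (f v) (at x) u)"
proof -
  have D: "(f v has_derivative frechet_derivative (f v) (at x)) (at x)" for v
    using diff frechet_derivative_works by blast
  show ?thesis
  proof (rule linearI)
    fix v w
    have "((\<lambda>y. f v y + f w y) has_derivative
        (\<lambda>u. frechet_derivative (f v) (at x) u + frechet_derivative (f w) (at x) u)) (at x)"
      by (intro has_derivative_add D)
    hence "(f (v + w) has_derivative
        (\<lambda>u. frechet_derivative (f v) (at x) u + frechet_derivative (f w) (at x) u)) (at x)"
      by (rule has_derivative_transform_within_open[OF _ assms(1,2)]) (simp add: linear_add[OF lin])
    from has_derivative_unique[OF this D]
    show "frechet_derivative (f (v + w)) (at x) u =
        frechet_derivative (f v) (at x) u + frechet_derivative (f w) (at x) u" by metis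
  next
    fix c :: real and v
    have "((\<lambda>y. c *\<^sub>R f v y) has_derivative (\<lambda>u. c *\<^sub>R frechet_derivative (f v) (at x) u)) (at x)"
      by (intro has_derivative_scaleR_right D)
    hence "(f (c *\<^sub>R v) has_derivative (\<lambda>u. c *\<^sub>R frechet_derivative (f v) (at x) u)) (at x)"
      by (rule has_derivative_transform_within_open[OF _ assms(1,2)]) (simp add: linear_cmul[OF lin])
    from has_derivative_unique[OF this D]
    show "frechet_derivative (f (c *\<^sub>R v)) (at x) u = c *\<^sub>R frechet_derivative (f v) (at x) u" by metis
  qed
qed

text \<open>The product rule. In the induction the last moving argument is expanded in the standard
  basis, whose vectors are constant: they join the fixed arguments \<open>ws\<close>, and only the
  scalar coefficients remain to be differentiated.\<close>

lemma multilinear_tensor_has_derivative: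
  fixes T :: "vec8 \<Rightarrow> tensor" and E :: "vec8 \<Rightarrow> nat \<Rightarrow> vec8"
  assumes N: "open N" "x \<in> N" and T: "\<And>y. y \<in> N \<Longrightarrow> multilinear_tensor k (T y)"
    and T': "\<And>vs. length vs = k \<Longrightarrow> (\<lambda>y. T y vs) differentiable (at x)"
    and E': "\<And>i. i < k \<Longrightarrow> (\<lambda>y. E y i) differentiable (at x)"
  shows "((\<lambda>y. T y (map (E y) [0..<k])) has_derivative
    (\<lambda>u. frechet_derivative (\<lambda>y. T y (map (E x) [0..<k])) (at x) u +
      (\<Sum>i<k. T x ((map (E x) [0..<k])[i := frechet_derivative (\<lambda>y. E y i) (at x) u])))) (at x)"
proof -
  let ?E' = "\<lambda>i. frechet_derivative (\<lambda>y. E y i) (at x)"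
  have "((\<lambda>y. T y (map (E y) [0..<m] @ ws)) has_derivative
    (\<lambda>u. frechet_derivative (\<lambda>y. T y (map (E x) [0..<m] @ ws)) (at x) u +
      (\<Sum>i<m. T x ((map (E x) [0..<m] @ ws)[i := ?E' i u])))) (at x)"
    if "m + length ws = k" for m ws
    using that
  proof (induction m arbitrary: ws)
    case 0
    thus ?case using T'[of ws] frechet_derivative_works by auto
  next
    case (Suc m)
    let ?pre = "map (E x) [0..<m]"
    have Em: "((\<lambda>y. E y m) has_derivative ?E' m) (at x)"
      using E'[of m] Suc.prems frechet_derivative_works by auto
    have lin: "linear (\<lambda>v. T y (map (E z) [0..<m] @ v # ws))" if "y \<in> N" for y z
      using Suc.prems by (intro multilinear_tensor_append[OF T[OF that]]) simp
    have lin_upd: "linear (\<lambda>v. T x ((?pre @ v # ws)[i := w]))" if "i < m" for i w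
    proof -
      have "linear (\<lambda>v. T x (?pre[i := w] @ v # ws))"
        using Suc.prems by (intro multilinear_tensor_append[OF T[OF N(2)]]) simp
      thus ?thesis using that by (simp add: list_update_append)
    qed
    have lin_der: "linear (\<lambda>v. frechet_derivative (\<lambda>y. T y (?pre @ v # ws)) (at x) u)" for u
      by (rule linear_frechet_derivative_param[OF N]) (use lin T' Suc.prems in auto)
    let ?d = "\<lambda>b u. frechet_derivative (\<lambda>y. T y (?pre @ b # ws)) (at x) u +
        (\<Sum>i<m. T x ((?pre @ b # ws)[i := ?E' i u]))"
    have "((\<lambda>y. \<Sum>b\<in>Basis. (E y m \<bullet> b) * T y (map (E y) [0..<m] @ b # ws)) has_derivative
      (\<lambda>u. \<Sum>b\<in>Basis. (E x m \<bullet> b) * ?d b u + (?E' m u \<bullet> b) * T x (?pre @ b # ws))) (at x)"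
      by (intro has_derivative_sum has_derivative_mult has_derivative_inner_left Em Suc.IH)
        (use Suc.prems in auto)
    moreover have "(\<Sum>b\<in>Basis. (E y m \<bullet> b) * T y (map (E y) [0..<m] @ b # ws)) =
        T y (map (E y) [0..<Suc m] @ ws)" if "y \<in> N" for y
      using linear_sum_Basis[OF lin[OF that], of y "E y m"] by simp
    ultimately have "((\<lambda>y. T y (map (E y) [0..<Suc m] @ ws)) has_derivative
      (\<lambda>u. \<Sum>b\<in>Basis. (E x m \<bullet> b) * ?d b u + (?E' m u \<bullet> b) * T x (?pre @ b # ws))) (at x)"
      using N by (elim has_derivative_transform_within_open) auto
    moreover have "(\<Sum>b\<in>Basis. (E x m \<bullet> b) * ?d b u + (?E' m u \<bullet> b) * T x (?pre @ b # ws)) =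
        frechet_derivative (\<lambda>y. T y (map (E x) [0..<Suc m] @ ws)) (at x) u +
        (\<Sum>i<Suc m. T x ((map (E x) [0..<Suc m] @ ws)[i := ?E' i u]))" for u
    proof -
      have "(\<Sum>b\<in>Basis. (E x m \<bullet> b) * frechet_derivative (\<lambda>y. T y (?pre @ b # ws)) (at x) u) =
          frechet_derivative (\<lambda>y. T y (?pre @ E x m # ws)) (at x) u"
        by (rule linear_sum_Basis[OF lin_der, symmetric])
      moreover have "(\<Sum>b\<in>Basis. (E x m \<bullet> b) * (\<Sum>i<m. T x ((?pre @ b # ws)[i := ?E' i u]))) =
          (\<Sum>i<m. T x ((?pre @ E x m # ws)[i := ?E' i u]))"
        unfolding sum_distrib_left
        by (subst sum.swap, intro sum.cong refl linear_sum_Basis[OF lin_upd, symmetric]) simp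
      moreover have "(\<Sum>b\<in>Basis. (?E' m u \<bullet> b) * T x (?pre @ b # ws)) = T x (?pre @ ?E' m u # ws)"
        by (rule linear_sum_Basis[OF lin[OF N(2)], symmetric])
      ultimately show ?thesis
        by (simp add: sum.distrib distrib_left list_update_append)
    qed
    ultimately show ?case by simp
  qed
  from this[of k "[]"] show ?thesis by simp
qed


section \<open>Intrinsic torsion at a point\<close>

lemma alternating_form_2_skew: "alternating_form 2 \<omega> \<Longrightarrow> \<omega> [u, v] = - \<omega> [v, u]"
  using alternating_form_swap[of 2 \<omega> "[v, u]" 0 1] by simp

lemma adapted_basis_coeff:
  assumes "adapted_basis h \<phi> F" "a < 8" "b < 8" "c < 8" "d < 8"
  shows "\<phi> [F (of_nat a), F (of_nat b), F (of_nat c), F (of_nat d)] = of_int (spin7_coeff a b c d)"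
proof -
  have e: "coframe h F i (F j) = (if i = j then 1 else 0)" for i j
    using assms(1) by (simp add: adapted_basis_def orthonormal_basis_def coframe_def)
  show ?thesis
    using standard_spin7_form_coeff[OF e assms(2-5)] assms(1) by (simp add: adapted_basis_def)
qed

lemma adapted_basis_star:
  assumes F: "adapted_basis h \<phi> F" and \<omega>: "alternating_form 2 \<omega>"
    and kl: "k < 8" "l < 8" "k \<noteq> l"
  shows "hodge_star_wrt h F 6 (wedge 4 2 \<phi> \<omega>) [F (of_nat k), F (of_nat l)] =
    pairing7 (\<lambda>i j. \<omega> [F (of_nat i), F (of_nat j)]) (xor k l) * of_int (spin7_sign k l) / 2 -
    \<omega> [F (of_nat k), F (of_nat l)]"
proof -
  let ?w = "\<lambda>i j. \<omega> [F (of_nat i), F (of_nat j)]"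
  have "hodge_star_wrt h F 6 (wedge 4 2 \<phi> \<omega>) [F (of_nat k), F (of_nat l)] =
      (\<Sum>i<8. \<Sum>j<8. ?w i j * of_int (spin7_coeff i j k l)) / 2"
    using F kl by (intro hodge_star_wedge_spin7_form) (auto simp: adapted_basis_def)
  also have "(\<Sum>i<8. \<Sum>j<8. ?w i j * of_int (spin7_coeff i j k l)) =
      pairing7 ?w (xor k l) * of_int (spin7_sign k l) - 2 * ?w k l"
    using kl by (intro spin7_coeff_contract alternating_form_2_skew[OF \<omega>])
  finally show ?thesis by (simp add: diff_divide_distrib)
qed

text \<open>The eigenvalue equation with 3 reads 4 w = \<open>pairing7\<close> times sign / 2, so
  \<open>pairing7 / 8\<close> is the coordinate. The basis must be the one picked in
  \<open>hodge_star\<close>, so that the defining equation applies to it directly.\<close>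

lemma Lambda2_7_coords:
  assumes \<omega>: "\<omega> \<in> Lambda2_7 h \<phi>" and F: "adapted_basis h \<phi> F" "F = (SOME F. adapted_basis h \<phi> F)"
  shows "\<exists>x. \<forall>i<8. \<forall>j<8. \<omega> [F (of_nat i), F (of_nat j)] = x (xor i j) * of_int (spin7_sign i j)"
proof -
  let ?w = "\<lambda>i j. \<omega> [F (of_nat i), F (of_nat j)]"
  have alt: "alternating_form 2 \<omega>" using \<omega> by (simp add: Lambda2_7_def)
  have "?w i j = pairing7 ?w (xor i j) / 8 * of_int (spin7_sign i j)" if ij: "i < 8" "j < 8" for i j
  proof (cases "i = j")
    case True
    thus ?thesis using alternating_form_2_skew[OF alt, of "F (of_nat i)" "F (of_nat i)"]
        spin7_sign_square_real[of i i] ij by simp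
  next
    case False
    have "hodge_star_wrt h F 6 (wedge 4 2 \<phi> \<omega>) [F (of_nat i), F (of_nat j)] = 3 * ?w i j"
      using \<omega> by (simp add: Lambda2_7_def hodge_star_def F(2)[symmetric])
    thus ?thesis using adapted_basis_star[OF F(1) alt ij False] by simp
  qed
  thus ?thesis by (intro exI[of _ "\<lambda>n. pairing7 ?w n / 8"]) auto
qed

text \<open>The eigenvalue -1 cancels the term \<open>- \<omega>\<close> of
  \<open>adapted_basis_star\<close>; the pair (0, n) suffices because its sign is nonzero.\<close>

lemma Lambda2_21_pairing7:
  assumes \<omega>: "\<omega> \<in> Lambda2_21 h \<phi>" and F: "adapted_basis h \<phi> F" "F = (SOME F. adapted_basis h \<phi> F)"
    and n: "0 < n" "n < 8"
  shows "pairing7 (\<lambda>i j. \<omega> [F (of_nat i), F (of_nat j)]) n = 0"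
proof -
  have alt: "alternating_form 2 \<omega>" using \<omega> by (simp add: Lambda2_21_def)
  have "hodge_star_wrt h F 6 (wedge 4 2 \<phi> \<omega>) [F (of_nat 0), F (of_nat n)] =
      - \<omega> [F (of_nat 0), F (of_nat n)]"
    using \<omega> by (simp add: Lambda2_21_def hodge_star_def F(2)[symmetric])
  thus ?thesis
    using adapted_basis_star[OF F(1) alt, of 0 n] n spin7_sign_square_real[of 0 n] by auto
qed

lemma form_act_adapted_basis:
  assumes h: "multilinear_tensor 2 h" and sym: "\<And>u v. h [u, v] = h [v, u]"
    and \<phi>: "multilinear_tensor 4 \<phi>" and F: "adapted_basis h \<phi> F"
    and lt: "a < 8" "b < 8" "c < 8" "d < 8"
  defines "f \<equiv> \<lambda>i. F (of_nat i)"
  shows "\<phi> [B (f a), f b, f c, f d] + \<phi> [f a, B (f b), f c, f d] + \<phi> [f a, f b, B (f c), f d] +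
      \<phi> [f a, f b, f c, B (f d)] = form_act (\<lambda>i j. h [B (f i), f j]) a b c d"
proof -
  have B: "B (f i) = (\<Sum>j<8. h [B (f i), f j] *\<^sub>R f j)" for i
    using orthonormal_basis_expansion[OF h, of F "B (f i)"] F
    by (simp add: adapted_basis_def sum_8_eq f_def sym[of "B _"])
  have lin: "L (B (f i)) = (\<Sum>j<8. h [B (f i), f j] * L (f j))" if "linear L" for L :: "vec8 \<Rightarrow> real" and i
    using arg_cong[OF B[of i], of L] by (simp add: linear_sum[OF that] linear_cmul[OF that])
  note app = multilinear_tensor_append[OF \<phi>]
  have \<phi>F: "\<phi> [f a, f b, f c, f d] = of_int (spin7_coeff a b c d)"
    if "a < 8" "b < 8" "c < 8" "d < 8" for a b c d
    using adapted_basis_coeff[OF F that] by (simp add: f_def)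
  show ?thesis
    using lin[OF app[of "[]" "[f b, f c, f d]", simplified], of a]
      lin[OF app[of "[f a]" "[f c, f d]", simplified], of b]
      lin[OF app[of "[f a, f b]" "[f d]", simplified], of c]
      lin[OF app[of "[f a, f b, f c]" "[]", simplified], of d] lt
    by (simp add: form_act_def \<phi>F)
qed

lemma multilinear_tensor_act:
  assumes T: "multilinear_tensor k T" and B: "linear B"
  shows "multilinear_tensor k (\<lambda>vs. \<Sum>i<k. T (vs[i := B (vs ! i)]))"
  unfolding multilinear_tensor_def
proof (intro allI impI linear_compose_sum[rule_format] ballI)
  fix vs :: "vec8 list" and j i
  assume vs: "length vs = k" "j < k" and "i \<in> {..<k}"
  show "linear (\<lambda>v. T (vs[j := v, i := B (vs[j := v] ! i)]))"
  proof (cases "i = j")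
    case True
    have "linear ((\<lambda>v. T (vs[j := v])) \<circ> B)"
      by (intro linear_compose B multilinear_tensorD[OF T] vs)
    thus ?thesis using True vs by (simp add: o_def)
  next
    case False
    have "linear (\<lambda>v. T (vs[i := B (vs ! i), j := v]))"
      by (intro multilinear_tensorD[OF T]) (use vs in auto)
    thus ?thesis using False by (simp add: list_update_swap)
  qed
qed

text \<open>Proved in the basis picked by \<open>hodge_star\<close>, but stated for arbitrary
  vectors, so that it can be applied in the frame \<open>E\<close>.\<close>

lemma Lambda2_21_annihilates:
  assumes h: "multilinear_tensor 2 h" and sym: "\<And>u v. h [u, v] = h [v, u]"
    and \<phi>: "multilinear_tensor 4 \<phi>" and ex: "\<exists>F. adapted_basis h \<phi> F"
    and B: "linear B" "(\<lambda>vs. h [B (vs ! 0), vs ! 1]) \<in> Lambda2_21 h \<phi>"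
    and len: "length vs = 4"
  shows "(\<Sum>i<4. \<phi> (vs[i := B (vs ! i)])) = 0"
proof -
  define F where "F = (SOME F. adapted_basis h \<phi> F)"
  have F: "adapted_basis h \<phi> F" unfolding F_def using ex by (rule someI_ex)
  hence onb: "orthonormal_basis h F" by (simp add: adapted_basis_def)
  have alt: "alternating_form 2 (\<lambda>vs. h [B (vs ! 0), vs ! 1])"
    using B(2) by (simp add: Lambda2_21_def)
  show ?thesis
  proof (rule multilinear_tensor_eq_0[OF multilinear_tensor_act[OF \<phi> B(1)] _ _ len])
    show "\<exists>c. v = (\<Sum>i\<in>UNIV. c i *\<^sub>R F i)" for v
      using orthonormal_basis_expansion[OF h onb, of v] by (rule exI[of _ "\<lambda>i. h [F i, v]"])
  next
    fix I :: "8 list" assume "length I = 4"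
    then obtain a b c d where abcd: "a < 8" "b < 8" "c < 8" "d < 8" and I: "I = map of_nat [a, b, c, d]"
      by (rule list_8_of_nat)
    have "form_act (\<lambda>i j. h [B (F (of_nat i)), F (of_nat j)]) a b c d = 0"
    proof (rule spin7_coeff_annihilate)
      show "h [B (F (of_nat i)), F (of_nat j)] = - h [B (F (of_nat j)), F (of_nat i)]" for i j
        using alternating_form_2_skew[OF alt, of "F (of_nat i)" "F (of_nat j)"] by simp
      show "pairing7 (\<lambda>i j. h [B (F (of_nat i)), F (of_nat j)]) n = 0" if "0 < n" "n < 8" for n
        using Lambda2_21_pairing7[OF B(2) F F_def that] by simp
    qed (use abcd in auto)
    thus "(\<Sum>m<4. \<phi> ((map F I)[m := B (map F I ! m)])) = 0"
      using form_act_adapted_basis[OF h sym \<phi> F abcd, of B]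
      by (simp add: I eval_nat_numeral add_ac)
  qed
qed

lemma bilinear_sum_8:
  fixes H :: "vec8 \<Rightarrow> vec8 \<Rightarrow> real"
  assumes "bilinear H" and F: "\<And>v. v = (\<Sum>i<8. c v i *\<^sub>R f i)"
  shows "H u v = (\<Sum>i<8. \<Sum>j<8. c u i * c v j * H (f i) (f j))"
proof -
  have "H u v = H (\<Sum>i<8. c u i *\<^sub>R f i) (\<Sum>j<8. c v j *\<^sub>R f j)" using F by metis
  thus ?thesis
    by (simp add: bilinear_sum[OF assms(1)] sum.cartesian_product bilinear_lmul[OF assms(1)]
        bilinear_rmul[OF assms(1)] case_prod_unfold mult_ac)
qed

text \<open>The pointwise content of the theorem, exported for any orthonormal basis
  \<open>G\<close>. The minus sign in the assumption on \<open>Lambda2_7\<close> arises because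
  \<open>is_spin7_component\<close> constrains Levi-Civita minus minimal connection, which is
  -\<xi>.\<close>

lemma spin7_torsion_at_point:
  fixes \<xi> :: "vec8 \<Rightarrow> vec8 \<Rightarrow> vec8"
  assumes h: "multilinear_tensor 2 h" and sym: "\<And>u v. h [u, v] = h [v, u]"
    and \<phi>: "alternating_form 4 \<phi>" and ex: "\<exists>F. adapted_basis h \<phi> F"
    and \<xi>: "bilinear \<xi>" and \<theta>: "linear (\<lambda>v. \<theta> [v])"
    and \<xi>7: "\<And>u. (\<lambda>vs. - h [\<xi> u (vs ! 0), vs ! 1]) \<in> Lambda2_7 h \<phi>"
    and eq: "\<And>a b c d e.
      (\<phi> [\<xi> a b, c, d, e] + \<phi> [b, \<xi> a c, d, e] + \<phi> [b, c, \<xi> a d, e] + \<phi> [b, c, d, \<xi> a e]) -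
      (\<phi> [\<xi> b a, c, d, e] + \<phi> [a, \<xi> b c, d, e] + \<phi> [a, c, \<xi> b d, e] + \<phi> [a, c, d, \<xi> b e]) +
      (\<phi> [\<xi> c a, b, d, e] + \<phi> [a, \<xi> c b, d, e] + \<phi> [a, b, \<xi> c d, e] + \<phi> [a, b, d, \<xi> c e]) -
      (\<phi> [\<xi> d a, b, c, e] + \<phi> [a, \<xi> d b, c, e] + \<phi> [a, b, \<xi> d c, e] + \<phi> [a, b, c, \<xi> d e]) +
      (\<phi> [\<xi> e a, b, c, d] + \<phi> [a, \<xi> e b, c, d] + \<phi> [a, b, \<xi> e c, d] + \<phi> [a, b, c, \<xi> e d]) =
      wedge 1 4 \<theta> \<phi> [a, b, c, d, e]"
    and G: "orthonormal_basis h G"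
  shows "\<theta> [v] = 16 / 7 * (\<Sum>i\<in>UNIV. h [\<xi> (G i) (G i), v])"
    and "(\<Sum>i\<in>UNIV. h [\<xi> u (G i), \<xi> v (G i)]) =
      ((\<Sum>i\<in>UNIV. (\<theta> [G i])\<^sup>2) * h [u, v] - \<theta> [u] * \<theta> [v]) / 32"
proof -
  define F where "F = (SOME F. adapted_basis h \<phi> F)"
  have F: "adapted_basis h \<phi> F" unfolding F_def using ex by (rule someI_ex)
  hence onb: "orthonormal_basis h F" by (simp add: adapted_basis_def)
  define f where "f i = F (of_nat i)" for i :: nat
  have \<phi>ml: "multilinear_tensor 4 \<phi>" using \<phi> by (simp add: alternating_form_def)
  note hl = multilinear_tensor_2[OF h]
  have ff: "h [f i, f j] = (if i = j then 1 else 0)" if "i < 8" "j < 8" for i j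
    using onb that by (simp add: f_def orthonormal_basis_def of_nat_8_eq_iff)
  have exp: "v = (\<Sum>i<8. h [f i, v] *\<^sub>R f i)" for v
    using orthonormal_basis_expansion[OF h onb, of v] by (simp add: sum_8_eq f_def)
  define w where "w k i j = h [\<xi> (f k) (f i), f j]" for k i j
  have "\<forall>u. \<exists>x. \<forall>i<8. \<forall>j<8. - h [\<xi> u (f i), f j] = x (xor i j) * of_int (spin7_sign i j)"
    using Lambda2_7_coords[OF \<xi>7 F F_def] by (simp add: f_def)
  then obtain x where x: "\<And>u i j. i < 8 \<Longrightarrow> j < 8 \<Longrightarrow>
      - h [\<xi> u (f i), f j] = x u (xor i j) * of_int (spin7_sign i j)" by metis
  define X where "X k n = - x (f k) n" for k n
  have wX: "w k i j = X k (xor i j) * of_int (spin7_sign i j)" if "i < 8" "j < 8" for k i j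
    using x[OF that, of "f k"] by (simp add: w_def X_def)
  have act: "\<phi> [\<xi> (f p) (f a), f b, f c, f d] + \<phi> [f a, \<xi> (f p) (f b), f c, f d] +
      \<phi> [f a, f b, \<xi> (f p) (f c), f d] + \<phi> [f a, f b, f c, \<xi> (f p) (f d)] = form_act (w p) a b c d"
    if "a < 8" "b < 8" "c < 8" "d < 8" for p a b c d
  proof -
    have "w p = (\<lambda>i j. h [\<xi> (f p) (f i), f j])" by (simp add: w_def fun_eq_iff)
    thus ?thesis
      using form_act_adapted_basis[OF h sym \<phi>ml F that, of "\<xi> (f p)"] by (simp add: f_def)
  qed
  have \<phi>F: "\<phi> [f a, f b, f c, f d] = of_int (spin7_coeff a b c d)"
    if "a < 8" "b < 8" "c < 8" "d < 8" for a b c d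
    using adapted_basis_coeff[OF F that] by (simp add: f_def)
  have W: "w k i j = \<theta> [f (xor k (xor i j))] * of_int (spin7_sign k (xor k (xor i j))) *
      of_int (spin7_sign i j) / 16" if "k < 8" "i < 8" "j < 8" for k i j
  proof (rule spin7_torsion_solve[where x = X])
    fix a b c d e :: nat assume lt: "a < 8" "b < 8" "c < 8" "d < 8" "e < 8"
    show "form_act (w a) b c d e - form_act (w b) a c d e + form_act (w c) a b d e -
      form_act (w d) a b c e + form_act (w e) a b c d =
      \<theta> [f a] * of_int (spin7_coeff b c d e) - \<theta> [f b] * of_int (spin7_coeff a c d e) -
      \<theta> [f c] * of_int (spin7_coeff b a d e) - \<theta> [f d] * of_int (spin7_coeff b c a e) -
      \<theta> [f e] * of_int (spin7_coeff b c d a)"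
      using eq[of "f a" "f b" "f c" "f d" "f e"] lt
      unfolding wedge_1_4[OF \<phi>] act[OF lt(2-5)] act[OF lt(1,3-5)] act[OF lt(1,2,4,5)]
        act[OF lt(1-3,5)] act[OF lt(1-4)]
      by (simp add: \<phi>F)
  qed (use wX that in auto)
  have \<xi>r: "linear (\<xi> u)" for u using \<xi> by (simp add: bilinear_def)
  have B1: "bilinear (\<lambda>a b. h [\<xi> a b, v])" for v
    using \<xi> linear_compose[OF _ hl(1)] unfolding bilinear_def o_def by auto
  have B2: "bilinear (\<lambda>a b. h [\<xi> u a, \<xi> v b])" for u v
    unfolding bilinear_def
    using linear_compose[OF \<xi>r hl(1), unfolded o_def] linear_compose[OF \<xi>r hl(2), unfolded o_def]
    by blast
  have B3: "bilinear (\<lambda>a b. \<theta> [a] * \<theta> [b])"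
    using \<theta> unfolding bilinear_def by (auto intro!: linearI simp: linear_add linear_cmul algebra_simps
        linear_add[OF \<theta>] linear_cmul[OF \<theta>])
  have tr: "(\<Sum>i<8. h [\<xi> (f i) (f i), v]) = 7 / 16 * \<theta> [v]" for v
  proof -
    have "(\<Sum>i<8. h [\<xi> (f i) (f i), v]) = (\<Sum>i<8. \<Sum>j<8. h [f j, v] * w i i j)"
      unfolding w_def by (subst (1) exp[of v])
        (simp add: linear_sum[OF hl(2)] linear_cmul[OF hl(2)])
    also have "\<dots> = (\<Sum>j<8. h [f j, v] * (\<Sum>i<8. w i i j))"
      by (subst sum.swap) (simp add: sum_distrib_left)
    also have "\<dots> = (\<Sum>j<8. 7 / 16 * (h [f j, v] * \<theta> [f j]))"
    proof (intro sum.cong refl)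
      fix j :: nat assume "j \<in> {..<8}"
      thus "h [f j, v] * (\<Sum>i<8. w i i j) = 7 / 16 * (h [f j, v] * \<theta> [f j])"
        using spin7_torsion_trace[where \<theta> = "\<lambda>j. \<theta> [f j]" and w = w, OF W, of j] by simp
    qed
    also have "\<dots> = 7 / 16 * (\<Sum>j<8. h [f j, v] * \<theta> [f j])" by (simp add: sum_distrib_left)
    also have "(\<Sum>j<8. h [f j, v] * \<theta> [f j]) = \<theta> [\<Sum>j<8. h [f j, v] *\<^sub>R f j]"
      by (simp add: linear_sum[OF \<theta>] linear_cmul[OF \<theta>])
    also have "\<dots> = \<theta> [v]" by (simp only: exp[of v, symmetric])
    finally show ?thesis .
  qed
  show "\<theta> [v] = 16 / 7 * (\<Sum>i\<in>UNIV. h [\<xi> (G i) (G i), v])"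
    using tr[of v] orthonormal_basis_trace[OF h sym G onb B1, of v] by (simp add: sum_8_eq f_def)
  let ?N = "\<Sum>n<8. (\<theta> [f n])\<^sup>2"
  have gram: "(\<Sum>i<8. h [\<xi> (f a) (f i), \<xi> (f b) (f i)]) = (?N * h [f a, f b] - \<theta> [f a] * \<theta> [f b]) / 32"
    if ab: "a < 8" "b < 8" for a b
  proof -
    have "h [\<xi> (f a) (f i), \<xi> (f b) (f i)] = (\<Sum>j<8. w a i j * w b i j)" for i
      using orthonormal_basis_parseval[OF h onb, of "\<xi> (f a) (f i)" "\<xi> (f b) (f i)"]
      by (simp add: sum_8_eq w_def f_def sym[of "F _" "\<xi> _ _"])
    hence "(\<Sum>i<8. h [\<xi> (f a) (f i), \<xi> (f b) (f i)]) = (\<Sum>i<8. \<Sum>j<8. w a i j * w b i j)"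
      by simp
    also have "\<dots> = ((if a = b then ?N else 0) - \<theta> [f a] * \<theta> [f b]) / 32"
      by (rule spin7_torsion_gram[where \<theta> = "\<lambda>j. \<theta> [f j]", OF W ab])
    finally show ?thesis using ff[OF ab] by simp
  qed
  let ?H = "\<lambda>u v. \<Sum>i<8. h [\<xi> u (f i), \<xi> v (f i)]"
  let ?K = "\<lambda>u v. (?N * h [u, v] - \<theta> [u] * \<theta> [v]) / 32"
  have \<xi>l: "linear (\<lambda>u. \<xi> u v)" for v using \<xi> by (simp add: bilinear_def)
  have H: "bilinear ?H"
    unfolding bilinear_def
    by (auto intro!: linearI simp: linear_add[OF \<xi>l] linear_cmul[OF \<xi>l] linear_add[OF hl(1)]
        linear_add[OF hl(2)] linear_cmul[OF hl(1)] linear_cmul[OF hl(2)] sum.distrib sum_distrib_left)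
  have K: "bilinear ?K"
    unfolding bilinear_def
    by (auto intro!: linearI simp: linear_add[OF hl(1)] linear_add[OF hl(2)] linear_cmul[OF hl(1)]
        linear_cmul[OF hl(2)] linear_add[OF \<theta>] linear_cmul[OF \<theta>] algebra_simps add_divide_distrib
        diff_divide_distrib)
  \<comment> \<open>Both sides of the Gram identity are bilinear in \<open>u\<close> and
    \<open>v\<close>, so agreement on the basis \<open>f\<close> is enough.\<close>
  have "?H u v = (\<Sum>i<8. \<Sum>j<8. h [f i, u] * h [f j, v] * ?H (f i) (f j))"
    by (rule bilinear_sum_8[OF H exp])
  also have "\<dots> = (\<Sum>i<8. \<Sum>j<8. h [f i, u] * h [f j, v] * ?K (f i) (f j))"
    using gram by (intro sum.cong refl arg_cong2[where f = "(*)"]) auto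
  also have "\<dots> = ?K u v" by (rule bilinear_sum_8[OF K exp, symmetric])
  finally have HK: "?H u v = ?K u v" .
  have "(\<Sum>i\<in>UNIV. h [\<xi> u (G i), \<xi> v (G i)]) = ?H u v"
    using orthonormal_basis_trace[OF h sym G onb B2, of u v] by (simp add: sum_8_eq f_def)
  moreover have "(\<Sum>i\<in>UNIV. (\<theta> [G i])\<^sup>2) = ?N"
    using orthonormal_basis_trace[OF h sym G onb B3] by (simp add: sum_8_eq f_def power2_eq_square)
  ultimately show "(\<Sum>i\<in>UNIV. h [\<xi> u (G i), \<xi> v (G i)]) =
      ((\<Sum>i\<in>UNIV. (\<theta> [G i])\<^sup>2) * h [u, v] - \<theta> [u] * \<theta> [v]) / 32"
    using HK by simp
qed


section \<open>Derivatives of tensors along frames\<close>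

lemma smooth_on_differentiable:
  assumes "smooth_on S f" "x \<in> S"
  shows "f differentiable (at x)"
proof -
  have "Ck_on (Suc 0) S f" using assms(1) unfolding smooth_on_def by blast
  thus ?thesis using assms(2) by simp
qed

lemma linear_wedge_covectors_last:
  assumes "length us + 1 = length I" and e: "\<And>i. linear (e i)"
  shows "linear (\<lambda>v. wedge_covectors e I (us @ [v]))"
  unfolding wedge_covectors_def
proof (rule linear_compose_sum[rule_format])
  fix \<sigma> assume "\<sigma> \<in> {\<sigma>. \<sigma> permutes {..<length I}}"
  hence \<sigma>: "\<sigma> permutes {..<length I}" by simp
  let ?n = "length us"
  obtain b where b: "\<sigma> b = ?n" using permutes_surj[OF \<sigma>] by (metis surjD)
  have bn: "b < length I" using permutes_in_image[OF \<sigma>, of b] b assms(1) by simp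
  have other: "(us @ [v]) ! \<sigma> a = us ! \<sigma> a" if "a < length I" "a \<noteq> b" for a v
  proof -
    have "\<sigma> a < length I" using permutes_in_image[OF \<sigma>, of a] that by simp
    moreover have "\<sigma> a \<noteq> ?n" using that b permutes_inj[OF \<sigma>] by (metis injD)
    ultimately show ?thesis using assms(1) by (simp add: nth_append)
  qed
  have "(\<Prod>a<length I. e (I ! a) ((us @ [v]) ! \<sigma> a)) =
      e (I ! b) v * (\<Prod>a\<in>{..<length I} - {b}. e (I ! a) (us ! \<sigma> a))" for v
    using bn b other by (subst prod.remove[of _ b]) (auto intro!: prod.cong)
  moreover have "linear (\<lambda>v. of_int (sign \<sigma>) * (e (I ! b) v * K))" for K :: real
    by (rule linearI) (simp_all add: linear_add[OF e] linear_cmul[OF e] algebra_simps)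
  ultimately show "linear (\<lambda>v. of_int (sign \<sigma>) * (\<Prod>a<length I. e (I ! a) ((us @ [v]) ! \<sigma> a)))"
    by simp
qed

text \<open>The vector \<open>v\<close> enters only through the last slot of the volume form,
  whatever \<alpha> and the picked basis are.\<close>

lemma linear_hodge_star_7:
  assumes h: "multilinear_tensor 2 h"
  shows "linear (\<lambda>v. hodge_star h \<phi> 7 \<alpha> [v])"
proof -
  have lin: "linear (\<lambda>v. wedge_covectors (coframe h F) [0,1,2,3,4,5,6,7] (map F I @ [v]))"
    if "length I = 7" for F :: basis8 and I
    using that multilinear_tensor_2(2)[OF h]
    by (intro linear_wedge_covectors_last) (auto simp: coframe_def[abs_def])
  have "linear (\<lambda>v. \<Sum>I | length I = 7. \<alpha> (map F I) *
      wedge_covectors (coframe h F) [0,1,2,3,4,5,6,7] (map F I @ [v]))" for F :: basis8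
  proof (rule linear_compose_sum[rule_format])
    fix I :: "8 list" assume "I \<in> {I. length I = 7}"
    thus "linear (\<lambda>v. \<alpha> (map F I) *
        wedge_covectors (coframe h F) [0,1,2,3,4,5,6,7] (map F I @ [v]))"
      using linear_compose_scale_right[OF lin[where I = I and F = F], where c = "\<alpha> (map F I)"] by simp
  qed
  hence "linear (\<lambda>v. (1 / fact 7) *\<^sub>R (\<Sum>I | length I = 7. \<alpha> (map F I) *
      wedge_covectors (coframe h F) [0,1,2,3,4,5,6,7] (map F I @ [v])))" for F :: basis8
    by (rule linear_compose_scale_right)
  thus ?thesis by (simp add: hodge_star_def hodge_star_wrt_def)
qed

lemma multilinear_tensor_cov_deriv:
  assumes N: "open N" "x \<in> N" and T: "\<And>y. y \<in> N \<Longrightarrow> multilinear_tensor k (T y)"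
    and T': "\<And>vs. length vs = k \<Longrightarrow> (\<lambda>y. T y vs) differentiable (at x)"
    and C: "linear (C x u)"
  shows "multilinear_tensor k (cov_deriv C k T x u)"
  unfolding multilinear_tensor_def
proof (intro allI impI)
  fix vs :: "vec8 list" and i assume vs: "length vs = k" "i < k"
  have "linear (\<lambda>v. frechet_derivative (\<lambda>y. T y (vs[i := v])) (at x) u)"
    by (rule linear_frechet_derivative_param[OF N]; (intro multilinear_tensorD[OF T] T')?)
      (use vs in auto)
  moreover have "linear (\<lambda>v. \<Sum>j<k. T x (vs[i := v, j := C x u (vs[i := v] ! j)]))"
    by (rule multilinear_tensorD[OF multilinear_tensor_act[OF T[OF N(2)] C] vs])
  ultimately show "linear (\<lambda>v. cov_deriv C k T x u (vs[i := v]))"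
    unfolding cov_deriv_def by (rule linear_compose_sub)
qed

text \<open>The Leibniz rule for a connection: the terms with \<open>C\<close> subtracted in
  \<open>cov_deriv\<close> cancel those added to the derivatives of the frame vectors.\<close>

lemma has_derivative_frame:
  fixes T :: "vec8 \<Rightarrow> tensor" and E :: "vec8 \<Rightarrow> basis8"
  assumes N: "open N" "x \<in> N" and T: "\<And>y. y \<in> N \<Longrightarrow> multilinear_tensor k (T y)"
    and T': "\<And>vs. length vs = k \<Longrightarrow> (\<lambda>y. T y vs) differentiable (at x)"
    and E': "\<And>i. (\<lambda>y. E y i) differentiable (at x)" and I: "length I = k"
  shows "((\<lambda>y. T y (map (E y) I)) has_derivative
    (\<lambda>u. cov_deriv C k T x u (map (E x) I) + (\<Sum>i<k. T x ((map (E x) I)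
      [i := frechet_derivative (\<lambda>y. E y (I ! i)) (at x) u + C x u (E x (I ! i))])))) (at x)"
proof -
  have map: "map (\<lambda>i. E y (I ! i)) [0..<k] = map (E y) I" for y
    using I by (intro nth_equalityI) auto
  have "T x ((map (E x) I)[i := a + b]) = T x ((map (E x) I)[i := a]) + T x ((map (E x) I)[i := b])"
    if "i < k" for i a b
    using I that by (intro linear_add[OF multilinear_tensorD[OF T[OF N(2)]]]) auto
  thus ?thesis
    using multilinear_tensor_has_derivative[OF N T T', of "\<lambda>y i. E y (I ! i)"] E' I
    unfolding map by (simp add: cov_deriv_def sum.distrib)
qed

lemma differentiable_bilinear_family:
  fixes B :: "vec8 \<Rightarrow> vec8 \<Rightarrow> vec8 \<Rightarrow> vec8"
  assumes N: "open N" "x \<in> N" and B: "\<And>y. y \<in> N \<Longrightarrow> bilinear (B y)"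
    and B': "\<And>u v. (\<lambda>y. B y u v) differentiable (at x)"
    and p: "p differentiable (at x)" and q: "q differentiable (at x)"
  shows "(\<lambda>y. B y (p y) (q y)) differentiable (at x)"
proof -
  have "(\<lambda>y. \<Sum>a\<in>Basis. \<Sum>b\<in>Basis. (p y \<bullet> a) *\<^sub>R (q y \<bullet> b) *\<^sub>R B y a b) differentiable (at x)"
    by (intro differentiable_sum ballI differentiable_scaleR differentiable_inner p q B'
        differentiable_const finite_Basis)
  then obtain D where D: "((\<lambda>y. \<Sum>a\<in>Basis. \<Sum>b\<in>Basis. (p y \<bullet> a) *\<^sub>R (q y \<bullet> b) *\<^sub>R B y a b)
      has_derivative D) (at x)" by (auto simp: differentiable_def)
  have "(\<Sum>a\<in>Basis. \<Sum>b\<in>Basis. (p y \<bullet> a) *\<^sub>R (q y \<bullet> b) *\<^sub>R B y a b) = B y (p y) (q y)"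
    if "y \<in> N" for y
  proof -
    have "B y (p y) (q y) = B y (\<Sum>a\<in>Basis. (p y \<bullet> a) *\<^sub>R a) (\<Sum>b\<in>Basis. (q y \<bullet> b) *\<^sub>R b)"
      by (simp add: euclidean_representation)
    thus ?thesis
      by (simp add: bilinear_sum[OF B[OF that]] sum.cartesian_product case_prod_unfold
          bilinear_lmul[OF B[OF that]] bilinear_rmul[OF B[OF that]] mult.commute)
  qed
  with D N have "((\<lambda>y. B y (p y) (q y)) has_derivative D) (at x)"
    by (elim has_derivative_transform_within_open) auto
  thus ?thesis by (auto simp: differentiable_def)
qed

lemma differentiable_tensor_2:
  fixes T :: "vec8 \<Rightarrow> tensor"
  assumes N: "open N" "x \<in> N" and T: "\<And>y. y \<in> N \<Longrightarrow> multilinear_tensor 2 (T y)"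
    and T': "\<And>vs. length vs = 2 \<Longrightarrow> (\<lambda>y. T y vs) differentiable (at x)"
    and p: "p differentiable (at x)" and q: "q differentiable (at x)"
  shows "(\<lambda>y. T y [p y, q y]) differentiable (at x)"
proof -
  have "(\<lambda>y. if i = (0::nat) then p y else q y) differentiable (at x)" for i
    using p q by (cases "i = 0") auto
  hence "(\<lambda>y. T y (map (\<lambda>i. if i = 0 then p y else q y) [0..<2])) differentiable (at x)"
    using multilinear_tensor_has_derivative[OF N T T', of "\<lambda>y i. if i = 0 then p y else q y"]
    unfolding differentiable_def by blast
  thus ?thesis by (simp add: upt_rec)
qed


section \<open>Locally conformal parallel structures in an adapted frame\<close>

lemma alternating_form_4_front:
  assumes "alternating_form 4 \<phi>"
  shows "\<phi> [p, X, q, r] = - \<phi> [X, p, q, r]" "\<phi> [p, q, X, r] = \<phi> [X, p, q, r]"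
    "\<phi> [p, q, r, X] = - \<phi> [X, p, q, r]"
proof -
  have s1: "\<phi> [a, b, c, d] = - \<phi> [b, a, c, d]" for a b c d
    using alternating_form_swap[OF assms, of "[b, a, c, d]" 0 1] by simp
  have s2: "\<phi> [a, b, c, d] = - \<phi> [a, c, b, d]" for a b c d
    using alternating_form_swap[OF assms, of "[a, c, b, d]" 1 2] by (simp add: numeral_2_eq_2)
  have s3: "\<phi> [a, b, c, d] = - \<phi> [a, b, d, c]" for a b c d
    using alternating_form_swap[OF assms, of "[a, b, d, c]" 2 3] by (simp add: numeral_2_eq_2 numeral_3_eq_3)
  show 1: "\<phi> [p, X, q, r] = - \<phi> [X, p, q, r]" by (rule s1)
  show 2: "\<phi> [p, q, X, r] = \<phi> [X, p, q, r]" using s2[of p q X r] s1[of p X q r] by linarith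
  show "\<phi> [p, q, r, X] = - \<phi> [X, p, q, r]"
    using s3[of p q r X] s2[of p q X r] s1[of p X q r] by linarith
qed

lemma affine_connectionD:
  assumes "affine_connection A C" "c \<in> A"
  shows "x \<in> coords c \<Longrightarrow> bilinear (C c x)" "smooth_on (coords c) (\<lambda>x. C c x u v)"
  using assms unfolding affine_connection_def by simp_all

locale lcp_frame =
  fixes A :: "'a chart set" and g \<Phi> :: "'a tensor_field" and nabla D :: "'a connection"
    and c :: "'a chart" and N :: "vec8 set" and E :: "vec8 \<Rightarrow> basis8"
  assumes chart: "c \<in> A" and frame: "adapted_local_frame g \<Phi> c N E"
    and metric: "riemannian_metric A g" and form: "differential_form A 4 \<Phi>"
    and lcp: "locally_conformal_parallel A g \<Phi>" and lc: "levi_civita A g nabla"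
    and minimal: "minimal_spin7_connection A g \<Phi> nabla D"
begin

abbreviation "\<theta> \<equiv> lee_form g \<Phi> c"

abbreviation "\<xi> \<equiv> intrinsic_torsion nabla D c"

abbreviation "r \<equiv> torsion_square g (intrinsic_torsion nabla D) c"

definition "DE x i u = frechet_derivative (\<lambda>y. E y i) (at x) u + D c x u (E x i)"

section \<open>Regularity of the given data on the domain of the frame\<close>

lemma open_N: "open N" and N_coords: "x \<in> N \<Longrightarrow> x \<in> coords c"
  and adapted: "x \<in> N \<Longrightarrow> adapted_basis (g c x) (\<Phi> c x) (E x)"
  and E_diff: "x \<in> N \<Longrightarrow> (\<lambda>y. E y i) differentiable (at x)"
  using frame smooth_on_differentiable unfolding adapted_local_frame_def by blast+

lemma onb: "x \<in> N \<Longrightarrow> orthonormal_basis (g c x) (E x)"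
  using adapted by (simp add: adapted_basis_def)

lemma E_orthonormal: "x \<in> N \<Longrightarrow> g c x [E x i, E x j] = (if i = j then 1 else 0)"
  using onb by (simp add: orthonormal_basis_def)

lemma g_ml: "x \<in> N \<Longrightarrow> multilinear_tensor 2 (g c x)"
  and g_diff: "x \<in> N \<Longrightarrow> length vs = 2 \<Longrightarrow> (\<lambda>y. g c y vs) differentiable (at x)"
  and g_sym: "x \<in> N \<Longrightarrow> g c x [u, v] = g c x [v, u]"
  using metric chart N_coords smooth_on_differentiable
  unfolding riemannian_metric_def smooth_tensor_field_def by blast+

lemma \<Phi>_alt: "x \<in> N \<Longrightarrow> alternating_form 4 (\<Phi> c x)"
  and \<Phi>_ml: "x \<in> N \<Longrightarrow> multilinear_tensor 4 (\<Phi> c x)"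
  and \<Phi>_diff: "x \<in> N \<Longrightarrow> length vs = 4 \<Longrightarrow> (\<lambda>y. \<Phi> c y vs) differentiable (at x)"
  using form chart N_coords smooth_on_differentiable
  unfolding differential_form_def smooth_tensor_field_def by blast+

lemma connections: "affine_connection A nabla" "affine_connection A D"
  using lc minimal by (simp_all add: levi_civita_def minimal_spin7_connection_def)

lemma D_bilinear: "x \<in> N \<Longrightarrow> bilinear (D c x)"
  and nabla_bilinear: "x \<in> N \<Longrightarrow> bilinear (nabla c x)"
  and D_diff: "x \<in> N \<Longrightarrow> (\<lambda>y. D c y u v) differentiable (at x)"
  and nabla_diff: "x \<in> N \<Longrightarrow> (\<lambda>y. nabla c y u v) differentiable (at x)"
  using affine_connectionD[OF connections(1) chart] affine_connectionD[OF connections(2) chart]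
    N_coords smooth_on_differentiable by blast+

lemma nabla_sym: "x \<in> N \<Longrightarrow> nabla c x u v = nabla c x v u"
  using lc chart N_coords unfolding levi_civita_def by blast

lemma \<xi>_bilinear: "x \<in> N \<Longrightarrow> bilinear (\<xi> x)"
  using D_bilinear[of x] nabla_bilinear[of x] linear_compose_sub
  unfolding bilinear_def intrinsic_torsion_def by blast

lemma \<xi>_diff: "x \<in> N \<Longrightarrow> (\<lambda>y. \<xi> y u v) differentiable (at x)"
  unfolding intrinsic_torsion_def by (intro differentiable_diff D_diff nabla_diff)

lemma D_linear: "x \<in> N \<Longrightarrow> linear (D c x u)"
  using D_bilinear by (simp add: bilinear_def)

lemma expand: "x \<in> N \<Longrightarrow> v = (\<Sum>i\<in>UNIV. g c x [E x i, v] *\<^sub>R E x i)"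
  by (rule orthonormal_basis_expansion[OF g_ml onb])

section \<open>Connection forms and the minimal connection\<close>

definition "connection_endo C x u v =
  (\<Sum>j\<in>UNIV. g c x [E x j, v] *\<^sub>R (frechet_derivative (\<lambda>y. E y j) (at x) u + C x u (E x j)))"

lemma connection_form_endo:
  assumes "x \<in> N"
  shows "connection_form (g c) C E x u = (\<lambda>vs. g c x [connection_endo C x u (vs ! 0), vs ! 1])"
proof -
  note lin = multilinear_tensor_2(1)[OF g_ml[OF assms]]
  show ?thesis
    by (simp add: fun_eq_iff connection_form_def connection_endo_def coframe_def linear_sum[OF lin]
        linear_cmul[OF lin])
qed

lemma connection_endo_linear: "x \<in> N \<Longrightarrow> linear (connection_endo C x u)"
  unfolding connection_endo_def
  by (intro linear_compose_sum[rule_format])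
    (auto intro!: linearI simp: linear_add[OF multilinear_tensor_2(2)[OF g_ml]]
      linear_cmul[OF multilinear_tensor_2(2)[OF g_ml]] scaleR_left_distrib)

lemma connection_endo_E: "x \<in> N \<Longrightarrow> connection_endo (D c) x u (E x i) = DE x i u"
  by (simp add: connection_endo_def E_orthonormal DE_def if_distrib[of "\<lambda>t. t *\<^sub>R _"] cong: if_cong)

lemma connection_component:
  assumes "x \<in> N"
  shows "is_spin7_component (g c x) (\<Phi> c x) (connection_form (g c) (nabla c) E x u)
    (connection_form (g c) (D c) E x u)"
  using minimal chart frame assms unfolding minimal_spin7_connection_def by blast

lemma D_endo_Lambda2_21:
  "x \<in> N \<Longrightarrow> (\<lambda>vs. g c x [connection_endo (D c) x u (vs ! 0), vs ! 1]) \<in> Lambda2_21 (g c x) (\<Phi> c x)"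
  using connection_component connection_form_endo by (simp add: is_spin7_component_def)

text \<open>The minimal connection is metric, because its connection form is alternating.\<close>

lemma DE_skew: "x \<in> N \<Longrightarrow> g c x [DE x i u, E x j] = - g c x [DE x j u, E x i]"
  using alternating_form_2_skew[of "\<lambda>vs. g c x [connection_endo (D c) x u (vs ! 0), vs ! 1]" "E x i" "E x j"]
    D_endo_Lambda2_21[of x u] by (simp add: Lambda2_21_def connection_endo_E)

text \<open>In the difference of the two connection forms the derivatives of the frame cancel, which
  leaves -\<xi>.\<close>

lemma \<xi>_Lambda2_7:
  assumes x: "x \<in> N"
  shows "(\<lambda>vs. - g c x [\<xi> x u (vs ! 0), vs ! 1]) \<in> Lambda2_7 (g c x) (\<Phi> c x)"
proof -
  note lin = multilinear_tensor_2(1)[OF g_ml[OF x]]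
  have \<xi>lin: "linear (\<xi> x u)" using \<xi>_bilinear[OF x] by (simp add: bilinear_def)
  have "connection_endo (nabla c) x u v - connection_endo (D c) x u v = - \<xi> x u v" for v
  proof -
    have "connection_endo (nabla c) x u v - connection_endo (D c) x u v =
        - (\<Sum>j\<in>UNIV. g c x [E x j, v] *\<^sub>R \<xi> x u (E x j))"
      by (simp add: connection_endo_def intrinsic_torsion_def sum_subtractf[symmetric]
          sum_negf[symmetric] scaleR_diff_right[symmetric] flip: scaleR_minus_right)
    also have "(\<Sum>j\<in>UNIV. g c x [E x j, v] *\<^sub>R \<xi> x u (E x j)) =
        \<xi> x u (\<Sum>j\<in>UNIV. g c x [E x j, v] *\<^sub>R E x j)"
      by (simp add: linear_sum[OF \<xi>lin] linear_cmul[OF \<xi>lin])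
    also have "\<dots> = \<xi> x u v" by (simp only: expand[OF x, symmetric])
    finally show ?thesis .
  qed
  hence "g c x [connection_endo (nabla c) x u v, w] - g c x [connection_endo (D c) x u v, w] =
      - g c x [\<xi> x u v, w]" for v w
    using linear_diff[OF lin] linear_neg[OF lin] by metis
  thus ?thesis
    using connection_component[OF x, of u] connection_form_endo[OF x]
    by (simp add: is_spin7_component_def)
qed

text \<open>In an adapted frame the components of \<Phi> are constant. Their zero derivative is the
  covariant derivative plus the action of the connection endomorphism on \<Phi>, and the latter
  vanishes by \<open>Lambda2_21_annihilates\<close>.\<close>

lemma \<Phi>_parallel:
  assumes x: "x \<in> N" and len: "length vs = 4"
  shows "cov_deriv (D c) 4 (\<Phi> c) x u vs = 0"
proof (rule multilinear_tensor_eq_0[OF _ _ _ len])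
  show "multilinear_tensor 4 (cov_deriv (D c) 4 (\<Phi> c) x u)"
    by (rule multilinear_tensor_cov_deriv[where C = "D c" and T = "\<Phi> c" and k = 4,
          OF open_N x \<Phi>_ml \<Phi>_diff[OF x] D_linear[OF x]])
  show "\<exists>k. v = (\<Sum>i\<in>UNIV. k i *\<^sub>R E x i)" for v
    using expand[OF x, of v] by (rule exI[of _ "\<lambda>i. g c x [E x i, v]"])
next
  fix I :: "8 list" assume I: "length I = 4"
  note der = has_derivative_frame[where T = "\<Phi> c" and E = E and C = "D c",
      OF open_N x \<Phi>_ml \<Phi>_diff[OF x] E_diff[OF x] I, folded DE_def]
  obtain a b e d where abcd: "a < 8" "b < 8" "e < 8" "d < 8" and Inat: "I = map of_nat [a, b, e, d]"
    using I by (rule list_8_of_nat)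
  have "((\<lambda>y. \<Phi> c y (map (E y) I)) has_derivative (\<lambda>u. 0)) (at x)"
  proof (rule has_derivative_transform_within_open[OF _ open_N x])
    show "((\<lambda>y. real_of_int (spin7_coeff a b e d)) has_derivative (\<lambda>u. 0)) (at x)" by simp
  qed (use adapted_basis_coeff[OF adapted abcd] Inat in simp)
  from fun_cong[OF has_derivative_unique[OF der this], of u]
  have "cov_deriv (D c) 4 (\<Phi> c) x u (map (E x) I) +
      (\<Sum>i<4. \<Phi> c x ((map (E x) I)[i := DE x (I ! i) u])) = 0" .
  moreover have "(\<Sum>i<4. \<Phi> c x ((map (E x) I)[i := DE x (I ! i) u])) =
      (\<Sum>i<4. \<Phi> c x ((map (E x) I)[i := connection_endo (D c) x u (map (E x) I ! i)]))"
    using I by (intro sum.cong refl) (simp add: connection_endo_E[OF x])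
  moreover have "\<dots> = 0"
    using I adapted[OF x] by (intro Lambda2_21_annihilates[OF g_ml[OF x] g_sym[OF x] \<Phi>_ml[OF x] _
        connection_endo_linear[OF x] D_endo_Lambda2_21[OF x]]) auto
  ultimately show "cov_deriv (D c) 4 (\<Phi> c) x u (map (E x) I) = 0" by simp
qed

text \<open>The minimal connection is split into \<xi> and Levi-Civita. The Levi-Civita terms are
  brought to the first slot so that their cancellation in the exterior derivative becomes
  syntactic.\<close>

lemma \<Phi>_deriv:
  assumes x: "x \<in> N"
  shows "frechet_derivative (\<lambda>y. \<Phi> c y [p, q, s, t]) (at x) u =
    (\<Phi> c x [\<xi> x u p, q, s, t] + \<Phi> c x [p, \<xi> x u q, s, t] + \<Phi> c x [p, q, \<xi> x u s, t] +
     \<Phi> c x [p, q, s, \<xi> x u t]) +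
    (\<Phi> c x [nabla c x u p, q, s, t] - \<Phi> c x [nabla c x u q, p, s, t] +
     \<Phi> c x [nabla c x u s, p, q, t] - \<Phi> c x [nabla c x u t, p, q, s])"
proof -
  have Dsum: "D c x u v = \<xi> x u v + nabla c x u v" for v by (simp add: intrinsic_torsion_def)
  note app = linear_add[OF multilinear_tensor_append[OF \<Phi>_ml[OF x]]]
  have "frechet_derivative (\<lambda>y. \<Phi> c y [p, q, s, t]) (at x) u =
      (\<Sum>i<4. \<Phi> c x ([p, q, s, t][i := D c x u ([p, q, s, t] ! i)]))"
    using \<Phi>_parallel[OF x, of "[p, q, s, t]" u] by (simp add: cov_deriv_def)
  also have "\<dots> = \<Phi> c x [D c x u p, q, s, t] + \<Phi> c x [p, D c x u q, s, t] +
      \<Phi> c x [p, q, D c x u s, t] + \<Phi> c x [p, q, s, D c x u t]"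
    by (simp add: eval_nat_numeral)
  also have "\<Phi> c x [D c x u p, q, s, t] = \<Phi> c x [\<xi> x u p, q, s, t] + \<Phi> c x [nabla c x u p, q, s, t]"
    using app[of "[]" "[q, s, t]"] by (simp add: Dsum)
  also have "\<Phi> c x [p, D c x u q, s, t] = \<Phi> c x [p, \<xi> x u q, s, t] - \<Phi> c x [nabla c x u q, p, s, t]"
    using app[of "[p]" "[s, t]"] alternating_form_4_front(1)[OF \<Phi>_alt[OF x], of p "nabla c x u q"]
    by (simp add: Dsum)
  also have "\<Phi> c x [p, q, D c x u s, t] = \<Phi> c x [p, q, \<xi> x u s, t] + \<Phi> c x [nabla c x u s, p, q, t]"
    using app[of "[p, q]" "[t]"] alternating_form_4_front(2)[OF \<Phi>_alt[OF x], of p q "nabla c x u s"]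
    by (simp add: Dsum)
  also have "\<Phi> c x [p, q, s, D c x u t] = \<Phi> c x [p, q, s, \<xi> x u t] - \<Phi> c x [nabla c x u t, p, q, s]"
    using app[of "[p, q, s]" "[]"] alternating_form_4_front(3)[OF \<Phi>_alt[OF x], of p q s "nabla c x u t"]
    by (simp add: Dsum)
  finally show ?thesis by simp
qed

text \<open>In the alternating sum the Levi-Civita terms for a pair of arguments occur twice with
  opposite signs, since the Christoffel symbols are symmetric. Only \<xi> survives.\<close>

lemma \<xi>_alternation:
  assumes x: "x \<in> N"
  defines "\<phi> \<equiv> \<Phi> c x" and "X \<equiv> \<xi> x"
  shows "(\<phi> [X a b, k, d, e] + \<phi> [b, X a k, d, e] + \<phi> [b, k, X a d, e] + \<phi> [b, k, d, X a e]) -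
      (\<phi> [X b a, k, d, e] + \<phi> [a, X b k, d, e] + \<phi> [a, k, X b d, e] + \<phi> [a, k, d, X b e]) +
      (\<phi> [X k a, b, d, e] + \<phi> [a, X k b, d, e] + \<phi> [a, b, X k d, e] + \<phi> [a, b, d, X k e]) -
      (\<phi> [X d a, b, k, e] + \<phi> [a, X d b, k, e] + \<phi> [a, b, X d k, e] + \<phi> [a, b, k, X d e]) +
      (\<phi> [X e a, b, k, d] + \<phi> [a, X e b, k, d] + \<phi> [a, b, X e k, d] + \<phi> [a, b, k, X e d]) =
      wedge 1 4 (\<theta> x) \<phi> [a, b, k, d, e]"
proof -
  have "ext_deriv 4 (\<Phi> c) x [a, b, k, d, e] =
      frechet_derivative (\<lambda>y. \<Phi> c y [b, k, d, e]) (at x) a -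
      frechet_derivative (\<lambda>y. \<Phi> c y [a, k, d, e]) (at x) b +
      frechet_derivative (\<lambda>y. \<Phi> c y [a, b, d, e]) (at x) k -
      frechet_derivative (\<lambda>y. \<Phi> c y [a, b, k, e]) (at x) d +
      frechet_derivative (\<lambda>y. \<Phi> c y [a, b, k, d]) (at x) e"
    by (simp add: ext_deriv_def eval_nat_numeral)
  moreover have "ext_deriv 4 (\<Phi> c) x [a, b, k, d, e] = wedge 1 4 (\<theta> x) \<phi> [a, b, k, d, e]"
    using lcp chart N_coords[OF x] unfolding locally_conformal_parallel_def \<phi>_def by simp
  ultimately show ?thesis
    unfolding \<Phi>_deriv[OF x] \<phi>_def X_def
    using nabla_sym[OF x, of a b] nabla_sym[OF x, of a k] nabla_sym[OF x, of a d] nabla_sym[OF x, of a e]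
      nabla_sym[OF x, of b k] nabla_sym[OF x, of b d] nabla_sym[OF x, of b e]
      nabla_sym[OF x, of k d] nabla_sym[OF x, of k e] nabla_sym[OF x, of d e]
    by simp
qed

section \<open>The Lee form and the tensor \<open>r\<close> in the frame\<close>

lemma \<theta>_linear: "x \<in> N \<Longrightarrow> linear (\<lambda>v. \<theta> x [v])"
  using linear_compose_scale_right[OF linear_hodge_star_7[OF g_ml[of x]], where c = "1 / 7"]
  unfolding lee_form_def by simp

lemma torsion_formulas:
  assumes x: "x \<in> N" and G: "orthonormal_basis (g c x) G"
  shows "\<theta> x [v] = 16 / 7 * (\<Sum>i\<in>UNIV. g c x [\<xi> x (G i) (G i), v])"
    and "(\<Sum>i\<in>UNIV. g c x [\<xi> x u (G i), \<xi> x v (G i)]) =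
      ((\<Sum>i\<in>UNIV. (\<theta> x [G i])\<^sup>2) * g c x [u, v] - \<theta> x [u] * \<theta> x [v]) / 32"
proof -
  have "\<exists>F. adapted_basis (g c x) (\<Phi> c x) F" using adapted[OF x] by blast
  note * = spin7_torsion_at_point[OF g_ml[OF x] g_sym[OF x] \<Phi>_alt[OF x] this
      \<xi>_bilinear[OF x] \<theta>_linear[OF x] \<xi>_Lambda2_7[OF x] \<xi>_alternation[OF x] G]
  show "\<theta> x [v] = 16 / 7 * (\<Sum>i\<in>UNIV. g c x [\<xi> x (G i) (G i), v])"
    and "(\<Sum>i\<in>UNIV. g c x [\<xi> x u (G i), \<xi> x v (G i)]) =
      ((\<Sum>i\<in>UNIV. (\<theta> x [G i])\<^sup>2) * g c x [u, v] - \<theta> x [u] * \<theta> x [v]) / 32"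
    by (rule *)+
qed

definition "\<theta>_square x = (\<Sum>i\<in>UNIV. (\<theta> x [E x i])\<^sup>2)"

lemma r_formula:
  assumes x: "x \<in> N"
  shows "r x [u, v] = (\<theta>_square x * g c x [u, v] - \<theta> x [u] * \<theta> x [v]) / 32"
proof -
  let ?F = "SOME F. orthonormal_basis (g c x) F"
  have "\<exists>F. orthonormal_basis (g c x) F" using onb[OF x] by blast
  hence F: "orthonormal_basis (g c x) ?F" by (rule someI_ex)
  have B: "bilinear (\<lambda>a b. \<theta> x [a] * \<theta> x [b])"
    using \<theta>_linear[OF x] unfolding bilinear_def
    by (auto intro!: linearI simp: linear_add[OF \<theta>_linear[OF x]] linear_cmul[OF \<theta>_linear[OF x]] algebra_simps)
  have "(\<Sum>i\<in>UNIV. (\<theta> x [?F i])\<^sup>2) = \<theta>_square x"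
    using orthonormal_basis_trace[OF g_ml[OF x] g_sym[OF x] F onb[OF x] B]
    by (simp add: \<theta>_square_def power2_eq_square)
  thus ?thesis
    using torsion_formulas(2)[OF x F, of u v] by (simp add: torsion_square_def Let_def)
qed

lemma \<theta>_ml: "x \<in> N \<Longrightarrow> multilinear_tensor 1 (\<theta> x)"
  using \<theta>_linear by (auto simp: multilinear_tensor_def length_Suc_conv)

lemma r_ml:
  assumes x: "x \<in> N"
  shows "multilinear_tensor 2 (r x)"
  unfolding multilinear_tensor_def
proof (intro allI impI)
  fix vs :: "vec8 list" and i :: nat assume vs: "length vs = 2" "i < 2"
  then obtain u v where uv: "vs = [u, v]" by (auto simp: length_Suc_conv numeral_2_eq_2)
  have "linear (\<lambda>w. r x [w, v])" "linear (\<lambda>w. r x [u, w])"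
    using multilinear_tensor_2[OF g_ml[OF x]] \<theta>_linear[OF x] unfolding r_formula[OF x]
    by (auto intro!: linearI simp: linear_add linear_cmul linear_add[OF \<theta>_linear[OF x]]
        linear_cmul[OF \<theta>_linear[OF x]] linear_add[OF multilinear_tensor_2(1)[OF g_ml[OF x]]]
        linear_cmul[OF multilinear_tensor_2(1)[OF g_ml[OF x]]]
        linear_add[OF multilinear_tensor_2(2)[OF g_ml[OF x]]]
        linear_cmul[OF multilinear_tensor_2(2)[OF g_ml[OF x]]]
        algebra_simps add_divide_distrib diff_divide_distrib)
  thus "linear (\<lambda>w. r x (vs[i := w]))"
    using vs uv by (cases i) (auto simp: less_Suc_eq)
qed


text \<open>The definition of \<theta> passes through bases picked at each point and shows no
  regularity. The trace formula in the smooth frame \<open>E\<close> supplies it.\<close>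

lemma \<theta>_diff:
  assumes x: "x \<in> N" and len: "length vs = 1"
  shows "(\<lambda>y. \<theta> y vs) differentiable (at x)"
proof -
  obtain v where v: "vs = [v]" using len by (auto simp: length_Suc_conv)
  have "(\<lambda>y. 16 / 7 * (\<Sum>i\<in>UNIV. g c y [\<xi> y (E y i) (E y i), v])) differentiable (at x)"
    by (intro differentiable_mult differentiable_const differentiable_sum finite ballI
        differentiable_tensor_2[OF open_N x g_ml g_diff[OF x]]
        differentiable_bilinear_family[OF open_N x \<xi>_bilinear \<xi>_diff[OF x]] E_diff[OF x])
  then obtain F where "((\<lambda>y. 16 / 7 * (\<Sum>i\<in>UNIV. g c y [\<xi> y (E y i) (E y i), v])) has_derivative F) (at x)"
    by (auto simp: differentiable_def)
  hence "((\<lambda>y. \<theta> y [v]) has_derivative F) (at x)"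
    by (rule has_derivative_transform_within_open[OF _ open_N x]) (rule torsion_formulas(1)[OF _ onb, symmetric])
  thus ?thesis using v by (auto simp: differentiable_def)
qed

lemma \<theta>_frame_derivative:
  assumes x: "x \<in> N"
  shows "((\<lambda>y. \<theta> y [E y i]) has_derivative
    (\<lambda>u. cov_deriv (D c) 1 \<theta> x u [E x i] + \<theta> x [DE x i u])) (at x)"
  using has_derivative_frame[where T = \<theta> and E = E and C = "D c" and I = "[i]",
      OF open_N x \<theta>_ml \<theta>_diff[OF x] E_diff[OF x], folded DE_def] by simp

lemma \<theta>_DE: "x \<in> N \<Longrightarrow> \<theta> x [DE x i u] = (\<Sum>j\<in>UNIV. g c x [DE x i u, E x j] * \<theta> x [E x j])"
proof -
  assume x: "x \<in> N"
  note lin = \<theta>_linear[OF x]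
  have "\<theta> x [DE x i u] = \<theta> x [\<Sum>j\<in>UNIV. g c x [E x j, DE x i u] *\<^sub>R E x j]"
    by (simp only: expand[OF x, symmetric])
  thus ?thesis by (simp add: linear_sum[OF lin] linear_cmul[OF lin] g_sym[OF x, of _ "E x _"])
qed

lemma \<theta>_square_derivative:
  assumes x: "x \<in> N"
  shows "(\<theta>_square has_derivative
    (\<lambda>u. 2 * (\<Sum>i\<in>UNIV. \<theta> x [E x i] * cov_deriv (D c) 1 \<theta> x u [E x i]))) (at x)"
proof -
  let ?t = "\<lambda>i. \<theta> x [E x i]"
  have der: "(\<theta>_square has_derivative (\<lambda>u. \<Sum>i\<in>UNIV. 2 *
      (cov_deriv (D c) 1 \<theta> x u [E x i] + \<theta> x [DE x i u]) * ?t i)) (at x)"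
    unfolding \<theta>_square_def[abs_def]
    by (auto intro!: derivative_eq_intros \<theta>_frame_derivative[OF x])
  have "(\<Sum>i\<in>UNIV. ?t i * \<theta> x [DE x i u]) = 0" for u
  proof -
    let ?S = "\<Sum>i\<in>UNIV. \<Sum>j\<in>UNIV. g c x [DE x i u, E x j] * (?t i * ?t j)"
    \<comment> \<open>A skew matrix is paired with a symmetric one; exchanging the summations gives
      \<open>?S = - ?S\<close>.\<close>
    have "?S = (\<Sum>i\<in>UNIV. \<Sum>j\<in>UNIV. - (g c x [DE x j u, E x i] * (?t j * ?t i)))"
      by (intro sum.cong refl) (subst DE_skew[OF x], simp)
    also have "\<dots> = - ?S" by (subst sum.swap) (simp add: sum_negf)
    finally have "?S = 0" by simp
    moreover have "(\<Sum>i\<in>UNIV. ?t i * \<theta> x [DE x i u]) = ?S"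
      by (simp add: \<theta>_DE[OF x] sum_distrib_left mult_ac)
    ultimately show ?thesis by simp
  qed
  hence "(\<Sum>i\<in>UNIV. 2 * (cov_deriv (D c) 1 \<theta> x u [E x i] + \<theta> x [DE x i u]) * ?t i) =
      2 * (\<Sum>i\<in>UNIV. ?t i * cov_deriv (D c) 1 \<theta> x u [E x i])" for u
  proof -
    have "(\<Sum>i\<in>UNIV. 2 * (cov_deriv (D c) 1 \<theta> x u [E x i] + \<theta> x [DE x i u]) * ?t i) =
      2 * (\<Sum>i\<in>UNIV. ?t i * cov_deriv (D c) 1 \<theta> x u [E x i]) + 2 * (\<Sum>i\<in>UNIV. ?t i * \<theta> x [DE x i u])"
      by (simp add: sum_distrib_left sum.distrib[symmetric] algebra_simps)
    thus ?thesis using \<open>(\<Sum>i\<in>UNIV. ?t i * \<theta> x [DE x i u]) = 0\<close> by simp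
  qed
  thus ?thesis using der by simp
qed

lemma r_diff:
  assumes x: "x \<in> N" and len: "length vs = 2"
  shows "(\<lambda>y. r y vs) differentiable (at x)"
proof -
  obtain u v where uv: "vs = [u, v]" using len by (auto simp: length_Suc_conv numeral_2_eq_2)
  have "\<theta>_square differentiable (at x)"
    using \<theta>_square_derivative[OF x] by (auto simp: differentiable_def)
  hence "(\<lambda>y. (\<theta>_square y * g c y [u, v] - \<theta> y [u] * \<theta> y [v]) / 32) differentiable (at x)"
    by (intro differentiable_divide differentiable_diff differentiable_mult g_diff[OF x] \<theta>_diff[OF x]
        differentiable_const) simp_all
  then obtain F where "((\<lambda>y. (\<theta>_square y * g c y [u, v] - \<theta> y [u] * \<theta> y [v]) / 32) has_derivative F) (at x)"
    by (auto simp: differentiable_def)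
  hence "((\<lambda>y. r y [u, v]) has_derivative F) (at x)"
    by (rule has_derivative_transform_within_open[OF _ open_N x]) (rule r_formula[symmetric])
  thus ?thesis using uv by (auto simp: differentiable_def)
qed

text \<open>The function r(E_i, E_j) is differentiated twice: by the Leibniz rule, and from
  \<open>r_formula\<close>. The terms with \<open>DE\<close> agree because the frame derivative is
  skew, and comparison gives the covariant derivative.\<close>

lemma cov_deriv_r:
  assumes x: "x \<in> N"
  defines "\<eta> \<equiv> \<lambda>u i. cov_deriv (D c) 1 \<theta> x u [E x i]"
  shows "cov_deriv (D c) 2 r x u [E x i, E x j] =
    ((if i = j then 2 * (\<Sum>k\<in>UNIV. \<theta> x [E x k] * \<eta> u k) else 0) -
     \<eta> u i * \<theta> x [E x j] - \<theta> x [E x i] * \<eta> u j) / 32"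
proof -
  let ?N' = "\<lambda>u. 2 * (\<Sum>k\<in>UNIV. \<theta> x [E x k] * \<eta> u k)"
  let ?d = "if i = j then 1 else 0 :: real"
  have "((\<lambda>y. r y [E y i, E y j]) has_derivative (\<lambda>u. cov_deriv (D c) 2 r x u [E x i, E x j] +
      (r x [DE x i u, E x j] + r x [E x i, DE x j u]))) (at x)"
    using has_derivative_frame[where T = r and E = E and C = "D c" and I = "[i, j]",
        OF open_N x r_ml r_diff[OF x] E_diff[OF x], folded DE_def]
    by (simp add: numeral_2_eq_2)
  moreover have "((\<lambda>y. r y [E y i, E y j]) has_derivative (\<lambda>u. (?N' u * ?d -
      ((\<eta> u i + \<theta> x [DE x i u]) * \<theta> x [E x j] + \<theta> x [E x i] * (\<eta> u j + \<theta> x [DE x j u]))) / 32)) (at x)"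
  proof (rule has_derivative_transform_within_open[OF _ open_N x])
    show "((\<lambda>y. (\<theta>_square y * ?d - \<theta> y [E y i] * \<theta> y [E y j]) / 32) has_derivative (\<lambda>u. (?N' u * ?d -
      ((\<eta> u i + \<theta> x [DE x i u]) * \<theta> x [E x j] + \<theta> x [E x i] * (\<eta> u j + \<theta> x [DE x j u]))) / 32)) (at x)"
      unfolding \<eta>_def
      by (auto intro!: derivative_eq_intros \<theta>_frame_derivative[OF x] \<theta>_square_derivative[OF x]
          simp: fun_eq_iff field_simps)
  qed (simp add: r_formula E_orthonormal)
  ultimately have "cov_deriv (D c) 2 r x u [E x i, E x j] +
      (r x [DE x i u, E x j] + r x [E x i, DE x j u]) = (?N' u * ?d -
      ((\<eta> u i + \<theta> x [DE x i u]) * \<theta> x [E x j] + \<theta> x [E x i] * (\<eta> u j + \<theta> x [DE x j u]))) / 32"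
    by (rule fun_cong[OF has_derivative_unique])
  moreover have "g c x [DE x i u, E x j] + g c x [E x i, DE x j u] = 0"
    using DE_skew[OF x, of i u j] g_sym[OF x, of "E x i" "DE x j u"] by simp
  hence "r x [DE x i u, E x j] + r x [E x i, DE x j u] =
      - (\<theta> x [DE x i u] * \<theta> x [E x j] + \<theta> x [E x i] * \<theta> x [DE x j u]) / 32"
    unfolding r_formula[OF x] by (simp add: field_simps flip: distrib_left)
  ultimately show ?thesis by (cases "i = j"; simp add: field_simps; linarith?)
qed

lemma frame_expansion: "x \<in> N \<Longrightarrow> \<exists>k. v = (\<Sum>i\<in>UNIV. k i *\<^sub>R E x i)"
  using expand[of x v] by (intro exI[of _ "\<lambda>i. g c x [E x i, v]"])

lemma r_parallel_if:
  assumes x: "x \<in> N" and 0: "\<And>v. cov_deriv (D c) 1 \<theta> x u [v] = 0" and len: "length vs = 2"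
  shows "cov_deriv (D c) 2 r x u vs = 0"
proof (rule multilinear_tensor_eq_0[OF _ frame_expansion[OF x] _ len])
  show "multilinear_tensor 2 (cov_deriv (D c) 2 r x u)"
    by (rule multilinear_tensor_cov_deriv[where C = "D c" and T = r and k = 2,
          OF open_N x r_ml r_diff[OF x] D_linear[OF x]])
  fix I :: "8 list" assume "length I = 2"
  then obtain i j where "I = [i, j]" by (auto simp: length_Suc_conv numeral_2_eq_2)
  thus "cov_deriv (D c) 2 r x u (map (E x) I) = 0" by (simp add: cov_deriv_r[OF x] 0 del: One_nat_def)
qed

text \<open>In contrast to \<open>r_parallel_if\<close>, which works at a single point, the
  assumption ranges over all of \<open>N\<close>: at a zero of \<theta> the algebraic equations are
  void, and constancy of |\<theta>|^2 on a neighbourhood is used.\<close>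

lemma \<theta>_parallel_if:
  assumes x: "x \<in> N" and 0: "\<And>y u vs. y \<in> N \<Longrightarrow> length vs = 2 \<Longrightarrow> cov_deriv (D c) 2 r y u vs = 0"
    and len: "length vs = 1"
  shows "cov_deriv (D c) 1 \<theta> x u vs = 0"
proof -
  let ?\<eta> = "\<lambda>y u i. cov_deriv (D c) 1 \<theta> y u [E y i]"
  have N'0: "(\<Sum>k\<in>UNIV. \<theta> y [E y k] * ?\<eta> y u k) = 0" if y: "y \<in> N" for y u
  proof -
    let ?S = "\<Sum>k\<in>UNIV. \<theta> y [E y k] * ?\<eta> y u k"
    have "0 = (\<Sum>i\<in>UNIV. 32 * cov_deriv (D c) 2 r y u [E y i, E y i])" using 0 y by simp
    also have "\<dots> = (\<Sum>i\<in>(UNIV :: 8 set). 2 * ?S - 2 * (\<theta> y [E y i] * ?\<eta> y u i))"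
      by (intro sum.cong refl) (simp add: cov_deriv_r[OF y])
    \<comment> \<open>Trace over the eight diagonal entries: the metric part gives 16 and the
      \<theta>-part -2.\<close>
    also have "\<dots> = 14 * ?S" by (simp add: sum_subtractf flip: sum_distrib_left)
    finally show ?thesis by simp
  qed
  have sym0: "?\<eta> x u i * \<theta> x [E x j] + \<theta> x [E x i] * ?\<eta> x u j = 0" for i j
    using cov_deriv_r[OF x, of u i j] 0[OF x, of "[E x i, E x j]" u] N'0[OF x, of u]
    by (simp split: if_splits)
  have \<eta>0: "?\<eta> x u i = 0" for i
  proof (cases "\<exists>j. \<theta> x [E x j] \<noteq> 0")
    case True
    then obtain j where j: "\<theta> x [E x j] \<noteq> 0" by blast
    \<comment> \<open>The diagonal equation at an index where \<theta> is nonzero comes first; the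
      mixed equations then give the remaining components.\<close>
    have "?\<eta> x u j = 0" using sym0[of j j] j by simp
    thus ?thesis using sym0[of i j] j by simp
  next
    case False
    obtain e where e: "e > 0" "ball x e \<subseteq> N" using open_N x by (meson openE)
    \<comment> \<open>Here \<theta> vanishes at \<open>x\<close>, so constancy of the squared norm
      makes it vanish on the ball, and its derivative at \<open>x\<close> is zero.\<close>
    have "\<exists>k. \<forall>y\<in>ball x e. \<theta>_square y = k"
    proof (rule has_derivative_zero_constant[OF convex_ball])
      fix y assume "y \<in> ball x e"
      hence y: "y \<in> N" using e by blast
      show "(\<theta>_square has_derivative (\<lambda>u. 0)) (at y within ball x e)"
        using has_derivative_at_withinI[OF \<theta>_square_derivative[OF y]] N'0[OF y] by simp
    qed
    then obtain k where k: "\<And>y. y \<in> ball x e \<Longrightarrow> \<theta>_square y = k" by blast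
    have "\<theta>_square x = 0" using False by (simp add: \<theta>_square_def)
    hence "\<theta>_square y = 0" if "y \<in> ball x e" for y using k[OF that] k[of x] e by simp
    hence "\<theta> y [E y i] = 0" if "y \<in> ball x e" for y
      using that unfolding \<theta>_square_def by (simp add: sum_nonneg_eq_0_iff)
    hence "((\<lambda>y. \<theta> y [E y i]) has_derivative (\<lambda>u. 0)) (at x)"
      using e by (intro has_derivative_transform_within_open[OF has_derivative_const open_ball, of x x e]) auto
    from fun_cong[OF has_derivative_unique[OF \<theta>_frame_derivative[OF x] this], of u]
    have "?\<eta> x u i + \<theta> x [DE x i u] = 0" .
    thus ?thesis using \<theta>_DE[OF x, of i u] False by simp
  qed
  show ?thesis
  proof (rule multilinear_tensor_eq_0[OF _ frame_expansion[OF x] _ len])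
    show "multilinear_tensor 1 (cov_deriv (D c) 1 \<theta> x u)"
      by (rule multilinear_tensor_cov_deriv[where C = "D c" and T = \<theta> and k = 1,
            OF open_N x \<theta>_ml \<theta>_diff[OF x] D_linear[OF x]])
    fix I :: "8 list" assume "length I = 1"
    then obtain i where "I = [i]" by (auto simp: length_Suc_conv)
    thus "cov_deriv (D c) 1 \<theta> x u (map (E x) I) = 0" using \<eta>0 by simp
  qed
qed

end

section \<open>From adapted frames to all charts\<close>

theorem theorem3p3:
  fixes M :: "'a::{t2_space,second_countable_topology} set"
    and A :: "'a chart set"
    and g \<Phi> :: "'a tensor_field"
    and nabla D :: "'a connection"
  assumes "spin7_structure M A g \<Phi>"
    and "locally_conformal_parallel A g \<Phi>"
    and "levi_civita A g nabla"
    and "minimal_spin7_connection A g \<Phi> nabla D"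
  shows "second_order_nearly_parallel A g nabla D \<longleftrightarrow>
         parallel_tensor A D 1 (lee_form g \<Phi>)"
proof -
  have frame: "\<exists>N E. x \<in> N \<and> lcp_frame A g \<Phi> nabla D c N E" if "c \<in> A" "x \<in> coords c" for c x
  proof -
    obtain N E where "x \<in> N" "adapted_local_frame g \<Phi> c N E"
      using assms(1) \<open>c \<in> A\<close> \<open>x \<in> coords c\<close> unfolding spin7_structure_def by blast
    thus ?thesis
      using assms \<open>c \<in> A\<close> by (auto simp: lcp_frame_def spin7_structure_def)
  qed
  show ?thesis
  proof
    assume r: "second_order_nearly_parallel A g nabla D"
    show "parallel_tensor A D 1 (lee_form g \<Phi>)"
      unfolding parallel_tensor_def
    proof (intro ballI allI impI)
      fix c x u and vs :: "vec8 list"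
      assume c: "c \<in> A" "x \<in> coords c" and vs: "length vs = 1"
      obtain N E where x: "x \<in> N" and "lcp_frame A g \<Phi> nabla D c N E" using frame[OF c] by blast
      then interpret lcp_frame A g \<Phi> nabla D c N E by simp
      show "cov_deriv (D c) 1 (lee_form g \<Phi> c) x u vs = 0"
        using r c(1) N_coords unfolding second_order_nearly_parallel_def parallel_tensor_def
        by (intro \<theta>_parallel_if[OF x _ vs]) blast
    qed
  next
    assume \<theta>: "parallel_tensor A D 1 (lee_form g \<Phi>)"
    show "second_order_nearly_parallel A g nabla D"
      unfolding second_order_nearly_parallel_def parallel_tensor_def
    proof (intro ballI allI impI)
      fix c x u and vs :: "vec8 list"
      assume c: "c \<in> A" "x \<in> coords c" and vs: "length vs = 2"
      obtain N E where x: "x \<in> N" and "lcp_frame A g \<Phi> nabla D c N E" using frame[OF c] by blast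
      then interpret lcp_frame A g \<Phi> nabla D c N E by simp
      show "cov_deriv (D c) 2 (torsion_square g (intrinsic_torsion nabla D) c) x u vs = 0"
        using \<theta> c unfolding parallel_tensor_def by (intro r_parallel_if[OF x _ vs]) simp
    qed
  qed
qed

end
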